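(* Let $G$ be a connected unicyclic graph that is not a cycle, and let $C_n$ be its unique cycle (of length $n$). Then $\operatorname{reg}(I(G))=\nu(G)+2$ if and only if $n\equiv 2 \pmod 3$ and $\nu(G\setminus\Gamma(G))=\nu(G)$.
   Context: All graphs are finite and simple. A graph is unicyclic if it contains exactly one cycle. For a graph $G$ with vertex set $\{x_1,\ldots,x_m\}$ and a field $K$, the edge ideal $I(G)\subseteq R=K[x_1,\ldots,x_m]$ is generated by the monomials $x_ix_j$ with $\{x_i,x_j\}\in E(G)$. The regularity of a finitely generated graded $R$-module $M$ is $\operatorname{reg}(M)=\max\{j-i \mid \operatorname{Tor}_i^R(M,K)_j\neq 0\}$. An induced matching in $G$ is a set of pairwise disjoint edges which are exactly the edges of the induced subgraph of $G$ on the union of their vertices; $\nu(G)$ denotes the largest size of an induced matching in $G$. For a connected unicyclic graph $G$ with cycle $C_n$, $\Gamma(G)$ denotes the set of all vertices of $G$ that are not on $C_n$ but are adjacent to some vertex of $C_n$. $G\setminus\Gamma(G)$ is the induced subgraph of $G$ on $V(G)\setminus\Gamma(G)$. *)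

theory Defs
  imports "HOL-Library.Poly_Mapping" "Jordan_Normal_Form.Matrix"
begin

section \<open>Finite simple graphs\<close>

record 'v sgraph =
  verts :: "'v set"
  edges :: "'v set set"

definition simple_graph :: "'v sgraph \<Rightarrow> bool" where
  "simple_graph G \<longleftrightarrow> finite (verts G) \<and> (\<forall>e\<in>edges G. e \<subseteq> verts G \<and> card e = 2)"

definition connected_graph :: "'v sgraph \<Rightarrow> bool" where
  "connected_graph G \<longleftrightarrow>
     verts G \<noteq> {} \<and> (\<forall>u\<in>verts G. \<forall>v\<in>verts G. (u, v) \<in> {(a, b). {a, b} \<in> edges G}\<^sup>*)"

definition subgraph :: "'v sgraph \<Rightarrow> 'v sgraph \<Rightarrow> bool" where
  "subgraph H G \<longleftrightarrow> verts H \<subseteq> verts G \<and> edges H \<subseteq> edges G"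

definition induced_subgraph :: "'v sgraph \<Rightarrow> 'v set \<Rightarrow> 'v sgraph" where
  "induced_subgraph G S = \<lparr>verts = S, edges = {e \<in> edges G. e \<subseteq> S}\<rparr>"

definition cycle_graph :: "'v sgraph \<Rightarrow> bool" where
  "cycle_graph C \<longleftrightarrow> (\<exists>vs. distinct vs \<and> 3 \<le> length vs \<and> verts C = set vs \<and>
     edges C = {{vs ! i, vs ! (Suc i mod length vs)} | i. i < length vs})"

text \<open>Cycles of \<open>G\<close> are counted as subgraphs, so the starting point and the orientation
  of a traversal play no role.\<close>

definition cycles :: "'v sgraph \<Rightarrow> 'v sgraph set" where
  "cycles G = {C. cycle_graph C \<and> subgraph C G}"

definition unicyclic :: "'v sgraph \<Rightarrow> bool" where
  "unicyclic G \<longleftrightarrow> (\<exists>!C. C \<in> cycles G)"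

definition induced_matching :: "'v sgraph \<Rightarrow> 'v set set \<Rightarrow> bool" where
  "induced_matching G M \<longleftrightarrow>
     M \<subseteq> edges G \<and> pairwise disjnt M \<and> edges (induced_subgraph G (\<Union>M)) = M"

definition induced_matching_number :: "'v sgraph \<Rightarrow> nat" where
  "induced_matching_number G = Max {card M | M. induced_matching G M}"

definition Gamma_set :: "'v sgraph \<Rightarrow> 'v sgraph \<Rightarrow> 'v set" where
  "Gamma_set G C = {v \<in> verts G - verts C. \<exists>u\<in>verts C. {u, v} \<in> edges G}"


section \<open>Polynomial rings and edge ideals\<close>

type_synonym ('v, 'k) mpoly = "('v \<Rightarrow>\<^sub>0 nat) \<Rightarrow>\<^sub>0 'k"

text \<open>The polynomial ring with coefficients in \<open>'k\<close> and set of variables \<open>X\<close>, as a subring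
  of the ring of all polynomials with variables indexed by \<open>'v\<close>.\<close>

definition poly_ring :: "'v set \<Rightarrow> ('v, 'k::field) mpoly set" where
  "poly_ring X = {p. \<forall>m\<in>Poly_Mapping.keys p. Poly_Mapping.keys m \<subseteq> X}"

definition var :: "'v \<Rightarrow> ('v, 'k::field) mpoly" where
  "var v = Poly_Mapping.single (Poly_Mapping.single v 1) 1"

definition mono_degree :: "('v \<Rightarrow>\<^sub>0 nat) \<Rightarrow> nat" where
  "mono_degree m = (\<Sum>v\<in>Poly_Mapping.keys m. Poly_Mapping.lookup m v)"

text \<open>Degrees are integers because of the degree shifts below; the zero polynomial is
  homogeneous of every degree.\<close>

definition homogeneous :: "int \<Rightarrow> ('v, 'k::field) mpoly \<Rightarrow> bool" where
  "homogeneous d p \<longleftrightarrow> (\<forall>m\<in>Poly_Mapping.keys p. int (mono_degree m) = d)"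

definition ideal_generated :: "'v set \<Rightarrow> ('v, 'k::field) mpoly set \<Rightarrow> ('v, 'k) mpoly set" where
  "ideal_generated X S =
     {\<Sum>s\<in>T. c s * s | T c. finite T \<and> T \<subseteq> S \<and> (\<forall>s\<in>T. c s \<in> poly_ring X)}"

definition edge_ideal :: "'v sgraph \<Rightarrow> ('v, 'k::field) mpoly set" where
  "edge_ideal G = ideal_generated (verts G) {var u * var v | u v. {u, v} \<in> edges G}"


section \<open>Graded free resolutions, Tor and regularity\<close>

text \<open>With \<open>R = poly_ring X\<close>, a \<open>free_resolution\<close> is the data of a complex of graded free
  modules \<open>\<dots> \<rightarrow> F 2 \<rightarrow> F 1 \<rightarrow> F 0\<close> with an augmentation \<open>F 0 \<rightarrow> R\<close>, where
  \<open>F i\<close> is the direct sum of the \<open>R(- res_shift i b)\<close> over \<open>b < res_rank i\<close>, i.e. its \<open>b\<close>-th basis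
  element has degree \<open>res_shift i b\<close>. The matrix \<open>res_diff i\<close> represents the differential
  \<open>F (i + 1) \<rightarrow> F i\<close>, and \<open>res_aug\<close> lists the images in \<open>R\<close> of the basis elements of \<open>F 0\<close>.\<close>

record (overloaded) ('v, 'k) free_resolution =
  res_rank :: "nat \<Rightarrow> nat"
  res_shift :: "nat \<Rightarrow> nat \<Rightarrow> int"
  res_diff :: "nat \<Rightarrow> ('v, 'k) mpoly mat"
  res_aug :: "('v, 'k) mpoly vec"

definition free_module :: "'v set \<Rightarrow> nat \<Rightarrow> ('v, 'k::field) mpoly vec set" where
  "free_module X r = {v \<in> carrier_vec r. \<forall>b<r. v $ b \<in> poly_ring X}"

definition graded_free_resolution ::
  "'v set \<Rightarrow> ('v, 'k::field) mpoly set \<Rightarrow> ('v, 'k) free_resolution \<Rightarrow> bool" where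
  "graded_free_resolution X I F \<longleftrightarrow>
     res_aug F \<in> free_module X (res_rank F 0) \<and>
     (\<forall>b<res_rank F 0. homogeneous (res_shift F 0 b) (res_aug F $ b)) \<and>
     (\<forall>i. res_diff F i \<in> carrier_mat (res_rank F i) (res_rank F (Suc i)) \<and>
        (\<forall>a<res_rank F i. \<forall>b<res_rank F (Suc i). res_diff F i $$ (a, b) \<in> poly_ring X \<and>
           homogeneous (res_shift F (Suc i) b - res_shift F i a) (res_diff F i $$ (a, b)))) \<and>
     {res_aug F \<bullet> v | v. v \<in> free_module X (res_rank F 0)} = I \<and>
     {v \<in> free_module X (res_rank F 0). res_aug F \<bullet> v = 0} =
       {res_diff F 0 *\<^sub>v w | w. w \<in> free_module X (res_rank F 1)} \<and>
     (\<forall>i. {v \<in> free_module X (res_rank F (Suc i)). res_diff F i *\<^sub>v v = 0\<^sub>v (res_rank F i)} =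
       {res_diff F (Suc i) *\<^sub>v w | w. w \<in> free_module X (res_rank F (Suc (Suc i)))})"

text \<open>The base change to the residue field \<open>'k\<close>, on which a polynomial acts through its constant
  coefficient: the tensor product of \<open>F i\<close> with \<open>'k\<close> is the space of vectors of length
  \<open>res_rank F i\<close> over \<open>'k\<close>, whose degree \<open>j\<close> part is spanned by the basis vectors of degree \<open>j\<close>.\<close>

definition tensor_diff :: "('v, 'k::field) free_resolution \<Rightarrow> nat \<Rightarrow> 'k mat" where
  "tensor_diff F i = map_mat (\<lambda>p. Poly_Mapping.lookup p 0) (res_diff F i)"

definition tensor_part :: "('v, 'k::field) free_resolution \<Rightarrow> nat \<Rightarrow> int \<Rightarrow> 'k vec set" where
  "tensor_part F i j =
     {z \<in> carrier_vec (res_rank F i). \<forall>b<res_rank F i. z $ b \<noteq> 0 \<longrightarrow> res_shift F i b = j}"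

fun tensor_cycles :: "('v, 'k::field) free_resolution \<Rightarrow> nat \<Rightarrow> int \<Rightarrow> 'k vec set" where
  "tensor_cycles F 0 j = tensor_part F 0 j"
| "tensor_cycles F (Suc i) j =
     {z \<in> tensor_part F (Suc i) j. tensor_diff F i *\<^sub>v z = 0\<^sub>v (res_rank F i)}"

definition tensor_boundaries :: "('v, 'k::field) free_resolution \<Rightarrow> nat \<Rightarrow> int \<Rightarrow> 'k vec set" where
  "tensor_boundaries F i j = {tensor_diff F i *\<^sub>v w | w. w \<in> tensor_part F (Suc i) j}"

text \<open>\<open>Tor_nonzero X I i j\<close> says that the degree \<open>j\<close> part of \<open>Tor i\<close> of \<open>I\<close> and \<open>'k\<close> over
  \<open>poly_ring X\<close> is nonzero. Up to isomorphism, this homology does not depend on the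
  resolution, and for finite \<open>X\<close> every homogeneous ideal has a resolution by free modules
  of finite rank.\<close>

definition Tor_nonzero :: "'v set \<Rightarrow> ('v, 'k::field) mpoly set \<Rightarrow> nat \<Rightarrow> int \<Rightarrow> bool" where
  "Tor_nonzero X I i j \<longleftrightarrow>
     (\<exists>F. graded_free_resolution X I F \<and> tensor_cycles F i j \<noteq> tensor_boundaries F i j)"

definition regularity :: "'v set \<Rightarrow> ('v, 'k::field) mpoly set \<Rightarrow> int" where
  "regularity X I = Max {j - int i | i j. Tor_nonzero X I i j}"

end

theory Submission
  imports Defs
begin

text \<open>For every graded free resolution, Tor of the edge ideal is the Koszul homology of the
  quotient ring, by dimension shifting along the resolution. Koszul homology splits into
  multidegrees; only squarefree ones contribute, and there it is the reduced cohomology of the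
  independence complex of an induced subgraph (Hochster's formula). The Taylor resolution shows
  that a resolution exists. Hence the regularity is the largest \<open>p + 1\<close> such that the
  independence complex of some induced subgraph has nonzero reduced cohomology in degree \<open>p - 1\<close>.

  If \<open>W\<close> is a minimal vertex set with nonzero cohomology in a given degree, the subgraph induced
  on \<open>W\<close> has no isolated vertex, and no neighbourhood of a vertex contains that of another one.
  In a unicyclic graph this forces \<open>W\<close> to be an induced matching \<open>M\<close>, possibly together with the
  cycle \<open>C\<close> and without edges between them. Each edge of \<open>M\<close> shifts the degree by one, and the
  cycle contributes one more than its induced matching number exactly when its length is \<open>2\<close>
  modulo \<open>3\<close>. So the value \<open>\<nu>(G) + 2\<close> is attained only on a disjoint union of \<open>C\<close> and an induced
  matching away from \<open>\<Gamma>(G)\<close>.\<close>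

text \<open>\<open>Tor_nonzero\<close> ranges over all resolutions, minimal or not, so nothing can
  be read off the matrices directly. The tensor homology of each resolution is described by one
  condition that does not mention the resolution, which yields independence of the choice as well.

  Tor of the ideal in position i is Tor of the quotient ring in position i + 1, hence the Koszul
  degree \<open>Suc i\<close>. Cohomology of W in face size p sits at i = |W| - p - 1 and j = |W|,
  so j - i = p + 1, and the value \<nu>(G) + 2 means p = \<nu>(G) + 1.

  The modulus 3 has two sources. Eliminating a pendant edge takes three vertices off a path and
  lowers p by one; an induced matching also spends three vertices of a cycle on each edge. The
  counts part for residue 2, where a leftover path of two vertices still contributes one to p but no
  further matching edge fits.

  Unicyclicity enters by counting edges: a vertex set inducing minimum degree two must be the vertex
  set of C. The deletion and link sequences work over every coefficient ring, so the answer is the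
  same for all fields.\<close>

section \<open>Signs, boundaries and cones\<close>

text \<open>An arbitrary choice of incidence signs; only these two rules are ever used, so no order on
  the vertices has to be fixed.\<close>

definition sign_system :: "'u set \<Rightarrow> ('u \<Rightarrow> 'u set \<Rightarrow> 'a::comm_ring_1) \<Rightarrow> bool" where
  "sign_system U \<epsilon> \<longleftrightarrow>
     (\<forall>u\<in>U. \<forall>S\<subseteq>U - {u}. \<epsilon> u S * \<epsilon> u S = 1) \<and>
     (\<forall>u\<in>U. \<forall>v\<in>U - {u}. \<forall>S\<subseteq>U - {u, v}.
        \<epsilon> u S * \<epsilon> v (insert u S) = - (\<epsilon> v S * \<epsilon> u (insert v S)))"

lemma sign_square:
  "sign_system U \<epsilon> \<Longrightarrow> u \<in> U \<Longrightarrow> S \<subseteq> U \<Longrightarrow> u \<notin> S \<Longrightarrow> \<epsilon> u S * \<epsilon> u S = 1"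
  unfolding sign_system_def by (metis subset_Diff_insert Diff_empty)

lemma sign_square_cancel:
  "sign_system U \<epsilon> \<Longrightarrow> u \<in> U \<Longrightarrow> S \<subseteq> U \<Longrightarrow> u \<notin> S \<Longrightarrow> \<epsilon> u S * (\<epsilon> u S * x) = x"
  using sign_square[of U \<epsilon> u S] by (simp flip: mult.assoc)

lemma sign_anticommute:
  "sign_system U \<epsilon> \<Longrightarrow> u \<in> U \<Longrightarrow> v \<in> U \<Longrightarrow> u \<noteq> v \<Longrightarrow> S \<subseteq> U - {u, v} \<Longrightarrow>
     \<epsilon> u S * \<epsilon> v (insert u S) = - (\<epsilon> v S * \<epsilon> u (insert v S))"
  unfolding sign_system_def by blast

text \<open>Multiply the anticommutation rule by \<open>\<epsilon> u S\<close> and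
  \<open>\<epsilon> u (insert v S)\<close>, whose squares are 1. This arrangement of signs is the
  one met in the boundary of a cone.\<close>

lemma sign_swap:
  assumes "sign_system U \<epsilon>" "u \<in> U" "v \<in> U" "u \<noteq> v" "S \<subseteq> U - {u, v}"
  shows "\<epsilon> u (insert v S) * \<epsilon> v (insert u S) = - (\<epsilon> v S * \<epsilon> u S)"
proof -
  have "\<epsilon> u (insert v S) * \<epsilon> v (insert u S) = (\<epsilon> u S * \<epsilon> u S) * (\<epsilon> u (insert v S) * \<epsilon> v (insert u S))"
  proof -
    have "\<epsilon> u S * \<epsilon> u S = 1" by (rule sign_square[OF assms(1,2)]) (use assms(5) in auto)
    then show ?thesis by simp
  qed
  also have "\<dots> = (\<epsilon> u S * \<epsilon> v (insert u S)) * (\<epsilon> u S * \<epsilon> u (insert v S))"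
    by (simp add: mult_ac)
  also have "\<dots> = - (\<epsilon> v S * \<epsilon> u S) * (\<epsilon> u (insert v S) * \<epsilon> u (insert v S))"
    using sign_anticommute[OF assms] by (simp add: mult_ac)
  also have "\<dots> = - (\<epsilon> v S * \<epsilon> u S)"
  proof -
    have "\<epsilon> u (insert v S) * \<epsilon> u (insert v S) = 1"
      by (rule sign_square[OF assms(1,2)]) (use assms in auto)
    then show ?thesis by simp
  qed
  finally show ?thesis .
qed

lemma sign_system_subset: "sign_system U \<epsilon> \<Longrightarrow> W \<subseteq> U \<Longrightarrow> sign_system W \<epsilon>"
  unfolding sign_system_def
proof (elim conjE, intro conjI ballI allI impI)
  fix u S
  assume "\<forall>u\<in>U. \<forall>S\<subseteq>U - {u}. \<epsilon> u S * \<epsilon> u S = 1" "W \<subseteq> U" "u \<in> W" "S \<subseteq> W - {u}"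
  moreover from this have "S \<subseteq> U - {u}" by auto
  ultimately show "\<epsilon> u S * \<epsilon> u S = 1" by auto
next
  fix u v S
  assume "\<forall>u\<in>U. \<forall>v\<in>U - {u}. \<forall>S\<subseteq>U - {u, v}.
        \<epsilon> u S * \<epsilon> v (insert u S) = - (\<epsilon> v S * \<epsilon> u (insert v S))"
    and "W \<subseteq> U" "u \<in> W" "v \<in> W - {u}" "S \<subseteq> W - {u, v}"
  moreover from this have "S \<subseteq> U - {u, v}" "v \<in> U - {u}" by auto
  ultimately show "\<epsilon> u S * \<epsilon> v (insert u S) = - (\<epsilon> v S * \<epsilon> u (insert v S))" by blast
qed

lemma sign_system_exists:
  assumes "finite (U :: 'u set)"
  shows "\<exists>\<epsilon> :: 'u \<Rightarrow> 'u set \<Rightarrow> 'a::comm_ring_1. sign_system U \<epsilon>"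
proof -
  obtain f :: "'u \<Rightarrow> nat" where f: "inj_on f U"
    using finite_imp_inj_to_nat_seg[OF assms] by blast
  \<comment> \<open>The usual simplicial sign: the parity of the number of elements of S that
    precede u in the numbering \<open>f\<close>. Inserting u changes the sign at v exactly when u
    precedes v, and of two vertices exactly one precedes the other.\<close>
  define \<epsilon> :: "'u \<Rightarrow> 'u set \<Rightarrow> 'a" where "\<epsilon> u S = (- 1) ^ card {x\<in>S. f x < f u}" for u S
  have card_ins: "(- 1 :: 'a) ^ card (insert u X) = - ((- 1) ^ card X)" if "finite X" "u \<notin> X" for u :: 'u and X
    using that by simp
  have ins: "\<epsilon> v (insert u S) = (if f u < f v then - \<epsilon> v S else \<epsilon> v S)"
    if "u \<in> U" "S \<subseteq> U - {u, v}" for u v S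
  proof -
    have "finite S" using that assms finite_subset by blast
    moreover have "{x\<in>insert u S. f x < f v} = (if f u < f v then insert u {x\<in>S. f x < f v} else {x\<in>S. f x < f v})"
      by auto
    moreover have "u \<notin> S" using that by auto
    ultimately show ?thesis using card_ins[of "{x\<in>S. f x < f v}" u] unfolding \<epsilon>_def by auto
  qed
  have "sign_system U \<epsilon>"
    unfolding sign_system_def
  proof (intro conjI ballI allI impI)
    fix u S show "\<epsilon> u S * \<epsilon> u S = 1" unfolding \<epsilon>_def by (simp flip: power_add mult_2)
  next
    fix u v S assume a: "u \<in> U" "v \<in> U - {u}" "S \<subseteq> U - {u, v}"
    then have "f u \<noteq> f v" using f by (auto dest: inj_onD)
    moreover have "S \<subseteq> U - {v, u}" using a by auto
    ultimately show "\<epsilon> u S * \<epsilon> v (insert u S) = - (\<epsilon> v S * \<epsilon> u (insert v S))"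
      using a ins[of u S v] ins[of v S u] by (auto simp: mult_ac)
  qed
  then show ?thesis by blast
qed

text \<open>The terms for (u, v) and (v, u) cancel. Showing only that the sum is its own negative
  would prove nothing in characteristic 2, hence the induction. This is what makes the square of a
  differential vanish.\<close>

lemma antisymmetric_sum_zero:
  fixes f :: "'u \<Rightarrow> 'u \<Rightarrow> 'a::ab_group_add"
  assumes "finite A" and "\<And>u v. u \<in> A \<Longrightarrow> v \<in> A \<Longrightarrow> u \<noteq> v \<Longrightarrow> f u v = - f v u"
  shows "(\<Sum>u\<in>A. \<Sum>v\<in>A - {u}. f u v) = 0"
  using assms
proof (induction A rule: finite_induct)
  case (insert a A)
  have "(\<Sum>u\<in>A. \<Sum>v\<in>A - {u}. f u v) = 0" using insert.IH insert.prems by blast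
  note hyps = insert.hyps and IH = this
  have "(\<Sum>u\<in>insert a A. \<Sum>v\<in>insert a A - {u}. f u v)
      = (\<Sum>v\<in>A. f a v) + (\<Sum>u\<in>A. \<Sum>v\<in>insert a A - {u}. f u v)"
    using hyps by simp
  also have "(\<Sum>u\<in>A. \<Sum>v\<in>insert a A - {u}. f u v) = (\<Sum>u\<in>A. f u a + (\<Sum>v\<in>A - {u}. f u v))"
    using hyps by (intro sum.cong) (auto simp: insert_Diff_if)
  also have "\<dots> = (\<Sum>u\<in>A. f u a)"
    using IH by (simp add: sum.distrib)
  also have "\<dots> = - (\<Sum>v\<in>A. f a v)"
    unfolding sum_negf[symmetric]
  proof (rule sum.cong)
    fix u assume "u \<in> A"
    then show "f u a = - f a u" using insert.prems[of u a] hyps by auto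
  qed simp
  finally show ?case by simp
qed simp

text \<open>Chains are coefficient functions on faces, so the boundary at S collects the
  coefficients of the faces having one vertex more.\<close>

definition bdry :: "'u set \<Rightarrow> ('u \<Rightarrow> 'u set \<Rightarrow> 'a::comm_ring_1) \<Rightarrow> ('u set \<Rightarrow> 'a) \<Rightarrow> 'u set \<Rightarrow> 'a" where
  "bdry U \<epsilon> c S = (\<Sum>u\<in>U - S. \<epsilon> u S * c (insert u S))"

definition cone :: "'u \<Rightarrow> ('u \<Rightarrow> 'u set \<Rightarrow> 'a::comm_ring_1) \<Rightarrow> ('u set \<Rightarrow> 'a) \<Rightarrow> 'u set \<Rightarrow> 'a" where
  "cone v \<epsilon> c S = (if v \<in> S then \<epsilon> v (S - {v}) * c (S - {v}) else 0)"

text \<open>The cone with apex v is a contracting homotopy: for v in S the boundary of the cone is c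
  S minus the cone over the boundary of c, which involves c only through its boundary at S - {v}.
  For v outside S only the summand u = v survives.\<close>

lemma bdry_cone:
  assumes "finite U" "sign_system U \<epsilon>" "v \<in> U" "S \<subseteq> U"
    and "v \<in> S \<Longrightarrow> bdry U \<epsilon> c (S - {v}) = 0"
  shows "bdry U \<epsilon> (cone v \<epsilon> c) S = c S"
proof (cases "v \<in> S")
  case False
  have "bdry U \<epsilon> (cone v \<epsilon> c) S = (\<Sum>u\<in>U - S. if u = v then c S else 0)"
    unfolding bdry_def
  proof (rule sum.cong)
    fix u assume "u \<in> U - S"
    show "\<epsilon> u S * cone v \<epsilon> c (insert u S) = (if u = v then c S else 0)"
      using sign_square_cancel[OF assms(2,3,4) False] False by (auto simp: cone_def)
  qed simp
  also have "\<dots> = c S" using assms False by (simp add: sum.delta)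
  finally show ?thesis .
next
  case True
  define S' where "S' = S - {v}"
  have S: "S = insert v S'" and v: "v \<notin> S'" using True unfolding S'_def by auto
  have US: "U - S' = insert v (U - S)" "v \<notin> U - S" using S v assms by auto
  have "bdry U \<epsilon> (cone v \<epsilon> c) S = (\<Sum>u\<in>U - S. - \<epsilon> v S' * (\<epsilon> u S' * c (insert u S')))"
    unfolding bdry_def
  proof (rule sum.cong)
    fix u assume u: "u \<in> U - S"
    have e: "insert u S - {v} = insert u S'" using u S v by auto
    have "\<epsilon> u (insert v S') * \<epsilon> v (insert u S') = - (\<epsilon> v S' * \<epsilon> u S')"
      using sign_swap[OF assms(2), of u v S'] u S v assms by auto
    then show "\<epsilon> u S * cone v \<epsilon> c (insert u S) = - \<epsilon> v S' * (\<epsilon> u S' * c (insert u S'))"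
      unfolding cone_def e using S by (simp add: mult.assoc[symmetric])
  qed simp
  also have "\<dots> = - \<epsilon> v S' * (\<Sum>u\<in>U - S. \<epsilon> u S' * c (insert u S'))"
    by (simp add: sum_distrib_left)
  also have "(\<Sum>u\<in>U - S. \<epsilon> u S' * c (insert u S')) = bdry U \<epsilon> c S' - \<epsilon> v S' * c S"
    unfolding bdry_def US(1) using US(2) assms(1) S by simp
  also have "bdry U \<epsilon> c S' = 0" using assms(5) True S'_def by simp
  also have "- \<epsilon> v S' * (0 - \<epsilon> v S' * c S) = c S"
    using sign_square_cancel[OF assms(2,3), of S'] v assms(4) S by auto
  finally show ?thesis .
qed

section \<open>Cohomology of independence complexes\<close>

definition nbh :: "'v set set \<Rightarrow> 'v \<Rightarrow> 'v set" where
  "nbh E v = {u. {u, v} \<in> E}"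

definition indep :: "'v set set \<Rightarrow> 'v set \<Rightarrow> 'v set set" where
  "indep E W = {T. T \<subseteq> W \<and> (\<forall>e\<in>E. \<not> e \<subseteq> T)}"

definition cobdry :: "('u \<Rightarrow> 'u set \<Rightarrow> 'a::comm_ring_1) \<Rightarrow> ('u set \<Rightarrow> 'a) \<Rightarrow> 'u set \<Rightarrow> 'a" where
  "cobdry \<epsilon> c T = (\<Sum>u\<in>T. \<epsilon> u (T - {u}) * c (T - {u}))"

text \<open>The number \<open>p\<close> is the cardinality of the faces: \<open>cohom_nz \<epsilon> E W p\<close> says that the reduced
  cohomology in degree \<open>p - 1\<close> of the independence complex of \<open>(W, E)\<close> is nonzero.\<close>

definition cohom_nz :: "('v \<Rightarrow> 'v set \<Rightarrow> 'a::comm_ring_1) \<Rightarrow> 'v set set \<Rightarrow> 'v set \<Rightarrow> nat \<Rightarrow> bool" where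
  "cohom_nz \<epsilon> E W p \<longleftrightarrow>
     (\<exists>c. (\<forall>T\<in>indep E W. card T = Suc p \<longrightarrow> cobdry \<epsilon> c T = 0) \<and>
        \<not> (\<exists>b. \<forall>T\<in>indep E W. card T = p \<longrightarrow> c T = cobdry \<epsilon> b T))"

lemma indep_mono: "T \<in> indep E W \<Longrightarrow> W \<subseteq> W' \<Longrightarrow> T \<in> indep E W'"
  unfolding indep_def by blast

lemma indep_delete: "T \<in> indep E (W - {v}) \<longleftrightarrow> T \<in> indep E W \<and> v \<notin> T"
  unfolding indep_def by blast

text \<open>An edge inside \<open>insert v T\<close> either lies in T or joins v to a neighbour in
  T. So the link of v in the independence complex is again an independence complex.\<close>

lemma indep_link:
  assumes "\<forall>e\<in>E. card e = 2" "v \<in> W"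
  shows "T \<in> indep E (W - insert v (nbh E v)) \<longleftrightarrow> v \<notin> T \<and> insert v T \<in> indep E W"
proof
  assume T: "T \<in> indep E (W - insert v (nbh E v))"
  have "\<not> e \<subseteq> insert v T" if e: "e \<in> E" for e
  proof
    assume s: "e \<subseteq> insert v T"
    obtain a b where ab: "e = {a, b}" "a \<noteq> b" using assms(1) e card_2_iff by metis
    have "\<not> e \<subseteq> T" using T e unfolding indep_def by blast
    then have "v = a \<or> v = b" using s ab by auto
    then obtain u where "e = {u, v}" "u \<noteq> v" using ab by auto
    then show False using s e T unfolding indep_def nbh_def by auto
  qed
  then show "v \<notin> T \<and> insert v T \<in> indep E W" using T assms unfolding indep_def by auto
next
  assume T: "v \<notin> T \<and> insert v T \<in> indep E W"
  then have E: "\<not> e \<subseteq> insert v T" if "e \<in> E" for e using that unfolding indep_def by blast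
  have "u \<notin> nbh E v" if "u \<in> T" for u using E[of "{u, v}"] that unfolding nbh_def by auto
  moreover have "\<forall>e\<in>E. \<not> e \<subseteq> T" using E by blast
  ultimately show "T \<in> indep E (W - insert v (nbh E v))" using T unfolding indep_def by auto
qed

lemma cobdry_diff: "cobdry \<epsilon> (\<lambda>T. a T - b T) T = cobdry \<epsilon> a T - cobdry \<epsilon> b T"
  unfolding cobdry_def by (simp add: right_diff_distrib sum_subtractf)

lemma cobdry_cong:
  "(\<And>u. u \<in> T \<Longrightarrow> a (T - {u}) = b (T - {u})) \<Longrightarrow> cobdry \<epsilon> a T = cobdry \<epsilon> b T"
  unfolding cobdry_def by (rule sum.cong) auto

text \<open>Exchanging v with the removed vertex costs one sign. Up to the sign of v, the result is
  the restriction of c minus the coboundary of its contraction with v.\<close>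

lemma cobdry_insert:
  assumes "sign_system W \<epsilon>" "finite T" "v \<in> W" "T \<subseteq> W" "v \<notin> T"
  shows "cobdry \<epsilon> c (insert v T)
    = \<epsilon> v T * (c T - cobdry \<epsilon> (\<lambda>S. \<epsilon> v S * c (insert v S)) T)"
proof -
  have "cobdry \<epsilon> c (insert v T)
      = \<epsilon> v T * c T + (\<Sum>u\<in>T. \<epsilon> u (insert v T - {u}) * c (insert v T - {u}))"
    unfolding cobdry_def using assms by simp
  also have "(\<Sum>u\<in>T. \<epsilon> u (insert v T - {u}) * c (insert v T - {u}))
      = (\<Sum>u\<in>T. - \<epsilon> v T * (\<epsilon> u (T - {u}) * (\<epsilon> v (T - {u}) * c (insert v (T - {u})))))"
  proof (rule sum.cong)
    fix u assume u: "u \<in> T"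
    define S where "S = T - {u}"
    have T: "T = insert u S" "u \<notin> S" "insert v T - {u} = insert v S" using u S_def assms by auto
    have anti: "\<epsilon> u S * \<epsilon> v (insert u S) = - (\<epsilon> v S * \<epsilon> u (insert v S))"
      using sign_anticommute[OF assms(1), of u v S] u T assms by auto
    have sq: "\<epsilon> v S * \<epsilon> v S = 1"
      using sign_square[OF assms(1,3), of S] T assms by auto
    have "- \<epsilon> v T * (\<epsilon> u S * (\<epsilon> v S * c (insert v S)))
        = - (\<epsilon> u S * \<epsilon> v (insert u S)) * (\<epsilon> v S * c (insert v S))"
      using T by (simp add: mult_ac)
    also have "\<dots> = (\<epsilon> v S * \<epsilon> v S) * (\<epsilon> u (insert v S) * c (insert v S))"
      unfolding anti by (simp add: mult_ac)
    finally show "\<epsilon> u (insert v T - {u}) * c (insert v T - {u})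
        = - \<epsilon> v T * (\<epsilon> u (T - {u}) * (\<epsilon> v (T - {u}) * c (insert v (T - {u}))))"
      unfolding T(3) S_def[symmetric] sq by simp
  qed simp
  finally show ?thesis
    unfolding cobdry_def by (simp add: right_diff_distrib sum_distrib_left sum_negf)
qed

text \<open>A cochain of the complex is a pair of cochains: its restriction \<open>a\<close> to the deletion of
  \<open>v\<close> and its contraction \<open>b\<close> with \<open>v\<close>, a cochain of the link; the differential sends
  \<open>(a, b)\<close> to \<open>(\<delta> a, a - \<delta> b)\<close>, so the complex is a mapping cone.\<close>

locale vertex_deletion =
  fixes \<epsilon> :: "'v \<Rightarrow> 'v set \<Rightarrow> 'a::comm_ring_1" and E :: "'v set set" and W :: "'v set" and v :: 'v
  assumes finite_W: "finite W" and edges_card: "\<forall>e\<in>E. card e = 2"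
    and signs: "sign_system W \<epsilon>" and v_in: "v \<in> W"
begin

abbreviation "Del \<equiv> W - {v}"
abbreviation "Lnk \<equiv> W - insert v (nbh E v)"

definition glue :: "('v set \<Rightarrow> 'a) \<Rightarrow> ('v set \<Rightarrow> 'a) \<Rightarrow> 'v set \<Rightarrow> 'a" where
  "glue a b T = (if v \<in> T then \<epsilon> v (T - {v}) * b (T - {v}) else a T)"

text \<open>(a, b) is the coboundary of (a', b') in the mapping cone. A link face T stands for the
  face \<open>insert v T\<close>; writing \<open>Suc (card T) = p\<close> leaves no such face for p
  = 0.\<close>

definition bounding :: "nat \<Rightarrow> ('v set \<Rightarrow> 'a) \<Rightarrow> ('v set \<Rightarrow> 'a) \<Rightarrow> bool" where
  "bounding p a b \<longleftrightarrow> (\<exists>a' b'. (\<forall>T\<in>indep E Del. card T = p \<longrightarrow> a T = cobdry \<epsilon> a' T) \<and>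
     (\<forall>T\<in>indep E Lnk. Suc (card T) = p \<longrightarrow> b T = a' T - cobdry \<epsilon> b' T))"

lemma link_in: "T \<in> indep E Lnk \<longleftrightarrow> v \<notin> T \<and> insert v T \<in> indep E W"
  by (rule indep_link[OF edges_card v_in])

lemma indep_D: "T \<in> indep E W \<Longrightarrow> T \<subseteq> W \<and> finite T"
  using finite_W finite_subset unfolding indep_def by blast

lemma link_D: "T \<in> indep E Lnk \<Longrightarrow> T \<subseteq> W \<and> finite T \<and> v \<notin> T \<and> T \<in> indep E Del"
  using indep_D indep_mono[of T E Lnk W] indep_mono[of T E Lnk Del] link_in by blast

lemma cobdry_glue_del: "v \<notin> T \<Longrightarrow> cobdry \<epsilon> (glue a b) T = cobdry \<epsilon> a T"
  by (rule cobdry_cong) (auto simp: glue_def)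

lemma cobdry_glue_link:
  assumes "T \<subseteq> W" "finite T" "v \<notin> T"
  shows "cobdry \<epsilon> (glue a b) (insert v T) = \<epsilon> v T * (a T - cobdry \<epsilon> b T)"
proof -
  have "cobdry \<epsilon> (\<lambda>S. \<epsilon> v S * glue a b (insert v S)) T = cobdry \<epsilon> b T"
  proof (rule cobdry_cong)
    fix u assume "u \<in> T"
    then have "v \<notin> T - {u}" "\<epsilon> v (T - {u}) * \<epsilon> v (T - {u}) = 1"
      using sign_square[OF signs v_in, of "T - {u}"] assms by auto
    then show "\<epsilon> v (T - {u}) * glue a b (insert v (T - {u})) = b (T - {u})"
      unfolding glue_def by (simp add: mult.assoc[symmetric])
  qed
  then show ?thesis
    using cobdry_insert[OF signs assms(2) v_in assms(1,3), of "glue a b"] assms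
    by (simp add: glue_def)
qed

lemma sign_cancel: "T \<subseteq> W \<Longrightarrow> v \<notin> T \<Longrightarrow> \<epsilon> v T * x = \<epsilon> v T * y \<longleftrightarrow> x = y"
  using sign_square_cancel[OF signs v_in, of T] by metis

lemma glue_decompose: "T \<subseteq> W \<Longrightarrow> glue c (\<lambda>S. \<epsilon> v S * c (insert v S)) T = c T"
  using sign_square_cancel[OF signs v_in, of "T - {v}" "c T"]
  by (auto simp: glue_def insert_absorb)

lemma cocycle_glue:
  "(\<forall>T\<in>indep E W. card T = p \<longrightarrow> cobdry \<epsilon> (glue a b) T = 0) \<longleftrightarrow>
     (\<forall>T\<in>indep E Del. card T = p \<longrightarrow> cobdry \<epsilon> a T = 0) \<and>
     (\<forall>T\<in>indep E Lnk. Suc (card T) = p \<longrightarrow> a T = cobdry \<epsilon> b T)" (is "?L \<longleftrightarrow> ?R")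
proof
  assume L: ?L
  show ?R
  proof (intro conjI ballI impI)
    fix T assume "T \<in> indep E Del" "card T = p"
    then show "cobdry \<epsilon> a T = 0" using L cobdry_glue_del[of T a b] by (auto simp: indep_delete)
  next
    fix T assume T: "T \<in> indep E Lnk" "Suc (card T) = p"
    have "\<epsilon> v T * (a T - cobdry \<epsilon> b T) = \<epsilon> v T * 0"
      using L T link_D[OF T(1)] link_in cobdry_glue_link[of T a b] by auto
    then have "a T - cobdry \<epsilon> b T = 0" using sign_cancel[of T] link_D[OF T(1)] by blast
    then show "a T = cobdry \<epsilon> b T" by simp
  qed
next
  assume R: ?R
  show ?L
  proof (intro ballI impI)
    fix T assume T: "T \<in> indep E W" "card T = p"
    show "cobdry \<epsilon> (glue a b) T = 0"
    proof (cases "v \<in> T")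
      case False
      then show ?thesis using R T cobdry_glue_del[of T a b] by (auto simp: indep_delete)
    next
      case True
      then obtain S where S: "T = insert v S" "v \<notin> S" using mk_disjoint_insert by metis
      then have "S \<in> indep E Lnk" using link_in T by auto
      then show ?thesis using R S T link_D[of S] cobdry_glue_link[of S a b] by auto
    qed
  qed
qed

lemma coboundary_glue:
  "(\<forall>T\<in>indep E W. card T = p \<longrightarrow> glue a b T = cobdry \<epsilon> (glue a' b') T) \<longleftrightarrow>
     (\<forall>T\<in>indep E Del. card T = p \<longrightarrow> a T = cobdry \<epsilon> a' T) \<and>
     (\<forall>T\<in>indep E Lnk. Suc (card T) = p \<longrightarrow> b T = a' T - cobdry \<epsilon> b' T)" (is "?L \<longleftrightarrow> ?R")
proof
  assume L: ?L
  show ?R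
  proof (intro conjI ballI impI)
    fix T assume "T \<in> indep E Del" "card T = p"
    then show "a T = cobdry \<epsilon> a' T" using L cobdry_glue_del[of T a' b']
      by (auto simp: indep_delete glue_def)
  next
    fix T assume T: "T \<in> indep E Lnk" "Suc (card T) = p"
    have "glue a b (insert v T) = \<epsilon> v T * (a' T - cobdry \<epsilon> b' T)"
      using L T link_D[OF T(1)] link_in cobdry_glue_link[of T a' b'] by auto
    then show "b T = a' T - cobdry \<epsilon> b' T" using sign_cancel[of T] link_D[OF T(1)]
      by (auto simp: glue_def)
  qed
next
  assume R: ?R
  show ?L
  proof (intro ballI impI)
    fix T assume T: "T \<in> indep E W" "card T = p"
    show "glue a b T = cobdry \<epsilon> (glue a' b') T"
    proof (cases "v \<in> T")
      case False
      then show ?thesis using R T cobdry_glue_del[of T a' b'] by (auto simp: indep_delete glue_def)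
    next
      case True
      then obtain S where S: "T = insert v S" "v \<notin> S" using mk_disjoint_insert by metis
      then have "S \<in> indep E Lnk" using link_in T by auto
      then show ?thesis using R S T link_D[of S] cobdry_glue_link[of S a' b'] by (auto simp: glue_def)
    qed
  qed
qed

text \<open>On the subsets of W every cochain agrees with a glued pair, so quantifying over cochains
  amounts to quantifying over pairs.\<close>

lemma cohom_nz_glue:
  "cohom_nz \<epsilon> E W p \<longleftrightarrow>
    (\<exists>a b. (\<forall>T\<in>indep E Del. card T = Suc p \<longrightarrow> cobdry \<epsilon> a T = 0) \<and>
      (\<forall>T\<in>indep E Lnk. card T = p \<longrightarrow> a T = cobdry \<epsilon> b T) \<and>
      \<not> bounding p a b)"
proof -
  have cb: "(\<exists>b. \<forall>T\<in>indep E W. card T = p \<longrightarrow> c T = cobdry \<epsilon> b T) \<longleftrightarrow>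
     (\<exists>a' b'. \<forall>T\<in>indep E W. card T = p \<longrightarrow> c T = cobdry \<epsilon> (glue a' b') T)" for c
  proof
    assume "\<exists>b. \<forall>T\<in>indep E W. card T = p \<longrightarrow> c T = cobdry \<epsilon> b T"
    then obtain b where b: "\<forall>T\<in>indep E W. card T = p \<longrightarrow> c T = cobdry \<epsilon> b T" by blast
    have "cobdry \<epsilon> (glue b (\<lambda>S. \<epsilon> v S * b (insert v S))) T = cobdry \<epsilon> b T" if "T \<in> indep E W" for T
      using that indep_D[OF that] by (intro cobdry_cong glue_decompose) auto
    with b show "\<exists>a' b'. \<forall>T\<in>indep E W. card T = p \<longrightarrow> c T = cobdry \<epsilon> (glue a' b') T"
      by metis
  qed blast
  have "cohom_nz \<epsilon> E W p \<longleftrightarrow>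
    (\<exists>a b. (\<forall>T\<in>indep E W. card T = Suc p \<longrightarrow> cobdry \<epsilon> (glue a b) T = 0) \<and>
      \<not> (\<exists>a' b'. \<forall>T\<in>indep E W. card T = p \<longrightarrow> glue a b T = cobdry \<epsilon> (glue a' b') T))" (is "?L \<longleftrightarrow> ?R")
  proof
    assume ?L
    then obtain c where c: "\<forall>T\<in>indep E W. card T = Suc p \<longrightarrow> cobdry \<epsilon> c T = 0"
      "\<not> (\<exists>b. \<forall>T\<in>indep E W. card T = p \<longrightarrow> c T = cobdry \<epsilon> b T)"
      unfolding cohom_nz_def by blast
    define d where "d = glue c (\<lambda>S. \<epsilon> v S * c (insert v S))"
    have d: "d T = c T" if "T \<subseteq> W" for T using glue_decompose[OF that] unfolding d_def .
    have "cobdry \<epsilon> d T = cobdry \<epsilon> c T" if "T \<in> indep E W" for T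
      using that indep_D[OF that] by (intro cobdry_cong d) auto
    then have 1: "\<forall>T\<in>indep E W. card T = Suc p \<longrightarrow> cobdry \<epsilon> d T = 0" using c(1) by simp
    have "\<not> (\<exists>a' b'. \<forall>T\<in>indep E W. card T = p \<longrightarrow> d T = cobdry \<epsilon> (glue a' b') T)"
      using c(2) cb[of c] d indep_D by metis
    with 1 show ?R unfolding d_def by blast
  next
    assume ?R
    then show ?L unfolding cohom_nz_def cb by blast
  qed
  then show ?thesis unfolding cocycle_glue coboundary_glue bounding_def by (simp add: conj_assoc)
qed

text \<open>Exactness at W in the long exact sequence in which the cohomology of Lnk at q, W at
  \<open>Suc q\<close>, Del at \<open>Suc q\<close> and Lnk at \<open>Suc q\<close> follow one
  another.\<close>

lemma nz_cases:
  assumes "cohom_nz \<epsilon> E W p"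
  shows "cohom_nz \<epsilon> E Del p \<or> (\<exists>q. p = Suc q \<and> cohom_nz \<epsilon> E Lnk q)"
proof (rule ccontr)
  assume neg: "\<not> ?thesis"
  obtain a b where ab: "\<forall>T\<in>indep E Del. card T = Suc p \<longrightarrow> cobdry \<epsilon> a T = 0"
      "\<forall>T\<in>indep E Lnk. card T = p \<longrightarrow> a T = cobdry \<epsilon> b T"
      "\<not> bounding p a b"
    using assms unfolding cohom_nz_glue by blast
  obtain a' where a': "\<forall>T\<in>indep E Del. card T = p \<longrightarrow> a T = cobdry \<epsilon> a' T"
    using neg ab(1) unfolding cohom_nz_def by blast
  show False
  proof (cases p)
    case 0
    then show False using ab(3) a' unfolding bounding_def by auto
  next
    case (Suc q)
    \<comment> \<open>On the link both a' and b have coboundary a, so their difference is a cocycle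
      there.\<close>
    have "\<forall>T\<in>indep E Lnk. card T = Suc q \<longrightarrow> cobdry \<epsilon> (\<lambda>T. a' T - b T) T = 0"
      using ab(2) a' Suc link_D by (auto simp: cobdry_diff)
    then obtain b' where "\<forall>T\<in>indep E Lnk. card T = q \<longrightarrow> a' T - b T = cobdry \<epsilon> b' T"
      using neg Suc unfolding cohom_nz_def by blast
    then have "\<forall>T\<in>indep E Lnk. card T = q \<longrightarrow> b T = a' T - cobdry \<epsilon> b' T" by (metis diff_diff_eq2 add_diff_cancel_left')
    then show False using ab(3) a' Suc unfolding bounding_def by auto
  qed
qed

text \<open>Vanishing of the deletion at q makes the map from the link into W injective. The class
  is represented by b on the link and zero on the deletion.\<close>

lemma nz_link:
  assumes "cohom_nz \<epsilon> E Lnk q" "\<not> cohom_nz \<epsilon> E Del q"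
  shows "cohom_nz \<epsilon> E W (Suc q)"
proof -
  obtain b where b: "\<forall>T\<in>indep E Lnk. card T = Suc q \<longrightarrow> cobdry \<epsilon> b T = 0"
    "\<not> (\<exists>b'. \<forall>T\<in>indep E Lnk. card T = q \<longrightarrow> b T = cobdry \<epsilon> b' T)"
    using assms(1) unfolding cohom_nz_def by blast
  show ?thesis unfolding cohom_nz_glue
  proof (rule exI[of _ "\<lambda>_. 0"], rule exI[of _ b], intro conjI)
    show "\<not> bounding (Suc q) (\<lambda>_. 0) b"
      unfolding bounding_def
    proof (intro notI, elim exE conjE)
      fix a' b' assume a': "\<forall>T\<in>indep E Del. card T = Suc q \<longrightarrow> 0 = cobdry \<epsilon> a' T"
        and b': "\<forall>T\<in>indep E Lnk. Suc (card T) = Suc q \<longrightarrow> b T = a' T - cobdry \<epsilon> b' T"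
      obtain a'' where "\<forall>T\<in>indep E Del. card T = q \<longrightarrow> a' T = cobdry \<epsilon> a'' T"
        using a' assms(2) unfolding cohom_nz_def by metis
      then have "\<forall>T\<in>indep E Lnk. card T = q \<longrightarrow> b T = cobdry \<epsilon> (\<lambda>T. a'' T - b' T) T"
        using b' link_D by (auto simp: cobdry_diff)
      then show False using b(2) by blast
    qed
  qed (use b in \<open>auto simp: cobdry_def\<close>)
qed

text \<open>The obstruction to extending a class of the deletion to W is its restriction to the
  link. As the link has no cohomology there, the restriction bounds, and what it bounds is the
  missing component b.\<close>

lemma nz_delete:
  assumes "cohom_nz \<epsilon> E Del p" "\<not> cohom_nz \<epsilon> E Lnk p"
  shows "cohom_nz \<epsilon> E W p"
proof -
  obtain a where a: "\<forall>T\<in>indep E Del. card T = Suc p \<longrightarrow> cobdry \<epsilon> a T = 0"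
    "\<not> (\<exists>a'. \<forall>T\<in>indep E Del. card T = p \<longrightarrow> a T = cobdry \<epsilon> a' T)"
    using assms(1) unfolding cohom_nz_def by blast
  have "\<forall>T\<in>indep E Lnk. card T = Suc p \<longrightarrow> cobdry \<epsilon> a T = 0" using a(1) link_D by blast
  then obtain b where "\<forall>T\<in>indep E Lnk. card T = p \<longrightarrow> a T = cobdry \<epsilon> b T"
    using assms(2) unfolding cohom_nz_def by blast
  then show ?thesis unfolding cohom_nz_glue bounding_def using a by blast
qed

text \<open>Link and deletion coincide, so the complex is the mapping cone of an identity, that is,
  a simplicial cone with apex v. The pair (b, 0) bounds (a, b).\<close>

lemma isolated_zero:
  assumes "nbh E v \<inter> W \<subseteq> {v}"
  shows "\<not> cohom_nz \<epsilon> E W p"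
proof
  assume "cohom_nz \<epsilon> E W p"
  then obtain a b where ab: "\<forall>T\<in>indep E Del. card T = Suc p \<longrightarrow> cobdry \<epsilon> a T = 0"
      "\<forall>T\<in>indep E Lnk. card T = p \<longrightarrow> a T = cobdry \<epsilon> b T"
      "\<not> bounding p a b"
    unfolding cohom_nz_glue by blast
  have "Lnk = Del" using assms by auto
  then have "\<forall>T\<in>indep E Del. card T = p \<longrightarrow> a T = cobdry \<epsilon> b T"
    "\<forall>T\<in>indep E Lnk. Suc (card T) = p \<longrightarrow> b T = b T - cobdry \<epsilon> (\<lambda>_. 0) T"
    using ab(2) by (simp_all add: cobdry_def)
  then show False using ab(3) unfolding bounding_def by blast
qed

end

lemma cohom_nz_isolated:
  assumes "finite W" "\<forall>e\<in>E. card e = 2" "sign_system W \<epsilon>" "v \<in> W" "nbh E v \<inter> W \<subseteq> {v}"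
  shows "\<not> cohom_nz \<epsilon> E W p"
proof -
  interpret vertex_deletion \<epsilon> E W v by unfold_locales (use assms in auto)
  show ?thesis using isolated_zero[OF assms(5)] .
qed

text \<open>The complex whose only face is the empty set has cohomology in reduced degree -1 alone.
  If the empty set is an edge, there is no face at all.\<close>

lemma cohom_nz_empty: "cohom_nz \<epsilon> E {} p \<longleftrightarrow> p = 0 \<and> {} \<notin> E"
proof -
  have i: "indep E {} = (if {} \<in> E then {} else {{}})" unfolding indep_def by auto
  have "\<exists>c :: 'a set \<Rightarrow> 'b. c {} \<noteq> 0" by (rule exI[of _ "\<lambda>_. 1"]) simp
  then show ?thesis
    unfolding cohom_nz_def i by (simp add: cobdry_def)
qed

text \<open>Deleting w isolates u, so the deletion is acyclic and the long exact sequence identifies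
  the cohomology of W with that of the link of w, shifted by one.\<close>

lemma cohom_nz_pendant:
  assumes fin: "finite W" and E: "\<forall>e\<in>E. card e = 2" and s: "sign_system W \<epsilon>"
    and u: "u \<in> W" "w \<in> W" "u \<noteq> w" "nbh E u \<inter> W = {w}"
  shows "cohom_nz \<epsilon> E W p \<longleftrightarrow> (\<exists>q. p = Suc q \<and> cohom_nz \<epsilon> E (W - insert w (nbh E w)) q)"
proof -
  interpret vertex_deletion \<epsilon> E W w by unfold_locales (use assms in auto)
  have "\<not> cohom_nz \<epsilon> E (W - {w}) q" for q
    by (rule cohom_nz_isolated[where v = u]) (use assms sign_system_subset[OF s, of "W - {w}"] in auto)
  then show ?thesis using nz_cases nz_link by blast
qed

text \<open>In the link of v all neighbours of u are gone while u itself is still there, so the link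
  is acyclic and removing v changes nothing.\<close>

lemma cohom_nz_fold:
  assumes fin: "finite W" and E: "\<forall>e\<in>E. card e = 2" and s: "sign_system W \<epsilon>"
    and u: "u \<in> W" "v \<in> W" "u \<noteq> v" "nbh E u \<inter> W \<subseteq> nbh E v"
  shows "cohom_nz \<epsilon> E W p \<longleftrightarrow> cohom_nz \<epsilon> E (W - {v}) p"
proof -
  interpret vertex_deletion \<epsilon> E W v by unfold_locales (use assms in auto)
  have nl: "x \<notin> nbh E x" for x using E unfolding nbh_def by fastforce
  have "u \<notin> nbh E v"
  proof
    assume "u \<in> nbh E v"
    then have "v \<in> nbh E u" unfolding nbh_def by (simp add: insert_commute)
    then show False using u nl by blast
  qed
  then have "\<not> cohom_nz \<epsilon> E (W - insert v (nbh E v)) q" for q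
    by (intro cohom_nz_isolated[where v = u])
       (use assms sign_system_subset[OF s, of "W - insert v (nbh E v)"] in auto)
  then show ?thesis using nz_cases nz_delete by blast
qed

section \<open>Taylor and Koszul complexes\<close>

abbreviation "keys \<equiv> Poly_Mapping.keys"
abbreviation "lookup \<equiv> Poly_Mapping.lookup"
abbreviation "single \<equiv> Poly_Mapping.single"

definition ind :: "'v set \<Rightarrow> 'v \<Rightarrow>\<^sub>0 nat" where
  "ind A = (\<Sum>v\<in>A. single v 1)"

lemma lookup_ind: "finite A \<Longrightarrow> lookup (ind A) v = (if v \<in> A then 1 else 0)"
  unfolding ind_def by (simp add: lookup_sum lookup_single when_def)

lemma keys_ind [simp]: "finite A \<Longrightarrow> keys (ind A) = A"
  by (auto simp: in_keys_iff lookup_ind split: if_splits)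

lemma ind_empty [simp]: "ind {} = 0"
  unfolding ind_def by simp

lemma ind_disjoint_union: "finite A \<Longrightarrow> finite B \<Longrightarrow> A \<inter> B = {} \<Longrightarrow> ind (A \<union> B) = ind A + ind B"
  unfolding ind_def by (rule sum.union_disjoint)

lemma keys_plus_nat: "keys (a + b :: 'v \<Rightarrow>\<^sub>0 nat) = keys a \<union> keys b"
  by (auto simp: in_keys_iff lookup_add)

lemma minus_ind_plus: "finite A \<Longrightarrow> A \<subseteq> keys a \<Longrightarrow> a - ind A + ind A = a"
  by (rule poly_mapping_eqI) (auto simp: lookup_add lookup_minus lookup_ind in_keys_iff)

lemma lookup_single_mult:
  fixes p :: "('v \<Rightarrow>\<^sub>0 nat) \<Rightarrow>\<^sub>0 'a::comm_ring_1"
  shows "lookup (single m c * p) (m + b) = c * lookup p b"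
proof -
  have "lookup (single m c * p) (m + b)
      = (\<Sum>l. ((c * (\<Sum>q. lookup p q when m + b = l + q)) when m = l))"
    unfolding lookup_mult lookup_single when_mult ..
  also have "\<dots> = c * (\<Sum>q. lookup p q when b = q)"
    by simp
  finally show ?thesis by simp
qed

lemma lookup_ind_mult:
  fixes p :: "('v \<Rightarrow>\<^sub>0 nat) \<Rightarrow>\<^sub>0 'a::comm_ring_1"
  assumes "finite A"
  shows "lookup (single (ind A) c * p) a =
    (if A \<subseteq> keys a then c * lookup p (a - ind A) else 0)"
proof (cases "A \<subseteq> keys a")
  case True
  then show ?thesis
    using lookup_single_mult[of "ind A" c p "a - ind A"] minus_ind_plus[OF assms True]
    by (simp add: add.commute)
next
  case False
  have "a \<notin> keys (single (ind A) c * p)"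
  proof
    assume "a \<in> keys (single (ind A) c * p)"
    then obtain b where "a = ind A + b"
      using keys_mult[of "single (ind A) c" p] by (auto split: if_splits)
    then show False using False assms by (simp add: keys_plus_nat)
  qed
  then show ?thesis using False by (simp add: in_keys_iff)
qed

lemma poly_mapping_of_finite_support:
  "finite {x. f x \<noteq> 0} \<Longrightarrow> \<exists>p. \<forall>x. lookup p x = f x"
  by (rule exI[of _ "Abs_poly_mapping f"]) simp

text \<open>The Taylor complex of the squarefree monomials with supports \<open>A u\<close>. Taking for \<open>A u\<close> the
  edges of a graph gives a resolution of its edge ideal; singletons give the Koszul complex.\<close>

locale weighted_simplex =
  fixes U :: "'u set" and A :: "'u \<Rightarrow> 'v set" and \<epsilon> :: "'u \<Rightarrow> 'u set \<Rightarrow> 'k::field"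
  assumes finite_U: "finite U" and finite_A: "\<And>u. u \<in> U \<Longrightarrow> finite (A u)"
    and signs: "sign_system U \<epsilon>"
begin

definition B :: "'u set \<Rightarrow> 'v set" where
  "B S = (\<Union>u\<in>S. A u)"

text \<open>The monomial factor is the quotient of the least common multiples belonging to
  \<open>insert u S\<close> and S, which are squarefree with supports \<open>B (insert u S)\<close>
  and \<open>B S\<close>.\<close>

definition tdiff :: "('u set \<Rightarrow> ('v, 'k) mpoly) \<Rightarrow> 'u set \<Rightarrow> ('v, 'k) mpoly" where
  "tdiff \<Omega> S = (\<Sum>u\<in>U - S. single (ind (A u - B S)) (\<epsilon> u S) * \<Omega> (insert u S))"

text \<open>The component of multidegree \<open>a\<close>; there the Taylor complex becomes the simplicial chain
  complex of the full simplex on \<open>Uat a\<close>, which is a cone unless \<open>Uat a\<close> is empty.\<close>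

definition co :: "('u set \<Rightarrow> ('v, 'k) mpoly) \<Rightarrow> ('v \<Rightarrow>\<^sub>0 nat) \<Rightarrow> 'u set \<Rightarrow> 'k" where
  "co \<Omega> a S = (if B S \<subseteq> keys a then lookup (\<Omega> S) (a - ind (B S)) else 0)"

definition Uat :: "('v \<Rightarrow>\<^sub>0 nat) \<Rightarrow> 'u set" where
  "Uat a = {u\<in>U. A u \<subseteq> keys a}"

lemma finite_B: "S \<subseteq> U \<Longrightarrow> finite (B S)"
  unfolding B_def using finite_U finite_A finite_subset by blast

lemma B_insert: "B (insert u S) = A u \<union> B S"
  unfolding B_def by auto

lemma ind_B_insert:
  assumes "u \<in> U" "S \<subseteq> U"
  shows "ind (A u - B S) + ind (B S) = ind (B (insert u S))"
proof -
  have "B (insert u S) = (A u - B S) \<union> B S" unfolding B_insert by auto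
  then show ?thesis using ind_disjoint_union[of "A u - B S" "B S"] finite_B[OF assms(2)] finite_A[OF assms(1)]
    by (metis Diff_disjoint Int_commute finite_Diff)
qed

text \<open>Within one multidegree the monomial factors only translate exponents, so just the signs
  remain. A vertex u with \<open>A u\<close> not inside the support of a contributes zero, which
  cuts U down to \<open>Uat a\<close>.\<close>

lemma co_tdiff:
  assumes "S \<subseteq> U" "B S \<subseteq> keys a"
  shows "co (tdiff \<Omega>) a S = bdry (Uat a) \<epsilon> (co \<Omega> a) S"
proof -
  have t: "lookup (single (ind (A u - B S)) (\<epsilon> u S) * \<Omega> (insert u S)) (a - ind (B S))
      = (if A u \<subseteq> keys a then \<epsilon> u S * co \<Omega> a (insert u S) else 0)" if u: "u \<in> U - S" for u
  proof -
    have k: "A u - B S \<subseteq> keys (a - ind (B S)) \<longleftrightarrow> A u \<subseteq> keys a"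
      using assms finite_B[OF assms(1)] by (auto simp: in_keys_iff lookup_minus lookup_ind)
    have "a - ind (B S) - ind (A u - B S) = a - ind (B (insert u S))"
      using ind_B_insert[of u S] u assms(1) by (simp add: diff_diff_add add.commute)
    moreover have "finite (A u - B S)" using finite_A u by auto
    ultimately show ?thesis
      using assms(2) by (simp add: lookup_ind_mult k co_def B_insert)
  qed
  have "co (tdiff \<Omega>) a S = (\<Sum>u\<in>U - S. if A u \<subseteq> keys a then \<epsilon> u S * co \<Omega> a (insert u S) else 0)"
    using assms t unfolding co_def[of "tdiff \<Omega>"] tdiff_def by (simp add: lookup_sum)
  also have "\<dots> = (\<Sum>u\<in>Uat a - S. \<epsilon> u S * co \<Omega> a (insert u S))"
    by (rule sum.mono_neutral_cong_right) (use finite_U in \<open>auto simp: Uat_def\<close>)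
  finally show ?thesis unfolding bdry_def .
qed

lemma co_lookup: "S \<subseteq> U \<Longrightarrow> co \<Omega> (m + ind (B S)) S = lookup (\<Omega> S) m"
  using finite_B[of S] unfolding co_def by (auto simp: keys_plus_nat)

lemma tdiff_cong:
  "(\<And>u. u \<in> U - S \<Longrightarrow> \<Omega> (insert u S) = \<Omega>' (insert u S)) \<Longrightarrow> tdiff \<Omega> S = tdiff \<Omega>' S"
  unfolding tdiff_def by (rule sum.cong) auto

text \<open>Inserting u and v in either order multiplies by the same monomial, since the quotients
  of least common multiples telescope; the signs of the two orders are opposite.\<close>

lemma tdiff_tdiff:
  assumes "S \<subseteq> U"
  shows "tdiff (tdiff \<Omega>) S = 0"
proof -
  define f where "f u v = single (ind (A u - B S)) (\<epsilon> u S) *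
    (single (ind (A v - B (insert u S))) (\<epsilon> v (insert u S)) * \<Omega> (insert v (insert u S)))" for u v
  have "tdiff (tdiff \<Omega>) S = (\<Sum>u\<in>U - S. \<Sum>v\<in>(U - S) - {u}. f u v)"
    unfolding tdiff_def[of "tdiff \<Omega>"] tdiff_def[of \<Omega>] sum_distrib_left f_def
    by (intro sum.cong) auto
  also have "\<dots> = 0"
  proof (rule antisymmetric_sum_zero)
    fix u v assume uv: "u \<in> U - S" "v \<in> U - S" "u \<noteq> v"
    have i: "ind (A u - B S) + ind (A v - B (insert u S)) + ind (B S) = ind (B (insert v (insert u S)))"
      if "u \<in> U - S" "v \<in> U - S" for u v
    proof -
      have "ind (A u - B S) + ind (A v - B (insert u S)) + ind (B S)
          = ind (A v - B (insert u S)) + (ind (A u - B S) + ind (B S))" by (simp add: ac_simps)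
      then show ?thesis
        using ind_B_insert[of u S] ind_B_insert[of v "insert u S"] that assms by simp
    qed
    have "ind (A u - B S) + ind (A v - B (insert u S)) = ind (A v - B S) + ind (A u - B (insert v S))"
    proof -
      have "ind (A u - B S) + ind (A v - B (insert u S)) + ind (B S)
          = ind (A v - B S) + ind (A u - B (insert v S)) + ind (B S)"
        unfolding i[OF uv(1,2)] i[OF uv(2,1)] by (simp add: insert_commute)
      then show ?thesis by (rule add_right_imp_eq)
    qed
    moreover have "\<epsilon> u S * \<epsilon> v (insert u S) = - (\<epsilon> v S * \<epsilon> u (insert v S))"
      using sign_anticommute[OF signs, of u v S] uv assms by auto
    ultimately show "f u v = - f v u"
      unfolding f_def by (simp add: mult.assoc[symmetric] mult_single insert_commute single_uminus)
  qed (use finite_U in auto)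
  finally show ?thesis .
qed

lemma tdiff_add: "tdiff (\<lambda>T. \<Omega> T + \<Omega>' T) S = tdiff \<Omega> S + tdiff \<Omega>' S"
  unfolding tdiff_def by (simp add: distrib_left sum.distrib)

lemma tdiff_diff: "tdiff (\<lambda>T. \<Omega> T - \<Omega>' T) S = tdiff \<Omega> S - tdiff \<Omega>' S"
  unfolding tdiff_def by (simp add: right_diff_distrib sum_subtractf)

lemma tdiff_sum_mult: "tdiff (\<lambda>T. \<Sum>b\<in>I. d b * \<Omega> b T) S = (\<Sum>b\<in>I. d b * tdiff (\<Omega> b) S)"
proof -
  have "tdiff (\<lambda>T. \<Sum>b\<in>I. d b * \<Omega> b T) S =
     (\<Sum>u\<in>U - S. \<Sum>b\<in>I. d b * (single (ind (A u - B S)) (\<epsilon> u S) * \<Omega> b (insert u S)))"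
    unfolding tdiff_def sum_distrib_left by (simp add: mult.left_commute)
  then show ?thesis
    unfolding tdiff_def sum_distrib_left by (simp add: sum.swap[of _ I])
qed

text \<open>For \<open>s = 0\<close> there is no cycle condition, and the hypothesis \<open>cov\<close> says that \<open>\<Omega> {}\<close> lies in the
  ideal generated by the monomials \<open>ind (A u)\<close>; for \<open>s > 0\<close> it is automatic.\<close>

lemma tdiff_exact:
  assumes cyc: "\<And>S. S \<subseteq> U \<Longrightarrow> Suc (card S) = s \<Longrightarrow> tdiff \<Omega> S = 0"
    and cov: "\<And>m. s = 0 \<Longrightarrow> m \<in> keys (\<Omega> {}) \<Longrightarrow> \<exists>u\<in>U. A u \<subseteq> keys m"
  obtains \<eta> where "\<And>S. S \<subseteq> U \<Longrightarrow> card S = s \<Longrightarrow> \<Omega> S = tdiff \<eta> S"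
    and "\<And>S m. S \<subseteq> U \<Longrightarrow> m \<in> keys (\<eta> S) \<Longrightarrow>
      \<exists>S'\<subseteq>U. card S' = s \<and> (\<exists>m'\<in>keys (\<Omega> S'). m + ind (B S) = m' + ind (B S'))"
proof -
  \<comment> \<open>Apex of the cone in multidegree a. It is arbitrary when \<open>Uat a\<close> is
    empty, a case settled separately through \<open>cov\<close>.\<close>
  define pick where "pick a = (SOME u. u \<in> Uat a)" for a
  define b where "b a S = (if S \<subseteq> U \<and> card S = Suc s \<and> B S \<subseteq> keys a then cone (pick a) \<epsilon> (co \<Omega> a) S else 0)" for a S
  \<comment> \<open>Every nonzero value descends from a monomial of \<Omega> in the same
    multidegree. This makes the supports finite, so that the values assemble to polynomials, and it
    gives the second conclusion.\<close>
  have b_nz: "\<exists>S'\<subseteq>U. card S' = s \<and> (\<exists>m'\<in>keys (\<Omega> S'). a = m' + ind (B S'))" if nz: "b a S \<noteq> 0" for a S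
  proof -
    let ?S = "S - {pick a}"
    have S: "S \<subseteq> U" "card S = Suc s" "B S \<subseteq> keys a" "pick a \<in> S" "co \<Omega> a ?S \<noteq> 0"
      using nz unfolding b_def cone_def by (auto split: if_splits)
    then have "card ?S = s" by simp
    moreover have "B ?S \<subseteq> keys a" "a - ind (B ?S) \<in> keys (\<Omega> ?S)"
      using S(5) unfolding co_def in_keys_iff by (auto split: if_splits)
    moreover have "a = (a - ind (B ?S)) + ind (B ?S)"
      by (rule sym, rule minus_ind_plus[OF finite_B \<open>B ?S \<subseteq> keys a\<close>]) (use S(1) in auto)
    ultimately show ?thesis using S(1) by blast
  qed
  define F where "F = (\<Union>S'\<in>Pow U. (\<lambda>m'. m' + ind (B S')) ` keys (\<Omega> S'))"
  have "finite F" unfolding F_def using finite_U by auto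
  have "\<exists>p. \<forall>m. lookup p m = b (m + ind (B S)) S" for S
  proof (rule poly_mapping_of_finite_support, rule finite_imageD)
    have "a \<in> F" if "b a S \<noteq> 0" for a
      using b_nz[OF that] unfolding F_def by blast
    then have "(\<lambda>m. m + ind (B S)) ` {m. b (m + ind (B S)) S \<noteq> 0} \<subseteq> F" by blast
    then show "finite ((\<lambda>m. m + ind (B S)) ` {m. b (m + ind (B S)) S \<noteq> 0})"
      using \<open>finite F\<close> finite_subset by blast
  qed (auto intro: inj_onI)
  then obtain \<eta> where \<eta>: "\<And>S m. lookup (\<eta> S) m = b (m + ind (B S)) S"
    by metis
  have co_\<eta>: "co \<eta> a S = b a S" if "S \<subseteq> U" for a S
  proof (cases "B S \<subseteq> keys a")
    case True
    then show ?thesis using minus_ind_plus[OF finite_B[OF that]] by (simp add: co_def \<eta>)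
  next
    case False
    then show ?thesis by (simp add: co_def b_def)
  qed
  show thesis
  proof (rule that[of \<eta>])
    fix S m assume "S \<subseteq> U" "m \<in> keys (\<eta> S)"
    then show "\<exists>S'\<subseteq>U. card S' = s \<and> (\<exists>m'\<in>keys (\<Omega> S'). m + ind (B S) = m' + ind (B S'))"
      using b_nz[of "m + ind (B S)" S] by (simp add: in_keys_iff \<eta>)
  next
    fix S assume S: "S \<subseteq> U" "card S = s"
    have finS: "finite S" using S(1) finite_U finite_subset by blast
    show "\<Omega> S = tdiff \<eta> S"
    proof (rule poly_mapping_eqI)
      fix m
      define a where "a = m + ind (B S)"
      have Ba: "B S \<subseteq> keys a" unfolding a_def using finite_B[OF S(1)] by (simp add: keys_plus_nat)
      have SU: "S \<subseteq> Uat a" using S(1) Ba unfolding Uat_def B_def by auto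
      have "lookup (tdiff \<eta> S) m = bdry (Uat a) \<epsilon> (co \<eta> a) S"
        using co_lookup[OF S(1), of "tdiff \<eta>" m] co_tdiff[OF S(1) Ba] unfolding a_def by simp
      also have "\<dots> = bdry (Uat a) \<epsilon> (cone (pick a) \<epsilon> (co \<Omega> a)) S"
        unfolding bdry_def
      proof (rule sum.cong)
        fix u assume u: "u \<in> Uat a - S"
        have "insert u S \<subseteq> U" "B (insert u S) \<subseteq> keys a" "card (insert u S) = Suc s"
          using u S Ba finS unfolding Uat_def B_insert by auto
        then show "\<epsilon> u S * co \<eta> a (insert u S) = \<epsilon> u S * cone (pick a) \<epsilon> (co \<Omega> a) (insert u S)"
          using co_\<eta>[of "insert u S" a] unfolding b_def by simp
      qed simp
      also have "\<dots> = co \<Omega> a S"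
      proof (cases "Uat a = {}")
        case True
        have "S = {}" using SU True by auto
        then have "co \<Omega> a S = 0"
          using cov[of a] S True unfolding co_def Uat_def B_def by (auto simp: in_keys_iff)
        then show ?thesis using True unfolding bdry_def by simp
      next
        case False
        then have p: "pick a \<in> Uat a" unfolding pick_def by (simp add: some_in_eq)
        show ?thesis
        proof (rule bdry_cone)
          show "finite (Uat a)" unfolding Uat_def using finite_U by simp
          show "sign_system (Uat a) \<epsilon>" by (rule sign_system_subset[OF signs]) (auto simp: Uat_def)
          show "pick a \<in> Uat a" "S \<subseteq> Uat a" by fact+
          assume v: "pick a \<in> S"
          let ?S = "S - {pick a}"
          have "tdiff \<Omega> ?S = 0" using cyc[of ?S] S v finS
            by (metis Diff_subset card_Suc_Diff1 order_trans)
          then have "co (tdiff \<Omega>) a ?S = 0" unfolding co_def by simp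
          moreover have "B ?S \<subseteq> keys a" using Ba unfolding B_def by blast
          ultimately show "bdry (Uat a) \<epsilon> (co \<Omega> a) ?S = 0"
            using co_tdiff[of ?S a \<Omega>] S(1) by auto
        qed
      qed
      also have "\<dots> = lookup (\<Omega> S) m"
        using co_lookup[OF S(1)] unfolding a_def by simp
      finally show "lookup (\<Omega> S) m = lookup (tdiff \<eta> S) m" by simp
    qed
  qed
qed

end

section \<open>Homogeneous polynomials\<close>

lemma mono_degree_plus: "mono_degree (a + b) = mono_degree a + mono_degree b"
proof -
  have s: "mono_degree c = (\<Sum>v\<in>keys a \<union> keys b. lookup c v)"
    if "keys c \<subseteq> keys a \<union> keys b" for c
    unfolding mono_degree_def using that by (intro sum.mono_neutral_left) (auto simp: in_keys_iff)
  show ?thesis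
    using s[of a] s[of b] s[of "a + b"] by (simp add: keys_plus_nat lookup_add sum.distrib)
qed

lemma mono_degree_ind: "finite A \<Longrightarrow> mono_degree (ind A) = card A"
  unfolding mono_degree_def by (simp add: lookup_ind)

lemma mono_degree_0 [simp]: "mono_degree 0 = 0"
  unfolding mono_degree_def by simp

lemma mono_degree_eq_0: "mono_degree m = 0 \<longleftrightarrow> m = 0"
  unfolding mono_degree_def by (auto simp: in_keys_iff intro!: poly_mapping_eqI)

lemma homogeneous_0 [simp]: "homogeneous d 0"
  unfolding homogeneous_def by simp

lemma homogeneous_add: "homogeneous d p \<Longrightarrow> homogeneous d q \<Longrightarrow> homogeneous d (p + q)"
  using keys_add[of p q] unfolding homogeneous_def by blast

lemma homogeneous_uminus: "homogeneous d p \<Longrightarrow> homogeneous d (- p)"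
  unfolding homogeneous_def by (simp add: in_keys_iff)

lemma homogeneous_diff: "homogeneous d p \<Longrightarrow> homogeneous d q \<Longrightarrow> homogeneous d (p - q)"
  using homogeneous_add[of d p "- q"] homogeneous_uminus[of d q] by simp

lemma homogeneous_sum: "(\<And>x. x \<in> X \<Longrightarrow> homogeneous d (f x)) \<Longrightarrow> homogeneous d (sum f X)"
  by (induction X rule: infinite_finite_induct) (auto intro: homogeneous_add)

lemma homogeneous_mult:
  assumes "homogeneous d p" "homogeneous e q" "d + e = f"
  shows "homogeneous f (p * q)"
  using keys_mult[of p q] assms unfolding homogeneous_def by (fastforce simp: mono_degree_plus)

lemma poly_ring_0 [simp]: "0 \<in> poly_ring X"
  unfolding poly_ring_def by simp

lemma poly_ring_add: "p \<in> poly_ring X \<Longrightarrow> q \<in> poly_ring X \<Longrightarrow> p + q \<in> poly_ring X"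
  using keys_add[of p q] unfolding poly_ring_def by blast

lemma poly_ring_uminus: "p \<in> poly_ring X \<Longrightarrow> - p \<in> poly_ring X"
  unfolding poly_ring_def by (simp add: in_keys_iff)

lemma poly_ring_diff: "p \<in> poly_ring X \<Longrightarrow> q \<in> poly_ring X \<Longrightarrow> p - q \<in> poly_ring X"
  using poly_ring_add[of p X "- q"] poly_ring_uminus[of q X] by simp

lemma poly_ring_sum: "(\<And>x. x \<in> I \<Longrightarrow> f x \<in> poly_ring X) \<Longrightarrow> sum f I \<in> poly_ring X"
  by (induction I rule: infinite_finite_induct) (auto intro: poly_ring_add)

lemma poly_ring_mult: "p \<in> poly_ring X \<Longrightarrow> q \<in> poly_ring X \<Longrightarrow> p * q \<in> poly_ring X"
  using keys_mult[of p q] unfolding poly_ring_def by (fastforce simp: keys_plus_nat)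

lemma poly_ring_single: "keys m \<subseteq> X \<Longrightarrow> single m c \<in> poly_ring X"
  unfolding poly_ring_def by simp

lemma homogeneous_single: "int (mono_degree m) = d \<Longrightarrow> homogeneous d (single m c)"
  unfolding homogeneous_def by simp

definition hpart :: "int \<Rightarrow> ('v, 'k::field) mpoly \<Rightarrow> ('v, 'k) mpoly" where
  "hpart e p = (\<Sum>m\<in>{m\<in>keys p. int (mono_degree m) = e}.
     single m (lookup p m))"

lemma lookup_hpart:
  "lookup (hpart e p) m = (if int (mono_degree m) = e then lookup p m else 0)"
proof -
  have "lookup (hpart e p) m
     = (\<Sum>m'\<in>{m\<in>keys p. int (mono_degree m) = e}. if m' = m then lookup p m else 0)"
    unfolding hpart_def lookup_sum by (intro sum.cong) (auto simp: lookup_single)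
  also have "\<dots> = (if int (mono_degree m) = e then lookup p m else 0)"
    by (auto simp: sum.delta in_keys_iff)
  finally show ?thesis .
qed

lemma homogeneous_hpart: "homogeneous e (hpart e p)"
  unfolding homogeneous_def by (auto simp: in_keys_iff lookup_hpart split: if_splits)

lemma poly_ring_hpart: "p \<in> poly_ring X \<Longrightarrow> hpart e p \<in> poly_ring X"
  unfolding poly_ring_def by (auto simp: in_keys_iff lookup_hpart split: if_splits)

lemma hpart_homogeneous: "homogeneous e p \<Longrightarrow> hpart e p = p"
  unfolding homogeneous_def by (rule poly_mapping_eqI) (auto simp: lookup_hpart in_keys_iff)

lemma hpart_add: "hpart e (p + q) = hpart e p + hpart e q"
  by (rule poly_mapping_eqI) (simp add: lookup_hpart lookup_add)

lemma hpart_0 [simp]: "hpart e 0 = 0"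
  by (rule poly_mapping_eqI) (simp add: lookup_hpart)

lemma hpart_sum: "hpart e (sum f X) = (\<Sum>x\<in>X. hpart e (f x))"
  by (induction X rule: infinite_finite_induct) (auto simp: hpart_add)

lemma hpart_mult:
  assumes h: "homogeneous d h"
  shows "hpart e (h * p) = h * hpart (e - d) p"
proof -
  \<comment> \<open>This rest of p has nothing in degree e - d, so its product with h has nothing in
    degree e.\<close>
  define p2 where "p2 = p - hpart (e - d) p"
  have "hpart e (h * p2) = 0"
  proof (rule poly_mapping_eqI)
    fix m
    have "m \<notin> keys (h * p2)" if "int (mono_degree m) = e"
    proof
      assume "m \<in> keys (h * p2)"
      then obtain a b where ab: "m = a + b" "a \<in> keys h" "b \<in> keys p2"
        using keys_mult[of h p2] by blast
      have "int (mono_degree a) = d" using h ab unfolding homogeneous_def by blast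
      then have "int (mono_degree b) = e - d" using that ab by (simp add: mono_degree_plus)
      then show False using ab(3) unfolding p2_def by (simp add: in_keys_iff lookup_minus lookup_hpart)
    qed
    then show "lookup (hpart e (h * p2)) m = lookup 0 m"
      by (simp add: lookup_hpart in_keys_iff)
  qed
  moreover have "hpart e (h * hpart (e - d) p) = h * hpart (e - d) p"
    by (rule hpart_homogeneous, rule homogeneous_mult[OF h homogeneous_hpart]) simp
  moreover have "h * p = h * hpart (e - d) p + h * p2" unfolding p2_def by (simp add: algebra_simps)
  ultimately show ?thesis by (simp add: hpart_add)
qed

text \<open>A sum of exponent vectors vanishes only if both summands do. Taking constant
  coefficients is therefore the ring map onto the residue field, along which resolutions are base
  changed.\<close>

lemma lookup_mult_0:
  fixes p q :: "('v, 'k::field) mpoly"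
  shows "lookup (p * q) 0 = lookup p 0 * lookup q 0"
proof -
  have "lookup (r * q) 0 = 0" if r: "lookup r 0 = 0" for r :: "('v, 'k) mpoly"
  proof -
    have "0 \<notin> keys (r * q)"
    proof
      assume "0 \<in> keys (r * q)"
      then obtain a b where ab: "0 = a + b" "a \<in> keys r"
        using keys_mult[of r q] by blast
      then have "mono_degree a = 0" by (metis mono_degree_plus mono_degree_0 add_is_0)
      then show False using ab r by (simp add: mono_degree_eq_0 in_keys_iff)
    qed
    then show ?thesis by (simp add: in_keys_iff)
  qed
  from this[of "p - single 0 (lookup p 0)"]
  have "lookup (p * q) 0 = lookup (single 0 (lookup p 0) * q) 0"
    by (simp add: lookup_minus left_diff_distrib)
  then show ?thesis using lookup_single_mult[of 0 "lookup p 0" q 0] by simp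
qed

text \<open>Fixing the value 0 beyond the rank makes equality of module elements the same as
  equality of functions.\<close>

definition free_fun :: "'v set \<Rightarrow> nat \<Rightarrow> (nat \<Rightarrow> ('v, 'k::field) mpoly) set" where
  "free_fun V r = {f. \<forall>b. if b < r then f b \<in> poly_ring V else f b = 0}"

definition mat_fun :: "nat \<Rightarrow> nat \<Rightarrow> (nat \<Rightarrow> nat \<Rightarrow> ('v, 'k::field) mpoly) \<Rightarrow>
    (nat \<Rightarrow> ('v, 'k) mpoly) \<Rightarrow> nat \<Rightarrow> ('v, 'k) mpoly" where
  "mat_fun m n M f a = (if a < m then \<Sum>b<n. M a b * f b else 0)"

section \<open>Koszul homology and Tor\<close>

text \<open>The index is shifted by one with respect to a free resolution of an ideal: position \<open>0\<close> is
  the polynomial ring, and \<open>d 0\<close> is the augmentation. Elements of the free modules are functions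
  vanishing outside the range of the rank.\<close>

locale graded_complex =
  fixes V :: "'v set" and \<epsilon> :: "'v \<Rightarrow> 'v set \<Rightarrow> 'k::field"
    and rank :: "nat \<Rightarrow> nat" and shift :: "nat \<Rightarrow> nat \<Rightarrow> int"
    and d :: "nat \<Rightarrow> nat \<Rightarrow> nat \<Rightarrow> ('v, 'k) mpoly"
  assumes finite_V: "finite V" and signs: "sign_system V \<epsilon>"
    and d_ring: "\<And>q a b. a < rank q \<Longrightarrow> b < rank (Suc q) \<Longrightarrow> d q a b \<in> poly_ring V"
    and d_homogeneous: "\<And>q a b. a < rank q \<Longrightarrow> b < rank (Suc q) \<Longrightarrow>
      homogeneous (shift (Suc q) b - shift q a) (d q a b)"
    and d_exact: "\<And>q f. f \<in> free_fun V (rank (Suc q)) \<Longrightarrow>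
      mat_fun (rank q) (rank (Suc q)) (d q) f = (\<lambda>_. 0) \<Longrightarrow>
      \<exists>g\<in>free_fun V (rank (Suc (Suc q))). mat_fun (rank (Suc q)) (rank (Suc (Suc q))) (d (Suc q)) g = f"
    and d_complex: "\<And>q g. g \<in> free_fun V (rank (Suc (Suc q))) \<Longrightarrow>
      mat_fun (rank q) (rank (Suc q)) (d q)
        (mat_fun (rank (Suc q)) (rank (Suc (Suc q))) (d (Suc q)) g) = (\<lambda>_. 0)"
begin

sublocale koszul: weighted_simplex V "\<lambda>v. {v}" \<epsilon>
  by unfold_locales (use finite_V signs in auto)

lemma koszul_B: "koszul.B S = S"
  unfolding koszul.B_def by auto

definition D :: "nat \<Rightarrow> (nat \<Rightarrow> ('v, 'k) mpoly) \<Rightarrow> nat \<Rightarrow> ('v, 'k) mpoly" where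
  "D q = mat_fun (rank q) (rank (Suc q)) (d q)"

definition Kd :: "('v set \<Rightarrow> nat \<Rightarrow> ('v, 'k) mpoly) \<Rightarrow> 'v set \<Rightarrow> nat \<Rightarrow> ('v, 'k) mpoly" where
  "Kd \<omega> S = (\<lambda>b. koszul.tdiff (\<lambda>T. \<omega> T b) S)"

definition Gr :: "nat \<Rightarrow> int \<Rightarrow> (nat \<Rightarrow> ('v, 'k) mpoly) set" where
  "Gr q e = {f \<in> free_fun V (rank q). \<forall>b<rank q. homogeneous (e - shift q b) (f b)}"

text \<open>Koszul chains of internal degree j: the Koszul basis element of S has degree s, so its
  coefficient has degree j - s. Values at sets of other sizes are left free.\<close>

definition KC :: "nat \<Rightarrow> nat \<Rightarrow> int \<Rightarrow> ('v set \<Rightarrow> nat \<Rightarrow> ('v, 'k) mpoly) set" where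
  "KC q s j = {\<omega>. \<forall>S\<subseteq>V. card S = s \<longrightarrow> \<omega> S \<in> Gr q (j - int s)}"

lemma GrI:
  "(\<And>b. b < rank q \<Longrightarrow> f b \<in> poly_ring V) \<Longrightarrow> (\<And>b. b < rank q \<Longrightarrow> homogeneous (e - shift q b) (f b)) \<Longrightarrow>
    (\<And>b. \<not> b < rank q \<Longrightarrow> f b = 0) \<Longrightarrow> f \<in> Gr q e"
  unfolding Gr_def free_fun_def by auto

lemma GrD:
  assumes "f \<in> Gr q e"
  shows "b < rank q \<Longrightarrow> f b \<in> poly_ring V" "b < rank q \<Longrightarrow> homogeneous (e - shift q b) (f b)"
    "\<not> b < rank q \<Longrightarrow> f b = 0" "f \<in> free_fun V (rank q)"
  using assms unfolding Gr_def free_fun_def by (auto split: if_splits)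

lemma KCD: "\<omega> \<in> KC q s j \<Longrightarrow> S \<subseteq> V \<Longrightarrow> card S = s \<Longrightarrow> \<omega> S \<in> Gr q (j - int s)"
  unfolding KC_def by blast

lemma D_Gr: "f \<in> Gr (Suc q) e \<Longrightarrow> D q f \<in> Gr q e"
proof (rule GrI)
  fix a assume f: "f \<in> Gr (Suc q) e" and a: "a < rank q"
  then have eq: "D q f a = (\<Sum>b<rank (Suc q). d q a b * f b)"
    unfolding D_def mat_fun_def by simp
  show "D q f a \<in> poly_ring V"
    unfolding eq using GrD(1)[OF f] d_ring a by (intro poly_ring_sum poly_ring_mult) auto
  show "homogeneous (e - shift q a) (D q f a)"
    unfolding eq
  proof (rule homogeneous_sum)
    fix b assume "b \<in> {..<rank (Suc q)}"
    then show "homogeneous (e - shift q a) (d q a b * f b)"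
      using d_homogeneous[OF a, of b] GrD(2)[OF f, of b] by (intro homogeneous_mult) auto
  qed
qed (simp add: D_def mat_fun_def)

lemma Gr_diff: "f \<in> Gr q e \<Longrightarrow> g \<in> Gr q e \<Longrightarrow> (\<lambda>b. f b - g b) \<in> Gr q e"
  using GrD[of f q e] GrD[of g q e] by (intro GrI poly_ring_diff homogeneous_diff) auto

lemma Kd_Gr:
  assumes w: "\<omega> \<in> KC q (Suc s) j" and S: "S \<subseteq> V" "card S = s"
  shows "Kd \<omega> S \<in> Gr q (j - int s)"
proof -
  have fin: "finite S" using S finite_V finite_subset by blast
  have m: "\<omega> (insert u S) \<in> Gr q (j - int (Suc s))" if "u \<in> V - S" for u
    using that S fin by (intro KCD[OF w]) auto
  have i: "ind ({u} - S) = ind {u}" if "u \<in> V - S" for u using that by (simp add: insert_Diff_if)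
  show ?thesis
  proof (rule GrI)
    fix b assume b: "b < rank q"
    show "Kd \<omega> S b \<in> poly_ring V"
      unfolding Kd_def koszul.tdiff_def koszul_B
      by (intro poly_ring_sum poly_ring_mult poly_ring_single) (use GrD(1)[OF m b] i in auto)
    show "homogeneous (j - int s - shift q b) (Kd \<omega> S b)"
      unfolding Kd_def koszul.tdiff_def koszul_B
    proof (rule homogeneous_sum)
      fix u assume u: "u \<in> V - S"
      show "homogeneous (j - int s - shift q b)
         (single (ind ({u} - S)) (\<epsilon> u S) * \<omega> (insert u S) b)"
        by (rule homogeneous_mult[OF homogeneous_single GrD(2)[OF m[OF u] b], of _ 1])
          (simp_all add: i[OF u] mono_degree_ind)
    qed
  next
    fix b assume "\<not> b < rank q"
    then show "Kd \<omega> S b = 0"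
      unfolding Kd_def koszul.tdiff_def using GrD(3)[OF m] by simp
  qed
qed

lemma Kd_cong:
  "(\<And>u. u \<in> V - S \<Longrightarrow> \<omega> (insert u S) = \<omega>' (insert u S)) \<Longrightarrow> Kd \<omega> S = Kd \<omega>' S"
  unfolding Kd_def by (intro ext koszul.tdiff_cong) simp

lemma Kd_Kd: "S \<subseteq> V \<Longrightarrow> Kd (Kd \<omega>) S = (\<lambda>_. 0)"
  unfolding Kd_def using koszul.tdiff_tdiff by simp

lemma Kd_add: "Kd (\<lambda>T b. \<omega> T b + \<omega>' T b) S = (\<lambda>b. Kd \<omega> S b + Kd \<omega>' S b)"
  unfolding Kd_def by (simp add: koszul.tdiff_add)

lemma Kd_diff: "Kd (\<lambda>T b. \<omega> T b - \<omega>' T b) S = (\<lambda>b. Kd \<omega> S b - Kd \<omega>' S b)"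
  unfolding Kd_def by (simp add: koszul.tdiff_diff)

lemma D_add: "D q (\<lambda>b. f b + g b) = (\<lambda>b. D q f b + D q g b)"
  unfolding D_def mat_fun_def by (auto simp: distrib_left sum.distrib)

lemma D_diff: "D q (\<lambda>b. f b - g b) = (\<lambda>b. D q f b - D q g b)"
  unfolding D_def mat_fun_def by (auto simp: right_diff_distrib sum_subtractf)

lemma Kd_D: "Kd (\<lambda>T. D q (\<omega> T)) S = D q (Kd \<omega> S)"
proof
  fix a
  show "Kd (\<lambda>T. D q (\<omega> T)) S a = D q (Kd \<omega> S) a"
    unfolding Kd_def D_def mat_fun_def
    using koszul.tdiff_sum_mult[of "d q a" "\<lambda>b T. \<omega> T b" "{..<rank (Suc q)}" S]
    by (auto simp: koszul.tdiff_def)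
qed

lemma D_D: "f \<in> Gr (Suc (Suc q)) e \<Longrightarrow> D q (D (Suc q) f) = (\<lambda>_. 0)"
  unfolding D_def using d_complex GrD(4) by blast

text \<open>\<open>D q\<close> preserves degrees, so the part of degree e of any preimage is already
  a preimage.\<close>

lemma D_homogeneous_lift:
  assumes f: "f \<in> Gr q e" and g: "g \<in> free_fun V (rank (Suc q))" "D q g = f"
  shows "\<exists>g'\<in>Gr (Suc q) e. D q g' = f"
proof -
  define g' where "g' b = hpart (e - shift (Suc q) b) (g b)" for b
  have "g' \<in> Gr (Suc q) e"
    using g(1) unfolding g'_def free_fun_def
    by (intro GrI poly_ring_hpart homogeneous_hpart) (auto split: if_splits dest: spec)
  moreover have "D q g' = f"
  proof
    fix a
    show "D q g' a = f a"
    proof (cases "a < rank q")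
      case True
      have "d q a b * g' b = hpart (e - shift q a) (d q a b * g b)" if "b < rank (Suc q)" for b
        unfolding hpart_mult[OF d_homogeneous[OF True that]] g'_def by simp
      then have "D q g' a = hpart (e - shift q a) (D q g a)"
        using True unfolding D_def mat_fun_def by (simp add: hpart_sum)
      then show ?thesis unfolding g(2) using hpart_homogeneous[OF GrD(2)[OF f True]] by simp
    next
      case False
      then show ?thesis using GrD(3)[OF f] unfolding D_def mat_fun_def by simp
    qed
  qed
  ultimately show ?thesis by blast
qed

lemma D_exact:
  assumes f: "f \<in> Gr (Suc q) e" and "D q f = (\<lambda>_. 0)"
  obtains g where "g \<in> Gr (Suc (Suc q)) e" "D (Suc q) g = f"
  using d_exact[OF GrD(4)[OF f]] assms(2) D_homogeneous_lift[OF f] unfolding D_def by blast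

text \<open>Exactness of the Koszul complex of a free module, one coordinate at a time. The
  multidegrees recorded by \<open>tdiff_exact\<close> keep the solution in the right degree and in
  the variables V. In position 0 the missing constant terms say that the element lies in the maximal
  ideal times the module.\<close>

lemma koszul_exact:
  assumes w: "\<omega> \<in> KC q s j"
    and cyc: "\<And>S. S \<subseteq> V \<Longrightarrow> Suc (card S) = s \<Longrightarrow> Kd \<omega> S = (\<lambda>_. 0)"
    and const: "\<And>b. s = 0 \<Longrightarrow> lookup (\<omega> {} b) 0 = 0"
  obtains \<eta> where "\<eta> \<in> KC q (Suc s) j" "\<And>S. S \<subseteq> V \<Longrightarrow> card S = s \<Longrightarrow> \<omega> S = Kd \<eta> S"
proof -
  have "\<exists>\<eta>. (\<forall>S\<subseteq>V. card S = s \<longrightarrow> \<omega> S b = koszul.tdiff \<eta> S) \<and>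
      (\<forall>S\<subseteq>V. \<forall>m\<in>keys (\<eta> S). \<exists>S'\<subseteq>V. card S' = s \<and> (\<exists>m'\<in>keys (\<omega> S' b). m + ind S = m' + ind S'))" for b
  proof (rule koszul.tdiff_exact[of s "\<lambda>S. \<omega> S b"])
    fix S assume "S \<subseteq> V" "Suc (card S) = s"
    then show "koszul.tdiff (\<lambda>S. \<omega> S b) S = 0" using cyc[of S] unfolding Kd_def by meson
  next
    fix m assume s: "s = 0" and m: "m \<in> keys (\<omega> {} b)"
    have "\<omega> {} \<in> Gr q j" using KCD[OF w, of "{}"] s by simp
    then have "keys m \<subseteq> V" using m GrD(1,3)[of "\<omega> {}" q j b] by (cases "b < rank q") (auto simp: poly_ring_def)
    moreover have "m \<noteq> 0" using m const[OF s, of b] by (auto simp: in_keys_iff)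
    then have "keys m \<noteq> {}" by (auto simp: in_keys_iff intro: poly_mapping_eqI)
    ultimately show "\<exists>u\<in>V. {u} \<subseteq> keys m" by blast
  next
    fix \<eta>
    assume "\<And>S. S \<subseteq> V \<Longrightarrow> card S = s \<Longrightarrow> \<omega> S b = koszul.tdiff \<eta> S"
      "\<And>S m. S \<subseteq> V \<Longrightarrow> m \<in> keys (\<eta> S) \<Longrightarrow> \<exists>S'\<subseteq>V. card S' = s \<and>
         (\<exists>m'\<in>keys (\<omega> S' b). m + ind (koszul.B S) = m' + ind (koszul.B S'))"
    then show ?thesis unfolding koszul_B by blast
  qed
  then obtain \<eta> where \<eta>: "\<And>b S. S \<subseteq> V \<Longrightarrow> card S = s \<Longrightarrow> \<omega> S b = koszul.tdiff (\<eta> b) S"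
    "\<And>b S m. S \<subseteq> V \<Longrightarrow> m \<in> keys (\<eta> b S) \<Longrightarrow>
      \<exists>S'\<subseteq>V. card S' = s \<and> (\<exists>m'\<in>keys (\<omega> S' b). m + ind S = m' + ind S')"
    by metis
  have "(\<lambda>S b. \<eta> b S) \<in> KC q (Suc s) j"
    unfolding KC_def
  proof (safe, rule GrI)
    fix S b assume S: "S \<subseteq> V" "card S = Suc s"
    have fin: "finite T" if "T \<subseteq> V" for T using that finite_V finite_subset by blast
    have k: "b < rank q \<and> keys m \<subseteq> V \<and> int (mono_degree m) = j - int (Suc s) - shift q b"
      if m: "m \<in> keys (\<eta> b S)" for m
    proof -
      obtain S' m' where m': "S' \<subseteq> V" "card S' = s" "m' \<in> keys (\<omega> S' b)" "m + ind S = m' + ind S'"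
        using \<eta>(2)[OF S(1) m] by blast
      note G = KCD[OF w m'(1,2)]
      have b: "b < rank q" by (rule ccontr) (use GrD(3)[OF G, of b] m'(3) in simp)
      have "keys m \<subseteq> keys (m' + ind S')" unfolding m'(4)[symmetric] keys_plus_nat by simp
      also have "\<dots> \<subseteq> V" using GrD(1)[OF G b] m'(1,3) fin[OF m'(1)]
        by (auto simp: keys_plus_nat poly_ring_def)
      finally have 1: "keys m \<subseteq> V" .
      have "mono_degree m + Suc s = mono_degree m' + s"
        using arg_cong[OF m'(4), of mono_degree] fin S m'(1,2) by (simp add: mono_degree_plus mono_degree_ind)
      moreover have "int (mono_degree m') = j - int s - shift q b"
        using GrD(2)[OF G b] m'(3) unfolding homogeneous_def by blast
      ultimately show ?thesis using b 1 by linarith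
    qed
    show "b < rank q \<Longrightarrow> \<eta> b S \<in> poly_ring V" using k unfolding poly_ring_def by blast
    show "b < rank q \<Longrightarrow> homogeneous (j - int (Suc s) - shift q b) (\<eta> b S)"
      using k unfolding homogeneous_def by blast
    show "\<not> b < rank q \<Longrightarrow> \<eta> b S = 0" using k by (metis ex_in_conv keys_eq_empty)
  qed
  moreover have "\<omega> S = Kd (\<lambda>S b. \<eta> b S) S" if "S \<subseteq> V" "card S = s" for S
    using \<eta>(1)[OF that] unfolding Kd_def by auto
  ultimately show thesis by (rule that)
qed

text \<open>\<open>koszul_nz q s j\<close> says that the cokernel of \<open>D q\<close> has nonzero Koszul homology in homological
  degree \<open>s\<close> and internal degree \<open>j\<close>. The connecting map from the cokernel of \<open>D q\<close> to that of
  \<open>D (Suc q)\<close> sends \<open>\<omega>\<close> to \<open>\<omega>'\<close> when \<open>Kd \<omega> = D q \<omega>'\<close>; \<open>linked_nz\<close> describes its image.\<close>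

definition bounds :: "nat \<Rightarrow> nat \<Rightarrow> int \<Rightarrow> ('v set \<Rightarrow> nat \<Rightarrow> ('v, 'k) mpoly) \<Rightarrow> bool" where
  "bounds q s j \<omega> \<longleftrightarrow> (\<exists>\<eta>\<in>KC q (Suc s) j. \<exists>\<theta>\<in>KC (Suc q) s j.
     \<forall>S\<subseteq>V. card S = s \<longrightarrow> \<omega> S = (\<lambda>b. Kd \<eta> S b + D q (\<theta> S) b))"

definition koszul_nz :: "nat \<Rightarrow> nat \<Rightarrow> int \<Rightarrow> bool" where
  "koszul_nz q s j \<longleftrightarrow> (\<exists>\<omega>\<in>KC q s j. (\<forall>S\<subseteq>V. Suc (card S) = s \<longrightarrow>
     (\<exists>y\<in>Gr (Suc q) (j - int (card S)). Kd \<omega> S = D q y)) \<and> \<not> bounds q s j \<omega>)"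

definition linked_nz :: "nat \<Rightarrow> nat \<Rightarrow> int \<Rightarrow> bool" where
  "linked_nz q s j \<longleftrightarrow> (\<exists>\<omega>'\<in>KC (Suc q) s j. (\<exists>\<omega>\<in>KC q (Suc s) j. \<forall>S\<subseteq>V. card S = s \<longrightarrow>
     Kd \<omega> S = D q (\<omega>' S)) \<and> \<not> bounds (Suc q) s j \<omega>')"

text \<open>A diagram chase for the connecting map. In one direction the required preimage comes
  from exactness of the complex, in the other from exactness of the Koszul complex of the free
  module in position \<open>Suc s\<close>.\<close>

lemma bounds_linked:
  assumes w: "\<omega> \<in> KC q (Suc s) j" and w': "\<omega>' \<in> KC (Suc q) s j"
    and link: "\<And>S. S \<subseteq> V \<Longrightarrow> card S = s \<Longrightarrow> Kd \<omega> S = D q (\<omega>' S)"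
  shows "bounds q (Suc s) j \<omega> \<longleftrightarrow> bounds (Suc q) s j \<omega>'"
proof
  have ins: "card (insert u S) = Suc s" if "S \<subseteq> V" "card S = s" "u \<in> V - S" for u S
  proof -
    have "finite S" using that(1) finite_V finite_subset by blast
    then show ?thesis using that by simp
  qed
  have card_ins: "insert u S \<subseteq> V" if "S \<subseteq> V" "u \<in> V - S" for u S
    using that by auto
  assume "bounds q (Suc s) j \<omega>"
  then obtain \<eta> \<theta> where n: "\<eta> \<in> KC q (Suc (Suc s)) j" "\<theta> \<in> KC (Suc q) (Suc s) j"
    "\<And>S. S \<subseteq> V \<Longrightarrow> card S = Suc s \<Longrightarrow> \<omega> S = (\<lambda>b. Kd \<eta> S b + D q (\<theta> S) b)"
    unfolding bounds_def by blast
  have "\<exists>\<theta>'. \<theta>' \<in> Gr (Suc (Suc q)) (j - int s) \<and> D (Suc q) \<theta>' = (\<lambda>b. \<omega>' S b - Kd \<theta> S b)"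
    if S: "S \<subseteq> V" "card S = s" for S
  proof -
    have "Kd \<omega> S = Kd (\<lambda>S b. Kd \<eta> S b + D q (\<theta> S) b) S"
    proof (rule Kd_cong)
      fix u assume u: "u \<in> V - S"
      show "\<omega> (insert u S) = (\<lambda>b. Kd \<eta> (insert u S) b + D q (\<theta> (insert u S)) b)"
        by (rule n(3)[OF card_ins[OF S(1) u] ins[OF S u]])
    qed
    also have "\<dots> = D q (Kd \<theta> S)"
      unfolding Kd_add Kd_Kd[OF S(1)] Kd_D by simp
    finally have "D q (\<lambda>b. \<omega>' S b - Kd \<theta> S b) = (\<lambda>_. 0)"
      unfolding D_diff link[OF S] by simp
    then show ?thesis
      using D_exact[OF Gr_diff[OF KCD[OF w' S] Kd_Gr[OF n(2) S]]] by metis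
  qed
  then obtain \<theta>' where t: "\<And>S. S \<subseteq> V \<Longrightarrow> card S = s \<Longrightarrow> \<theta>' S \<in> Gr (Suc (Suc q)) (j - int s)"
    "\<And>S. S \<subseteq> V \<Longrightarrow> card S = s \<Longrightarrow> D (Suc q) (\<theta>' S) = (\<lambda>b. \<omega>' S b - Kd \<theta> S b)"
    by metis
  show "bounds (Suc q) s j \<omega>'"
    unfolding bounds_def
    by (rule bexI[OF _ n(2)], rule bexI[of _ \<theta>']) (use t in \<open>auto simp: KC_def\<close>)
next
  assume "bounds (Suc q) s j \<omega>'"
  then obtain \<eta> \<theta> where n: "\<eta> \<in> KC (Suc q) (Suc s) j" "\<theta> \<in> KC (Suc (Suc q)) s j"
    "\<And>S. S \<subseteq> V \<Longrightarrow> card S = s \<Longrightarrow> \<omega>' S = (\<lambda>b. Kd \<eta> S b + D (Suc q) (\<theta> S) b)"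
    unfolding bounds_def by blast
  \<comment> \<open>Subtracting the image of \<eta> turns \<omega> into a Koszul cycle over the free
    module itself, not just over the cokernel.\<close>
  define \<zeta> where "\<zeta> = (\<lambda>T b. \<omega> T b - D q (\<eta> T) b)"
  have z: "\<zeta> \<in> KC q (Suc s) j"
    unfolding KC_def \<zeta>_def using Gr_diff[OF KCD[OF w] D_Gr[OF KCD[OF n(1)]]] by blast
  have "Kd \<zeta> S = (\<lambda>_. 0)" if S: "S \<subseteq> V" "Suc (card S) = Suc s" for S
  proof -
    have S': "card S = s" using S by simp
    have "Kd \<omega> S = D q (Kd \<eta> S)"
      unfolding link[OF S(1) S'] n(3)[OF S(1) S'] D_add D_D[OF KCD[OF n(2) S(1) S']] by simp
    then show ?thesis unfolding \<zeta>_def Kd_diff Kd_D by simp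
  qed
  then obtain \<xi> where x: "\<xi> \<in> KC q (Suc (Suc s)) j"
    "\<And>S. S \<subseteq> V \<Longrightarrow> card S = Suc s \<Longrightarrow> \<zeta> S = Kd \<xi> S"
    using koszul_exact[OF z] by blast
  show "bounds q (Suc s) j \<omega>"
    unfolding bounds_def
  proof (rule bexI[OF _ x(1)], rule bexI[OF _ n(1)], intro allI impI)
    fix S assume "S \<subseteq> V" "card S = Suc s"
    then show "\<omega> S = (\<lambda>b. Kd \<xi> S b + D q (\<eta> S) b)"
      using x(2)[of S] unfolding \<zeta>_def by (metis (no_types, lifting) diff_add_cancel)
  qed
qed

text \<open>The free module has no Koszul homology in position \<open>Suc s\<close>, so the
  connecting map is injective and its image is nonzero exactly when its source is.\<close>

lemma koszul_nz_Suc: "koszul_nz q (Suc s) j \<longleftrightarrow> linked_nz q s j"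
proof
  assume "koszul_nz q (Suc s) j"
  then obtain \<omega> where w: "\<omega> \<in> KC q (Suc s) j" "\<not> bounds q (Suc s) j \<omega>"
    "\<And>S. S \<subseteq> V \<Longrightarrow> card S = s \<Longrightarrow> \<exists>y\<in>Gr (Suc q) (j - int s). Kd \<omega> S = D q y"
    unfolding koszul_nz_def by auto
  then obtain \<omega>' where w': "\<And>S. S \<subseteq> V \<Longrightarrow> card S = s \<Longrightarrow> \<omega>' S \<in> Gr (Suc q) (j - int s)"
    "\<And>S. S \<subseteq> V \<Longrightarrow> card S = s \<Longrightarrow> Kd \<omega> S = D q (\<omega>' S)"
    by metis
  then have "\<omega>' \<in> KC (Suc q) s j" unfolding KC_def by blast
  with w w' bounds_linked[of \<omega> q s j \<omega>'] show "linked_nz q s j"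
    unfolding linked_nz_def by blast
next
  assume "linked_nz q s j"
  then obtain \<omega>' \<omega> where w: "\<omega>' \<in> KC (Suc q) s j" "\<omega> \<in> KC q (Suc s) j"
    "\<And>S. S \<subseteq> V \<Longrightarrow> card S = s \<Longrightarrow> Kd \<omega> S = D q (\<omega>' S)" "\<not> bounds (Suc q) s j \<omega>'"
    unfolding linked_nz_def by blast
  have "\<forall>S\<subseteq>V. Suc (card S) = Suc s \<longrightarrow> (\<exists>y\<in>Gr (Suc q) (j - int (card S)). Kd \<omega> S = D q y)"
    using w(3) KCD[OF w(1)] by auto
  moreover have "\<not> bounds q (Suc s) j \<omega>" using bounds_linked[OF w(2,1,3)] w(4) by blast
  ultimately show "koszul_nz q (Suc s) j"
    unfolding koszul_nz_def using w(2) by blast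
qed

text \<open>In positive Koszul degree the connecting map is also surjective:
  \<open>D q \<omega>'\<close> is a Koszul boundary iff it is a cycle, iff
  \<open>Kd \<omega>'\<close> lies in the kernel of \<open>D q\<close>, iff it lies in the image of
  \<open>D (Suc q)\<close>. The last condition says that \<omega>' is a cycle over the
  cokernel.\<close>

lemma linked_nz_Suc: "linked_nz q (Suc s) j \<longleftrightarrow> koszul_nz (Suc q) (Suc s) j"
proof -
  have "(\<exists>\<omega>\<in>KC q (Suc (Suc s)) j. \<forall>S\<subseteq>V. card S = Suc s \<longrightarrow> Kd \<omega> S = D q (\<omega>' S)) \<longleftrightarrow>
    (\<forall>S\<subseteq>V. Suc (card S) = Suc s \<longrightarrow> (\<exists>y\<in>Gr (Suc (Suc q)) (j - int (card S)). Kd \<omega>' S = D (Suc q) y))"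
    (is "?L \<longleftrightarrow> ?R") if w': "\<omega>' \<in> KC (Suc q) (Suc s) j" for \<omega>'
  proof -
    have DK: "(\<lambda>T. D q (\<omega>' T)) \<in> KC q (Suc s) j"
      unfolding KC_def using D_Gr KCD[OF w'] by blast
    have "?L \<longleftrightarrow> (\<forall>S\<subseteq>V. card S = s \<longrightarrow> Kd (\<lambda>T. D q (\<omega>' T)) S = (\<lambda>_. 0))" (is "_ \<longleftrightarrow> ?M")
    proof
      assume ?L
      then obtain \<omega> where w: "\<And>S. S \<subseteq> V \<Longrightarrow> card S = Suc s \<Longrightarrow> Kd \<omega> S = D q (\<omega>' S)" by blast
      show ?M
      proof (intro allI impI)
        fix S assume S: "S \<subseteq> V" "card S = s"
        have fin: "finite S" using S finite_V finite_subset by blast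
        have "Kd (\<lambda>T. D q (\<omega>' T)) S = Kd (Kd \<omega>) S"
          using w S fin by (intro Kd_cong) auto
        then show "Kd (\<lambda>T. D q (\<omega>' T)) S = (\<lambda>_. 0)" using Kd_Kd[OF S(1)] by simp
      qed
    next
      assume M: ?M
      then obtain \<omega> where "\<omega> \<in> KC q (Suc (Suc s)) j"
         "\<And>S. S \<subseteq> V \<Longrightarrow> card S = Suc s \<Longrightarrow> D q (\<omega>' S) = Kd \<omega> S"
        using koszul_exact[OF DK] by auto
      then show ?L by metis
    qed
    also have "?M \<longleftrightarrow> (\<forall>S\<subseteq>V. card S = s \<longrightarrow> D q (Kd \<omega>' S) = (\<lambda>_. 0))" unfolding Kd_D ..
    also have "\<dots> \<longleftrightarrow> ?R"
    proof (intro iffI allI impI)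
      fix S assume h: "\<forall>S\<subseteq>V. card S = s \<longrightarrow> D q (Kd \<omega>' S) = (\<lambda>_. 0)" and S: "S \<subseteq> V" "Suc (card S) = Suc s"
      then have S': "card S = s" by simp
      show "\<exists>y\<in>Gr (Suc (Suc q)) (j - int (card S)). Kd \<omega>' S = D (Suc q) y"
        using D_exact[OF Kd_Gr[OF w' S(1) S']] h S S' by metis
    next
      fix S assume R: ?R and S: "S \<subseteq> V" "card S = s"
      have "Suc (card S) = Suc s" using S by simp
      then obtain y where y: "y \<in> Gr (Suc (Suc q)) (j - int (card S))" "Kd \<omega>' S = D (Suc q) y"
        using R S(1) by blast
      show "D q (Kd \<omega>' S) = (\<lambda>_. 0)" unfolding y(2) by (rule D_D[OF y(1)])
    qed
    finally show ?thesis .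
  qed
  note eq = this
  show ?thesis unfolding linked_nz_def koszul_nz_def
    by (rule bex_cong[OF refl]) (simp only: eq)
qed

lemma koszul_nz_linked: "koszul_nz q (Suc s) j \<longleftrightarrow> linked_nz (q + s) 0 j"
proof (induction s arbitrary: q)
  case 0
  then show ?case by (simp add: koszul_nz_Suc)
next
  case (Suc s)
  then show ?case using koszul_nz_Suc[of q "Suc s" j] linked_nz_Suc[of q s j] by simp
qed

text \<open>The first Koszul differential has the maximal ideal times the module as its image, and
  this consists of the elements without constant terms.\<close>

lemma in_maximal_ideal_iff:
  assumes "f \<in> Gr q j"
  shows "(\<exists>\<eta>\<in>KC q 1 j. f = Kd \<eta> {}) \<longleftrightarrow> (\<forall>b. lookup (f b) 0 = 0)"
proof
  assume "\<exists>\<eta>\<in>KC q 1 j. f = Kd \<eta> {}"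
  then obtain \<eta> where f: "f = Kd \<eta> {}" by blast
  have "lookup (single (ind {u}) c * p) 0 = 0" for u :: 'v and c :: 'k and p
    by (simp add: lookup_ind_mult)
  then show "\<forall>b. lookup (f b) 0 = 0"
    unfolding f Kd_def koszul.tdiff_def koszul_B by (simp add: lookup_sum)
next
  assume c: "\<forall>b. lookup (f b) 0 = 0"
  have "(\<lambda>_. f) \<in> KC q 0 j" unfolding KC_def using assms by simp
  then obtain \<eta> where \<eta>: "\<eta> \<in> KC q (Suc 0) j" "\<And>S. S \<subseteq> V \<Longrightarrow> card S = 0 \<Longrightarrow> f = Kd \<eta> S"
    using koszul_exact[of "\<lambda>_. f" q 0 j] c by auto
  then show "\<exists>\<eta>\<in>KC q 1 j. f = Kd \<eta> {}" using \<eta>(2)[of "{}"] by auto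
qed

text \<open>Dimension shifting ends here: in Koszul degree 0 both conditions are read modulo the
  maximal ideal and become the homology of the complex tensored with the residue field, at position
  \<open>Suc q\<close>.\<close>

lemma linked_nz_0:
  "linked_nz q 0 j \<longleftrightarrow> (\<exists>z\<in>Gr (Suc q) j. (\<forall>a. lookup (D q z a) 0 = 0) \<and>
     \<not> (\<exists>w\<in>Gr (Suc (Suc q)) j. \<forall>b. lookup (z b - D (Suc q) w b) 0 = 0))"
proof -
  have e: "(\<forall>S\<subseteq>V. card S = 0 \<longrightarrow> P S) \<longleftrightarrow> P {}" for P :: "'v set \<Rightarrow> bool"
    using finite_V finite_subset by (auto simp: card_eq_0_iff)
  have KC0: "\<omega> \<in> KC q 0 j \<longleftrightarrow> \<omega> {} \<in> Gr q j" for \<omega> q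
    unfolding KC_def using e[of "\<lambda>S. \<omega> S \<in> Gr q j"] by simp
  have ex0: "(\<exists>\<omega>\<in>KC q 0 j. P (\<omega> {})) \<longleftrightarrow> (\<exists>z\<in>Gr q j. P z)" for P q
  proof
    assume "\<exists>z\<in>Gr q j. P z"
    then obtain z where "z \<in> Gr q j" "P z" by blast
    then show "\<exists>\<omega>\<in>KC q 0 j. P (\<omega> {})" using KC0[of "\<lambda>_. z"] by (intro bexI[of _ "\<lambda>_. z"]) auto
  qed (auto simp: KC0)
  have b: "bounds (Suc q) 0 j \<omega> \<longleftrightarrow>
     (\<exists>w\<in>Gr (Suc (Suc q)) j. \<forall>b. lookup (\<omega> {} b - D (Suc q) w b) 0 = 0)"
    if w: "\<omega> \<in> KC (Suc q) 0 j" for \<omega>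
  proof -
    have "bounds (Suc q) 0 j \<omega> \<longleftrightarrow> (\<exists>\<theta>\<in>KC (Suc (Suc q)) 0 j. \<exists>\<eta>\<in>KC (Suc q) 1 j.
        (\<lambda>b. \<omega> {} b - D (Suc q) (\<theta> {}) b) = Kd \<eta> {})"
      unfolding bounds_def e by (auto simp: fun_eq_iff algebra_simps)
    also have "\<dots> \<longleftrightarrow> (\<exists>\<theta>\<in>KC (Suc (Suc q)) 0 j. \<forall>b. lookup (\<omega> {} b - D (Suc q) (\<theta> {}) b) 0 = 0)"
      using in_maximal_ideal_iff[OF Gr_diff[OF w[unfolded KC0] D_Gr]] by (auto simp: KC0)
    also have "\<dots> \<longleftrightarrow> (\<exists>w\<in>Gr (Suc (Suc q)) j. \<forall>b. lookup (\<omega> {} b - D (Suc q) w b) 0 = 0)"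
      by (rule ex0)
    finally show ?thesis .
  qed
  have l: "(\<exists>\<omega>\<in>KC q (Suc 0) j. \<forall>S\<subseteq>V. card S = 0 \<longrightarrow> Kd \<omega> S = D q (\<omega>' S))
     \<longleftrightarrow> (\<forall>a. lookup (D q (\<omega>' {}) a) 0 = 0)" if "\<omega>' \<in> KC (Suc q) 0 j" for \<omega>'
    using in_maximal_ideal_iff[OF D_Gr[OF that[unfolded KC0]]] unfolding e by (auto dest: sym)
  have "linked_nz q 0 j \<longleftrightarrow> (\<exists>\<omega>\<in>KC (Suc q) 0 j. (\<forall>a. lookup (D q (\<omega> {}) a) 0 = 0) \<and>
     \<not> (\<exists>w\<in>Gr (Suc (Suc q)) j. \<forall>b. lookup (\<omega> {} b - D (Suc q) w b) 0 = 0))"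
    unfolding linked_nz_def using b l by auto
  also have "\<dots> \<longleftrightarrow> (\<exists>z\<in>Gr (Suc q) j. (\<forall>a. lookup (D q z a) 0 = 0) \<and>
     \<not> (\<exists>w\<in>Gr (Suc (Suc q)) j. \<forall>b. lookup (z b - D (Suc q) w b) 0 = 0))"
    by (rule ex0)
  finally show ?thesis .
qed

end

section \<open>Hochster's formula\<close>

text \<open>Complementation in \<open>W\<close> turns the boundary into the coboundary, with these signs.\<close>

definition csign :: "('v \<Rightarrow> 'v set \<Rightarrow> 'k) \<Rightarrow> 'v set \<Rightarrow> 'v \<Rightarrow> 'v set \<Rightarrow> 'k" where
  "csign \<epsilon> W u T = \<epsilon> u (W - insert u T)"

lemma sign_system_csign:
  assumes "sign_system W \<epsilon>"
  shows "sign_system W (csign \<epsilon> W)"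
  unfolding sign_system_def csign_def
proof (intro conjI ballI allI impI)
  fix u S assume "u \<in> W" "S \<subseteq> W - {u}"
  then show "\<epsilon> u (W - insert u S) * \<epsilon> u (W - insert u S) = 1"
    by (intro sign_square[OF assms]) auto
next
  fix u v S assume uv: "u \<in> W" "v \<in> W - {u}" "S \<subseteq> W - {u, v}"
  define X where "X = W - insert u (insert v S)"
  have "W - insert u S = insert v X" "W - insert v (insert u S) = X"
    "W - insert v S = insert u X" "W - insert u (insert v S) = X"
    using uv unfolding X_def by auto
  moreover have "\<epsilon> u X * \<epsilon> v (insert u X) = - (\<epsilon> v X * \<epsilon> u (insert v X))"
    using uv unfolding X_def by (intro sign_anticommute[OF assms]) auto
  ultimately show "\<epsilon> u (W - insert u S) * \<epsilon> v (W - insert v (insert u S))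
      = - (\<epsilon> v (W - insert v S) * \<epsilon> u (W - insert u (insert v S)))"
    by (simp add: mult.commute)
qed

lemma cobdry_csign:
  assumes "S \<subseteq> W"
  shows "cobdry (csign \<epsilon> W) c (W - S) = bdry W \<epsilon> (\<lambda>S. c (W - S)) S"
  unfolding cobdry_def bdry_def csign_def
proof (rule sum.cong)
  fix u assume u: "u \<in> W - S"
  have "W - insert u (W - S - {u}) = S" "W - S - {u} = W - insert u S" using u assms by auto
  then show "\<epsilon> u (W - insert u (W - S - {u})) * c (W - S - {u}) = \<epsilon> u S * c (W - insert u S)" by metis
qed simp

definition mono_ideal :: "'v set \<Rightarrow> 'v set set \<Rightarrow> ('v, 'k::field) mpoly set" where
  "mono_ideal V E = {p \<in> poly_ring V. \<forall>m\<in>keys p. \<exists>e\<in>E. e \<subseteq> keys m}"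

text \<open>With a single generator in position 0, whose image ideal is given by
  \<open>image_0\<close>, the cokernel of \<open>D 0\<close> is the quotient of the polynomial ring
  by the monomial ideal.\<close>

locale edge_resolution = graded_complex V \<epsilon> rank shift d
  for V :: "'v set" and \<epsilon> :: "'v \<Rightarrow> 'v set \<Rightarrow> 'k::field" and rank shift d +
  fixes E :: "'v set set"
  assumes rank_0: "rank 0 = 1" and shift_0: "shift 0 0 = 0"
    and image_0: "{D 0 g 0 | g. g \<in> free_fun V (rank 1)} = mono_ideal V E"
begin

lemma Gr_0I: "p \<in> poly_ring V \<Longrightarrow> homogeneous e p \<Longrightarrow> (\<lambda>b. if b = 0 then p else 0) \<in> Gr 0 e"
  by (rule GrI) (auto simp: rank_0 shift_0)

lemma Gr_0D: "f \<in> Gr 0 e \<Longrightarrow> f 0 \<in> poly_ring V \<and> homogeneous e (f 0) \<and> (\<forall>b. b \<noteq> 0 \<longrightarrow> f b = 0)"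
  using GrD[of f 0 e] by (auto simp: rank_0 shift_0)

lemma D_0_image:
  assumes "f \<in> Gr 0 e"
  shows "(\<exists>g\<in>Gr (Suc 0) e. f = D 0 g) \<longleftrightarrow> f 0 \<in> mono_ideal V E"
proof
  assume "\<exists>g\<in>Gr (Suc 0) e. f = D 0 g"
  then obtain g where "g \<in> free_fun V (rank 1)" "f = D 0 g" using GrD(4) by fastforce
  then show "f 0 \<in> mono_ideal V E" unfolding image_0[symmetric] by blast
next
  assume "f 0 \<in> mono_ideal V E"
  then obtain g where g: "g \<in> free_fun V (rank (Suc 0))" "f 0 = D 0 g 0"
    unfolding image_0[symmetric] by auto
  have "D 0 g = f"
  proof
    fix b show "D 0 g b = f b"
      using g(2) Gr_0D[OF assms] by (cases "b = 0") (auto simp: D_def mat_fun_def rank_0)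
  qed
  then show "\<exists>g\<in>Gr (Suc 0) e. f = D 0 g"
    using D_homogeneous_lift[OF assms g(1)] by metis
qed

lemma Uat_koszul: "keys a \<subseteq> V \<Longrightarrow> koszul.Uat a = keys a"
  unfolding koszul.Uat_def by auto

lemma finite_sub: "S \<subseteq> V \<Longrightarrow> finite S"
  using finite_V finite_subset by blast

lemma Kd_0: "Kd \<omega> S 0 = koszul.tdiff (\<lambda>T. \<omega> T 0) S"
  unfolding Kd_def ..

lemma ind_minus: "finite W \<Longrightarrow> S \<subseteq> W \<Longrightarrow> ind W - ind S = ind (W - S)"
  by (frule (1) finite_subset[rotated], intro poly_mapping_eqI) (auto simp: lookup_minus lookup_ind)

text \<open>In multidegree \<open>ind W\<close> the Koszul basis element of S carries the monomial
  on W - S, which survives in the quotient ring iff W - S is independent. Complementation thus turns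
  a cochain of the independence complex into a Koszul chain.\<close>

lemma nz_of_cohom:
  assumes W: "W \<subseteq> V" "card W = p + s" "int (card W) = j" and s: "s = Suc i"
    and nz: "cohom_nz (csign \<epsilon> W) E W p"
  shows "koszul_nz 0 s j"
proof -
  have fW: "finite W" using finite_sub W by blast
  obtain c where c: "\<And>T. T \<in> indep E W \<Longrightarrow> card T = Suc p \<Longrightarrow> cobdry (csign \<epsilon> W) c T = 0"
    "\<not> (\<exists>b. \<forall>T\<in>indep E W. card T = p \<longrightarrow> c T = cobdry (csign \<epsilon> W) b T)"
    using nz unfolding cohom_nz_def by blast
  define \<Omega> where "\<Omega> S = (if S \<subseteq> W then single (ind (W - S)) (c (W - S)) else 0)" for S
  define \<omega> where "\<omega> = (\<lambda>S b :: nat. if b = 0 then \<Omega> S else 0)"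
  have w: "\<omega> \<in> KC 0 s j"
    unfolding KC_def
  proof (safe)
    fix S assume S: "S \<subseteq> V" "s = card S"
    have "\<Omega> S \<in> poly_ring V"
      unfolding \<Omega>_def using W fW by (auto intro!: poly_ring_single)
    moreover have "homogeneous (j - int s) (\<Omega> S)"
    proof (cases "S \<subseteq> W")
      case True
      then have "card (W - S) + s = card W" using S fW card_mono[OF fW True] finite_sub[OF S(1)] by (simp add: card_Diff_subset)
      then show ?thesis unfolding \<Omega>_def using True W(3) fW
        by (auto intro!: homogeneous_single simp: mono_degree_ind)
    qed (simp add: \<Omega>_def)
    ultimately show "\<omega> S \<in> Gr 0 (j - int (card S))" unfolding \<omega>_def S(2)[symmetric] by (rule Gr_0I)
  qed
  have \<Omega>: "(\<lambda>T. \<omega> T 0) = \<Omega>" unfolding \<omega>_def by simp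
  have "\<exists>y\<in>Gr (Suc 0) (j - int (card S)). Kd \<omega> S = D 0 y" if S: "S \<subseteq> V" "Suc (card S) = s" for S
  proof -
    have wS: "\<omega> \<in> KC 0 (Suc (card S)) j" using w S by simp
    have G: "Kd \<omega> S \<in> Gr 0 (j - int (card S))" by (rule Kd_Gr[OF wS S(1) refl])
    have "koszul.tdiff \<Omega> S = (if S \<subseteq> W then single (ind (W - S)) (cobdry (csign \<epsilon> W) c (W - S)) else 0)"
    proof (cases "S \<subseteq> W")
      case True
      have "koszul.tdiff \<Omega> S = (\<Sum>u\<in>W - S. single (ind {u}) (\<epsilon> u S) * single (ind (W - insert u S)) (c (W - insert u S)))"
        unfolding koszul.tdiff_def koszul_B
        by (rule sum.mono_neutral_cong_right) (use W finite_V True in \<open>auto simp: \<Omega>_def insert_Diff_if\<close>)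
      also have "\<dots> = (\<Sum>u\<in>W - S. single (ind (W - S)) (\<epsilon> u S * c (W - insert u S)))"
      proof (rule sum.cong)
        fix u assume u: "u \<in> W - S"
        have "ind (W - S) = ind ({u} \<union> (W - insert u S))" using u by (intro arg_cong[of _ _ ind]) auto
        also have "\<dots> = ind {u} + ind (W - insert u S)" by (rule ind_disjoint_union) (use fW in auto)
        finally show "single (ind {u}) (\<epsilon> u S) * single (ind (W - insert u S)) (c (W - insert u S))
          = single (ind (W - S)) (\<epsilon> u S * c (W - insert u S))" by (simp add: mult_single)
      qed simp
      also have "\<dots> = single (ind (W - S)) (bdry W \<epsilon> (\<lambda>S. c (W - S)) S)"
        unfolding bdry_def by (intro poly_mapping_eqI) (simp add: lookup_sum lookup_single when_def)
      finally show ?thesis using True by (simp add: cobdry_csign)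
    next
      case False
      then show ?thesis unfolding koszul.tdiff_def \<Omega>_def by (simp add: sum.neutral)
    qed
    moreover have "single (ind (W - S)) (cobdry (csign \<epsilon> W) c (W - S)) \<in> mono_ideal V E" if "S \<subseteq> W"
    proof (cases "W - S \<in> indep E W")
      case True
      have "card (W - S) = Suc p" using W(2) S s that fW finite_sub[OF S(1)] by (simp add: card_Diff_subset)
      then show ?thesis using c(1)[OF True] by (simp add: mono_ideal_def)
    next
      case False
      then obtain e where "e \<in> E" "e \<subseteq> W - S" unfolding indep_def by blast
      then show ?thesis unfolding mono_ideal_def using fW W(1) by (auto intro!: poly_ring_single)
    qed
    moreover have "(0 :: ('v, 'k) mpoly) \<in> mono_ideal V E" unfolding mono_ideal_def by simp
    ultimately have "Kd \<omega> S 0 \<in> mono_ideal V E" unfolding Kd_0 \<Omega> by simp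
    then show ?thesis using D_0_image[OF G] by blast
  qed
  moreover have "\<not> bounds 0 s j \<omega>"
  proof
    assume "bounds 0 s j \<omega>"
    then obtain \<eta> \<theta> where n: "\<theta> \<in> KC (Suc 0) s j"
       "\<And>S. S \<subseteq> V \<Longrightarrow> card S = s \<Longrightarrow> \<omega> S = (\<lambda>b. Kd \<eta> S b + D 0 (\<theta> S) b)"
      unfolding bounds_def by blast
    \<comment> \<open>Only the component of \<eta> in multidegree \<open>ind W\<close> matters,
      again indexed by complements.\<close>
    define b where "b T = lookup (\<eta> (W - T) 0) (ind T)" for T
    have "c T = cobdry (csign \<epsilon> W) b T" if T: "T \<in> indep E W" "card T = p" for T
    proof -
      define S where "S = W - T"
      have TW: "T \<subseteq> W" using T unfolding indep_def by blast
      have fT: "finite T" using TW fW finite_subset by blast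
      have S: "S \<subseteq> W" "S \<subseteq> V" "card S = s" "W - S = T"
        using TW W T fT unfolding S_def by (auto simp: card_Diff_subset)
      have fS: "finite S" using S finite_sub by blast
      have "D 0 (\<theta> S) 0 \<in> mono_ideal V E"
        using D_0_image[OF D_Gr[OF KCD[OF n(1) S(2,3)]]] KCD[OF n(1) S(2,3)] by blast
      \<comment> \<open>T is independent, so its monomial is outside the ideal and the summand
        coming from \<theta> is invisible in this coefficient.\<close>
      then have "ind T \<notin> keys (D 0 (\<theta> S) 0)"
        using T fT unfolding mono_ideal_def indep_def by auto
      moreover have "lookup (\<omega> S 0) (ind T) = c T"
        unfolding \<omega>_def \<Omega>_def using S by simp
      ultimately have "c T = lookup (Kd \<eta> S 0) (ind T)"
        unfolding n(2)[OF S(2,3)] by (simp add: lookup_add in_keys_iff)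
      also have "\<dots> = koszul.co (koszul.tdiff (\<lambda>T. \<eta> T 0)) (ind T + ind S) S"
        unfolding Kd_0 using koszul.co_lookup[OF S(2)] unfolding koszul_B by simp
      also have "ind T + ind S = ind W"
        using ind_disjoint_union[OF fT fS] S by (auto simp: Un_absorb1 S_def TW)
      also have "koszul.co (koszul.tdiff (\<lambda>T. \<eta> T 0)) (ind W) S = bdry W \<epsilon> (koszul.co (\<lambda>T. \<eta> T 0) (ind W)) S"
        using koszul.co_tdiff[OF S(2), of "ind W"] S(1) fW W(1) Uat_koszul[of "ind W"] by (simp add: koszul_B)
      also have "\<dots> = bdry W \<epsilon> (\<lambda>S. b (W - S)) S"
        unfolding bdry_def
      proof (rule sum.cong)
        fix u assume u: "u \<in> W - S"
        have i: "insert u S \<subseteq> W" using u S by auto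
        have "W - (W - insert u S) = insert u S" using i by auto
        then show "\<epsilon> u S * koszul.co (\<lambda>T. \<eta> T 0) (ind W) (insert u S) = \<epsilon> u S * b (W - insert u S)"
          unfolding koszul.co_def koszul_B b_def using i fW by (simp add: ind_minus)
      qed simp
      also have "\<dots> = cobdry (csign \<epsilon> W) b T" using cobdry_csign[OF S(1)] S(4) by metis
      finally show ?thesis .
    qed
    then show False using c(2) by blast
  qed
  ultimately show ?thesis unfolding koszul_nz_def using w by blast
qed

text \<open>In a multidegree \<open>a\<close> with some exponent at least \<open>2\<close>, removing the corresponding vertex from
  \<open>S\<close> does not change the support of \<open>a - ind S\<close>, so the complex is a cone.\<close>

lemma multidegree_exact:
  assumes a: "keys a \<subseteq> V" "int (mono_degree a) = j" and s: "s = Suc i"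
    and noncoh: "\<And>W p. W \<subseteq> V \<Longrightarrow> card W = p + s \<Longrightarrow> int (card W) = j \<Longrightarrow> \<not> cohom_nz (csign \<epsilon> W) E W p"
    and cyc: "\<And>S. S \<subseteq> keys a \<Longrightarrow> card S = i \<Longrightarrow>
      \<not> (\<exists>e\<in>E. e \<subseteq> keys (a - ind S)) \<Longrightarrow> bdry (keys a) \<epsilon> c S = 0"
  shows "\<exists>b. \<forall>S\<subseteq>keys a. card S = s \<longrightarrow>
      \<not> (\<exists>e\<in>E. e \<subseteq> keys (a - ind S)) \<longrightarrow> c S = bdry (keys a) \<epsilon> b S"
proof (cases "\<exists>v\<in>keys a. lookup a v \<noteq> 1")
  case True
  then obtain v where v: "v \<in> keys a" "lookup a v \<noteq> 1" by blast
  let ?K = "keys a"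
  have v2: "lookup a v \<ge> 2" using v by (auto simp: in_keys_iff)
  show ?thesis
  proof (intro exI[of _ "cone v \<epsilon> c"] allI impI)
    fix S assume S: "S \<subseteq> ?K" "card S = s" "\<not> (\<exists>e\<in>E. e \<subseteq> keys (a - ind S))"
    have fS: "finite S" by (rule finite_subset[OF S(1)]) simp
    show "c S = bdry ?K \<epsilon> (cone v \<epsilon> c) S"
    proof (rule sym, rule bdry_cone[OF _ sign_system_subset[OF signs a(1)] v(1) S(1)])
      assume "v \<in> S"
      have "keys (a - ind (S - {v})) = keys (a - ind S)"
        using v2 fS by (auto simp: in_keys_iff lookup_minus lookup_ind split: if_splits)
      then show "bdry ?K \<epsilon> c (S - {v}) = 0"
        using cyc[of "S - {v}"] S \<open>v \<in> S\<close> s fS by auto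
    qed simp
  qed
next
  case False
  define W where "W = keys a"
  have fW: "finite W" unfolding W_def by simp
  have aW: "a = ind W"
    using False unfolding W_def by (intro poly_mapping_eqI) (auto simp: lookup_ind in_keys_iff)
  have W: "W \<subseteq> V" "int (card W) = j" using a mono_degree_ind[OF fW] aW unfolding W_def by auto
  have keys_a: "keys (a - ind S) = W - S" if "S \<subseteq> W" for S
    unfolding aW using that fW by (simp add: ind_minus)
  show ?thesis
  proof (cases "s \<le> card W")
    case le: True
    define p where "p = card W - s"
    have p: "card W = p + s" using le unfolding p_def by simp
    have sub: "T \<subseteq> W" if "T \<in> indep E W" for T using that unfolding indep_def by blast
    have dd: "W - (W - T) = T" if "T \<subseteq> W" for T using that by auto
    have "\<forall>T\<in>indep E W. card T = Suc p \<longrightarrow> cobdry (csign \<epsilon> W) (\<lambda>T. c (W - T)) T = 0"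
    proof (intro ballI impI)
      fix T assume T: "T \<in> indep E W" "card T = Suc p"
      define S where "S = W - T"
      have S: "S \<subseteq> W" "W - S = T" using sub[OF T(1)] unfolding S_def by auto
      have "card S = i" using T(2) p s S sub[OF T(1)] finite_subset[OF sub[OF T(1)] fW] unfolding S_def
        by (simp add: card_Diff_subset)
      moreover have "\<not> (\<exists>e\<in>E. e \<subseteq> keys (a - ind S))"
        unfolding keys_a[OF S(1)] S(2) using T(1) unfolding indep_def by blast
      ultimately have "bdry W \<epsilon> c S = 0" using cyc[of S] S(1) unfolding W_def by blast
      also have "bdry W \<epsilon> c S = bdry W \<epsilon> (\<lambda>S. c (W - (W - S))) S"
        unfolding bdry_def by (rule sum.cong) (use S dd in auto)
      finally show "cobdry (csign \<epsilon> W) (\<lambda>T. c (W - T)) T = 0"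
        using cobdry_csign[OF S(1), of \<epsilon> "\<lambda>T. c (W - T)"] S(2) by simp
    qed
    then obtain b where b: "\<And>T. T \<in> indep E W \<Longrightarrow> card T = p \<Longrightarrow> c (W - T) = cobdry (csign \<epsilon> W) b T"
      using noncoh[OF W(1) p W(2)] unfolding cohom_nz_def by blast
    show ?thesis
    proof (intro exI[of _ "\<lambda>S. b (W - S)"] allI impI)
      fix S assume S: "S \<subseteq> keys a" "card S = s" "\<not> (\<exists>e\<in>E. e \<subseteq> keys (a - ind S))"
      have SW: "S \<subseteq> W" using S unfolding W_def by simp
      have "W - S \<in> indep E W" using S(3) unfolding keys_a[OF SW] indep_def by blast
      moreover have "card (W - S) = p" using SW S(2) p finite_subset[OF SW fW] by (simp add: card_Diff_subset)
      ultimately have "c (W - (W - S)) = cobdry (csign \<epsilon> W) b (W - S)" by (rule b)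
      then show "c S = bdry (keys a) \<epsilon> (\<lambda>S. b (W - S)) S"
        using cobdry_csign[OF SW, of \<epsilon> b] dd[OF SW] unfolding W_def[symmetric] by simp
    qed
  next
    case False
    then have "card S \<noteq> s" if "S \<subseteq> keys a" for S
      using card_mono[of "keys a" S] that unfolding W_def by auto
    then show ?thesis by blast
  qed
qed

text \<open>If all the relevant cohomology vanished, \<open>multidegree_exact\<close> would solve
  the boundary equation modulo the ideal in every multidegree. The solutions add up to a Koszul
  chain, and what remains of \<omega> has only monomials of the ideal, so it lifts along
  \<open>D 0\<close>.\<close>

lemma cohom_of_nz:
  assumes s: "s = Suc i" and nz: "koszul_nz 0 s j"
  shows "\<exists>W p. W \<subseteq> V \<and> card W = p + s \<and> int (card W) = j \<and> cohom_nz (csign \<epsilon> W) E W p"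
proof (rule ccontr)
  assume neg: "\<not> ?thesis"
  obtain \<omega> where w: "\<omega> \<in> KC 0 s j" "\<not> bounds 0 s j \<omega>"
    and wc: "\<And>S. S \<subseteq> V \<Longrightarrow> card S = i \<Longrightarrow> \<exists>y\<in>Gr (Suc 0) (j - int i). Kd \<omega> S = D 0 y"
    using nz unfolding koszul_nz_def s by auto
  define \<Omega> where "\<Omega> = (\<lambda>S. \<omega> S 0)"
  \<comment> \<open>The multidegrees occurring in \<omega>. Setting the solution to 0 outside this
    finite set makes the values of H polynomials.\<close>
  define F where "F = (\<Union>S\<in>{S\<in>Pow V. card S = s}. (\<lambda>m. m + ind S) ` keys (\<Omega> S))"
  have finF: "finite F" unfolding F_def using finite_V by auto
  have FV: "keys a \<subseteq> V \<and> int (mono_degree a) = j" if a: "a \<in> F" for a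
  proof -
    obtain S m where S: "S \<subseteq> V" "card S = s" "m \<in> keys (\<Omega> S)" "a = m + ind S"
      using a unfolding F_def by auto
    have "\<Omega> S \<in> poly_ring V" "homogeneous (j - int s) (\<Omega> S)"
      using Gr_0D[OF KCD[OF w(1) S(1,2)]] unfolding \<Omega>_def by auto
    then have "keys m \<subseteq> V" "int (mono_degree m) = j - int s"
      using S(3) unfolding poly_ring_def homogeneous_def by auto
    then show ?thesis using S finite_sub[OF S(1)] by (simp add: keys_plus_nat mono_degree_plus mono_degree_ind)
  qed
  have "\<exists>b. \<forall>S\<subseteq>keys a. card S = s \<longrightarrow> \<not> (\<exists>e\<in>E. e \<subseteq> keys (a - ind S)) \<longrightarrow>
      koszul.co \<Omega> a S = bdry (keys a) \<epsilon> b S" if a: "a \<in> F" for a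
  proof (rule multidegree_exact[OF _ _ s])
    show aV: "keys a \<subseteq> V" "int (mono_degree a) = j" using FV[OF a] by auto
    show "\<not> cohom_nz (csign \<epsilon> W) E W p" if "W \<subseteq> V" "card W = p + s" "int (card W) = j" for W p
      using neg that by blast
    fix S assume S: "S \<subseteq> keys a" "card S = i" "\<not> (\<exists>e\<in>E. e \<subseteq> keys (a - ind S))"
    have SV: "S \<subseteq> V" using S aV by auto
    obtain y where y: "y \<in> Gr (Suc 0) (j - int i)" "Kd \<omega> S = D 0 y" using wc[OF SV S(2)] by blast
    then have "Kd \<omega> S 0 \<in> mono_ideal V E" using D_0_image[OF D_Gr[OF y(1)]] by auto
    then have "a - ind S \<notin> keys (koszul.tdiff \<Omega> S)"
      using S(3) unfolding Kd_0 \<Omega>_def mono_ideal_def by blast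
    then have "koszul.co (koszul.tdiff \<Omega>) a S = 0"
      unfolding koszul.co_def koszul_B by (simp add: in_keys_iff)
    then show "bdry (keys a) \<epsilon> (koszul.co \<Omega> a) S = 0"
      using koszul.co_tdiff[OF SV, of a \<Omega>] S(1) unfolding koszul_B Uat_koszul[OF aV(1)] by simp
  qed
  then obtain b where b: "\<And>a S. a \<in> F \<Longrightarrow> S \<subseteq> keys a \<Longrightarrow> card S = s \<Longrightarrow> \<not> (\<exists>e\<in>E. e \<subseteq> keys (a - ind S)) \<Longrightarrow>
      koszul.co \<Omega> a S = bdry (keys a) \<epsilon> (b a) S"
    by metis
  have "\<exists>p. \<forall>m. lookup p m = (if m + ind S \<in> F then b (m + ind S) S else 0)" for S
  proof (rule poly_mapping_of_finite_support, rule finite_imageD)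
    have "(\<lambda>m. m + ind S) ` {m. (if m + ind S \<in> F then b (m + ind S) S else 0) \<noteq> 0} \<subseteq> F"
      by auto
    then show "finite ((\<lambda>m. m + ind S) ` {m. (if m + ind S \<in> F then b (m + ind S) S else 0) \<noteq> 0})"
      using finF finite_subset by blast
  qed (auto intro: inj_onI)
  then obtain H where H: "\<And>S m. lookup (H S) m = (if m + ind S \<in> F then b (m + ind S) S else 0)"
    by metis
  define \<eta> where "\<eta> = (\<lambda>S b :: nat. if b = 0 then H S else 0)"
  have \<eta>: "\<eta> \<in> KC 0 (Suc s) j"
    unfolding KC_def
  proof safe
    fix S assume S: "S \<subseteq> V" "card S = Suc s"
    have "keys m \<subseteq> V \<and> int (mono_degree m) = j - int (Suc s)" if "m \<in> keys (H S)" for m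
    proof -
      have "m + ind S \<in> F" using that by (auto simp: in_keys_iff H split: if_splits)
      then show ?thesis using FV[of "m + ind S"] S finite_sub[OF S(1)]
        by (auto simp: keys_plus_nat mono_degree_plus mono_degree_ind)
    qed
    then show "\<eta> S \<in> Gr 0 (j - int (Suc s))" unfolding \<eta>_def
      by (intro Gr_0I) (auto simp: poly_ring_def homogeneous_def)
  qed
  have "\<exists>y\<in>Gr (Suc 0) (j - int s). (\<lambda>b. \<omega> S b - Kd \<eta> S b) = D 0 y" if S: "S \<subseteq> V" "card S = s" for S
  proof -
    have G: "(\<lambda>b. \<omega> S b - Kd \<eta> S b) \<in> Gr 0 (j - int s)"
      by (rule Gr_diff[OF KCD[OF w(1) S] Kd_Gr[OF \<eta> S]])
    have fS: "finite S" using finite_sub[OF S(1)] .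
    have "\<exists>e\<in>E. e \<subseteq> keys m" if m: "m \<in> keys (\<omega> S 0 - Kd \<eta> S 0)" for m
    proof (rule ccontr)
      assume dep: "\<not> (\<exists>e\<in>E. e \<subseteq> keys m)"
      define a where "a = m + ind S"
      have Sa: "S \<subseteq> keys a" unfolding a_def using fS by (simp add: keys_plus_nat)
      have 1: "lookup (\<omega> S 0) m = koszul.co \<Omega> a S"
        using koszul.co_lookup[OF S(1), of \<Omega> m] unfolding a_def koszul_B \<Omega>_def by simp
      have 2: "lookup (Kd \<eta> S 0) m = bdry (koszul.Uat a) \<epsilon> (koszul.co H a) S"
        using koszul.co_lookup[OF S(1), of "koszul.tdiff H" m] koszul.co_tdiff[OF S(1), of a H] Sa
        unfolding a_def koszul_B Kd_0 \<eta>_def by simp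
      have coH: "koszul.co H a T = (if a \<in> F then b a T else 0)" if "T \<subseteq> keys a" for T
        using that minus_ind_plus[of T a] finite_subset[OF that] unfolding koszul.co_def koszul_B H by simp
      have "koszul.co \<Omega> a S = bdry (koszul.Uat a) \<epsilon> (koszul.co H a) S"
      proof (cases "a \<in> F")
        case True
        have U: "koszul.Uat a = keys a" using Uat_koszul FV[OF True] by blast
        have "koszul.co \<Omega> a S = bdry (keys a) \<epsilon> (b a) S"
          using b[OF True Sa S(2)] dep unfolding a_def by simp
        also have "\<dots> = bdry (keys a) \<epsilon> (koszul.co H a) S"
          unfolding bdry_def by (rule sum.cong) (use coH Sa True in auto)
        finally show ?thesis unfolding U .
      next
        case False
        have "m \<notin> keys (\<Omega> S)" using False S unfolding F_def a_def by auto
        then have "koszul.co \<Omega> a S = 0" using 1 unfolding \<Omega>_def by (simp add: in_keys_iff)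
        moreover have "bdry (koszul.Uat a) \<epsilon> (koszul.co H a) S = 0"
          unfolding bdry_def
        proof (rule sum.neutral, rule ballI)
          fix u assume "u \<in> koszul.Uat a - S"
          then have "insert u S \<subseteq> keys a" using Sa unfolding koszul.Uat_def by auto
          then show "\<epsilon> u S * koszul.co H a (insert u S) = 0" using coH False by simp
        qed
        ultimately show ?thesis by simp
      qed
      then show False using m 1 2 by (simp add: in_keys_iff lookup_minus)
    qed
    then have "\<omega> S 0 - Kd \<eta> S 0 \<in> mono_ideal V E"
      using Gr_0D[OF G] unfolding mono_ideal_def by blast
    then show ?thesis using D_0_image[OF G] by simp
  qed
  then have "\<forall>S\<in>{S. S \<subseteq> V \<and> card S = s}. \<exists>y. y \<in> Gr (Suc 0) (j - int s) \<and> (\<lambda>b. \<omega> S b - Kd \<eta> S b) = D 0 y"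
    by blast
  from bchoice[OF this] obtain \<theta> where t: "\<And>S. S \<subseteq> V \<Longrightarrow> card S = s \<Longrightarrow> \<theta> S \<in> Gr (Suc 0) (j - int s)"
    "\<And>S. S \<subseteq> V \<Longrightarrow> card S = s \<Longrightarrow> (\<lambda>b. \<omega> S b - Kd \<eta> S b) = D 0 (\<theta> S)"
    by blast
  have "\<omega> S = (\<lambda>b. Kd \<eta> S b + D 0 (\<theta> S) b)" if "S \<subseteq> V" "card S = s" for S
    unfolding t(2)[OF that, symmetric] by simp
  then have "bounds 0 s j \<omega>"
    unfolding bounds_def using t(1)
    by (intro bexI[OF _ \<eta>] bexI[of _ \<theta>] allI impI) (simp_all add: KC_def)
  then show False using w(2) by blast
qed

end

section \<open>Vectors and matrices as functions\<close>

lemma mult_mat_vec_fun: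
  assumes "M \<in> carrier_mat m n"
  shows "M *\<^sub>v vec n f = vec m (mat_fun m n (\<lambda>a b. M $$ (a, b)) f)"
proof (rule eq_vecI)
  fix a assume "a < dim_vec (vec m (mat_fun m n (\<lambda>a b. M $$ (a, b)) f))"
  then have a: "a < m" by simp
  then have "(M *\<^sub>v vec n f) $ a = (\<Sum>b\<in>{0..<n}. M $$ (a, b) * f b)"
    using assms by (simp add: scalar_prod_def)
  then show "(M *\<^sub>v vec n f) $ a = vec m (mat_fun m n (\<lambda>a b. M $$ (a, b)) f) $ a"
    using a by (simp add: mat_fun_def atLeast0LessThan)
qed (use assms in auto)

lemma scalar_prod_vec_fun:
  assumes "v \<in> carrier_vec n"
  shows "v \<bullet> vec n f = mat_fun 1 n (\<lambda>a b. v $ b) f 0"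
  using assms by (simp add: scalar_prod_def mat_fun_def atLeast0LessThan)

lemma vec_free_fun: "f \<in> free_fun V r \<Longrightarrow> vec r f \<in> free_module V r"
  unfolding free_module_def free_fun_def by auto

lemma free_module_vec:
  assumes "v \<in> free_module V r"
  obtains f where "f \<in> free_fun V r" "v = vec r f"
proof (rule that[of "\<lambda>b. if b < r then v $ b else 0"])
  show "(\<lambda>b. if b < r then v $ b else 0) \<in> free_fun V r"
    using assms unfolding free_module_def free_fun_def by auto
  show "v = vec r (\<lambda>b. if b < r then v $ b else 0)"
    using assms unfolding free_module_def by auto
qed

lemma vec_fun_cong: "vec r f = vec r g \<Longrightarrow> b < r \<Longrightarrow> f b = g b"
  by (metis index_vec)

lemma mat_fun_outside: "\<not> a < m \<Longrightarrow> mat_fun m n M f a = 0"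
  unfolding mat_fun_def by simp

lemma vec_fun_eqI:
  assumes "vec r f = vec r g" "\<And>b. \<not> b < r \<Longrightarrow> f b = 0" "\<And>b. \<not> b < r \<Longrightarrow> g b = 0"
  shows "f = g"
proof
  fix b show "f b = g b" using vec_fun_cong[OF assms(1)] assms(2,3) by (cases "b < r") auto
qed

lemma free_fun_outside: "f \<in> free_fun V r \<Longrightarrow> \<not> b < r \<Longrightarrow> f b = 0"
  unfolding free_fun_def by (auto split: if_splits)

section \<open>Tensor homology of an arbitrary graded free resolution\<close>

context
  fixes V :: "'v set" and E :: "'v set set" and \<epsilon> :: "'v \<Rightarrow> 'v set \<Rightarrow> 'k::field"
    and F :: "('v, 'k) free_resolution"
  assumes finite_V: "finite V" and signs: "sign_system V \<epsilon>"
    and res: "graded_free_resolution V (mono_ideal V E) F"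
    and nonempty: "{} \<notin> E"
begin

definition rk :: "nat \<Rightarrow> nat" where
  "rk q = (case q of 0 \<Rightarrow> 1 | Suc q \<Rightarrow> res_rank F q)"

definition sh :: "nat \<Rightarrow> nat \<Rightarrow> int" where
  "sh q b = (case q of 0 \<Rightarrow> 0 | Suc q \<Rightarrow> res_shift F q b)"

definition dd :: "nat \<Rightarrow> nat \<Rightarrow> nat \<Rightarrow> ('v, 'k) mpoly" where
  "dd q a b = (case q of 0 \<Rightarrow> res_aug F $ b | Suc q \<Rightarrow> res_diff F q $$ (a, b))"

lemma rk_simps [simp]: "rk 0 = 1" "rk (Suc q) = res_rank F q"
  and sh_simps [simp]: "sh 0 b = 0" "sh (Suc q) b = res_shift F q b"
  and dd_simps: "dd 0 = (\<lambda>a b. res_aug F $ b)" "dd (Suc q) = (\<lambda>a b. res_diff F q $$ (a, b))"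
  by (auto simp: rk_def sh_def dd_def fun_eq_iff)

lemma res_facts:
  "res_aug F \<in> carrier_vec (res_rank F 0)"
  "res_diff F i \<in> carrier_mat (res_rank F i) (res_rank F (Suc i))"
  "{res_aug F \<bullet> v | v. v \<in> free_module V (res_rank F 0)} = mono_ideal V E"
  "{v \<in> free_module V (res_rank F 0). res_aug F \<bullet> v = 0} =
       {res_diff F 0 *\<^sub>v w | w. w \<in> free_module V (res_rank F 1)}"
  "{v \<in> free_module V (res_rank F (Suc i)). res_diff F i *\<^sub>v v = 0\<^sub>v (res_rank F i)} =
       {res_diff F (Suc i) *\<^sub>v w | w. w \<in> free_module V (res_rank F (Suc (Suc i)))}"
  using res unfolding graded_free_resolution_def free_module_def by auto

lemma aug_fun: "res_aug F \<bullet> vec (res_rank F 0) f = mat_fun (rk 0) (rk (Suc 0)) (dd 0) f 0"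
  using scalar_prod_vec_fun[OF res_facts(1)] by (simp add: dd_simps)

lemma diff_fun:
  "res_diff F q *\<^sub>v vec (res_rank F (Suc q)) f
    = vec (res_rank F q) (mat_fun (rk (Suc q)) (rk (Suc (Suc q))) (dd (Suc q)) f)"
  using mult_mat_vec_fun[OF res_facts(2)] by (simp add: dd_simps)

lemma cycle_iff:
  "mat_fun (rk q) (rk (Suc q)) (dd q) f = (\<lambda>_. 0) \<longleftrightarrow>
    (case q of 0 \<Rightarrow> res_aug F \<bullet> vec (res_rank F 0) f = 0
     | Suc i \<Rightarrow> res_diff F i *\<^sub>v vec (res_rank F (Suc i)) f = 0\<^sub>v (res_rank F i))"
proof (cases q)
  case 0
  have "mat_fun (rk 0) (rk (Suc 0)) (dd 0) f = (\<lambda>_. 0) \<longleftrightarrow> mat_fun (rk 0) (rk (Suc 0)) (dd 0) f 0 = 0"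
    unfolding fun_eq_iff using mat_fun_outside[of _ "rk 0" "rk (Suc 0)" "dd 0" f] by (metis less_one rk_simps(1))
  then show ?thesis using aug_fun[of f] 0 by simp
next
  case (Suc i)
  have z: "0\<^sub>v (res_rank F i) = vec (res_rank F i) (\<lambda>_. 0 :: ('v, 'k) mpoly)" by auto
  show ?thesis
    unfolding Suc nat.case diff_fun z
    by (auto intro!: vec_fun_eqI[of "res_rank F i"] simp: mat_fun_outside)
qed

text \<open>Joins exactness at the augmentation and at the later differentials into one equivalence,
  whose two directions are the locale assumptions \<open>d_exact\<close> and
  \<open>d_complex\<close>.\<close>

lemma kernel_image:
  assumes f: "f \<in> free_fun V (rk (Suc q))"
  shows "mat_fun (rk q) (rk (Suc q)) (dd q) f = (\<lambda>_. 0) \<longleftrightarrow>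
    (\<exists>g\<in>free_fun V (rk (Suc (Suc q))). mat_fun (rk (Suc q)) (rk (Suc (Suc q))) (dd (Suc q)) g = f)"
proof -
  let ?v = "vec (res_rank F q) f"
  have v: "?v \<in> free_module V (res_rank F q)" using f vec_free_fun by simp
  have "mat_fun (rk q) (rk (Suc q)) (dd q) f = (\<lambda>_. 0) \<longleftrightarrow>
      ?v \<in> {res_diff F q *\<^sub>v w | w. w \<in> free_module V (res_rank F (Suc q))}"
  proof (cases q)
    case 0
    then show ?thesis unfolding cycle_iff 0 nat.case
      using res_facts(4)[THEN eqset_imp_iff, of "vec (res_rank F 0) f"] v[unfolded 0] by simp
  next
    case (Suc i)
    then show ?thesis unfolding cycle_iff Suc nat.case
      using res_facts(5)[of i, THEN eqset_imp_iff, of "vec (res_rank F (Suc i)) f"] v[unfolded Suc] by simp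
  qed
  also have "\<dots> \<longleftrightarrow> (\<exists>g\<in>free_fun V (rk (Suc (Suc q))). ?v = res_diff F q *\<^sub>v vec (res_rank F (Suc q)) g)"
    by (auto intro: vec_free_fun elim!: free_module_vec)
  also have "\<dots> \<longleftrightarrow> (\<exists>g\<in>free_fun V (rk (Suc (Suc q))). mat_fun (rk (Suc q)) (rk (Suc (Suc q))) (dd (Suc q)) g = f)"
    unfolding diff_fun
    using vec_fun_eqI[of "res_rank F q" f] free_fun_outside[OF f] mat_fun_outside by (metis rk_simps(2))
  finally show ?thesis .
qed

lemma mat_fun_free_fun:
  assumes "\<And>a b. a < m \<Longrightarrow> b < n \<Longrightarrow> M a b \<in> poly_ring V" "f \<in> free_fun V n"
  shows "mat_fun m n M f \<in> free_fun V m"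
  using assms unfolding free_fun_def mat_fun_def by (auto intro!: poly_ring_sum poly_ring_mult split: if_splits)

lemma dd_ring: "a < rk q \<Longrightarrow> b < rk (Suc q) \<Longrightarrow> dd q a b \<in> poly_ring V"
  using res unfolding graded_free_resolution_def free_module_def by (cases q) (auto simp: dd_simps)

lemma dd_homogeneous:
  "a < rk q \<Longrightarrow> b < rk (Suc q) \<Longrightarrow> homogeneous (sh (Suc q) b - sh q a) (dd q a b)"
  using res unfolding graded_free_resolution_def by (cases q) (auto simp: dd_simps)

interpretation graded_complex V \<epsilon> rk sh dd
proof unfold_locales
  show "finite V" "sign_system V \<epsilon>" by (rule finite_V, rule signs)
  show "a < rk q \<Longrightarrow> b < rk (Suc q) \<Longrightarrow> dd q a b \<in> poly_ring V" for q a b by (rule dd_ring)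
  show "a < rk q \<Longrightarrow> b < rk (Suc q) \<Longrightarrow> homogeneous (sh (Suc q) b - sh q a) (dd q a b)" for q a b
    by (rule dd_homogeneous)
  show "\<exists>g\<in>free_fun V (rk (Suc (Suc q))). mat_fun (rk (Suc q)) (rk (Suc (Suc q))) (dd (Suc q)) g = f"
    if "f \<in> free_fun V (rk (Suc q))" "mat_fun (rk q) (rk (Suc q)) (dd q) f = (\<lambda>_. 0)" for q f
    using kernel_image that by blast
  show "mat_fun (rk q) (rk (Suc q)) (dd q) (mat_fun (rk (Suc q)) (rk (Suc (Suc q))) (dd (Suc q)) g) = (\<lambda>_. 0)"
    if "g \<in> free_fun V (rk (Suc (Suc q)))" for q g
  proof -
    have "mat_fun (rk (Suc q)) (rk (Suc (Suc q))) (dd (Suc q)) g \<in> free_fun V (rk (Suc q))"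
      by (rule mat_fun_free_fun[OF dd_ring that])
    then show ?thesis using kernel_image that by blast
  qed
qed

interpretation edge_resolution V \<epsilon> rk sh dd E
proof unfold_locales
  show "rk 0 = 1" "sh 0 0 = 0" by simp_all
  show "{D 0 g 0 |g. g \<in> free_fun V (rk 1)} = mono_ideal V E"
    unfolding res_facts(3)[symmetric] D_def
    by (auto simp: aug_fun intro: vec_free_fun elim!: free_module_vec) (metis aug_fun rk_simps One_nat_def vec_free_fun)
qed

definition cst :: "nat \<Rightarrow> (nat \<Rightarrow> ('v, 'k) mpoly) \<Rightarrow> 'k vec" where
  "cst i z = vec (res_rank F i) (\<lambda>b. lookup (z b) 0)"

lemma cst_part: "tensor_part F i j = cst i ` Gr (Suc i) j"
proof safe
  fix y assume y: "y \<in> tensor_part F i j"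
  \<comment> \<open>Lift by constant polynomials. These have degree 0, as required wherever
    \<open>y $ b\<close> is nonzero, because there the shift is j.\<close>
  define z :: "nat \<Rightarrow> ('v, 'k) mpoly" where "z b = (if b < res_rank F i then single 0 (y $ b) else 0)" for b
  have "z \<in> Gr (Suc i) j"
    using y unfolding tensor_part_def z_def
    by (intro GrI) (auto intro!: poly_ring_single simp: homogeneous_def)
  moreover have "y = cst i z"
    using y unfolding tensor_part_def cst_def z_def by auto
  ultimately show "y \<in> cst i ` Gr (Suc i) j" by blast
next
  fix z assume z: "z \<in> Gr (Suc i) j"
  have "res_shift F i b = j" if "b < res_rank F i" "lookup (z b) 0 \<noteq> 0" for b
  proof -
    have "0 \<in> keys (z b)" using that(2) by (simp add: in_keys_iff)
    then show ?thesis using GrD(2)[OF z, of b] that(1) unfolding homogeneous_def by fastforce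
  qed
  then show "cst i z \<in> tensor_part F i j"
    unfolding tensor_part_def cst_def by auto
qed

lemma tensor_diff_cst: "tensor_diff F i *\<^sub>v cst (Suc i) w = cst i (D (Suc i) w)"
proof (rule eq_vecI)
  fix a assume "a < dim_vec (cst i (D (Suc i) w))"
  then have a: "a < res_rank F i" by (simp add: cst_def)
  note c = res_facts(2)[of i]
  have "(tensor_diff F i *\<^sub>v cst (Suc i) w) $ a
      = (\<Sum>b\<in>{0..<res_rank F (Suc i)}. lookup (res_diff F i $$ (a, b)) 0 * lookup (w b) 0)"
    unfolding tensor_diff_def cst_def using a c by (simp add: scalar_prod_def)
  also have "\<dots> = cst i (D (Suc i) w) $ a"
    unfolding cst_def D_def mat_fun_def using a
    by (simp add: lookup_sum lookup_mult_0 dd_simps atLeast0LessThan)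
  finally show "(tensor_diff F i *\<^sub>v cst (Suc i) w) $ a = cst i (D (Suc i) w) $ a" .
qed (use res_facts(2)[of i] in \<open>auto simp: cst_def tensor_diff_def\<close>)

lemma cst_eq_iff: "cst i z = cst i z' \<longleftrightarrow> (\<forall>b<res_rank F i. lookup (z b) 0 = lookup (z' b) 0)"
  unfolding cst_def by (auto dest: vec_fun_cong intro!: eq_vecI)

lemma cst_cycles:
  assumes z: "z \<in> Gr (Suc i) j"
  shows "cst i z \<in> tensor_cycles F i j \<longleftrightarrow> (\<forall>a. lookup (D i z a) 0 = 0)"
proof (cases i)
  \<comment> \<open>\<open>tensor_cycles\<close> imposes no equation in position 0, and none is
    hidden on the other side: \<open>D 0 z\<close> lies in the ideal, which has no constant terms
    because the empty set is not an edge.\<close>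
  case 0
  have "D 0 z \<in> Gr 0 j" using D_Gr z 0 by blast
  moreover have "D 0 z 0 \<in> mono_ideal V E"
    using D_0_image[OF calculation] z 0 by auto
  then have "0 \<notin> keys (D 0 z 0)" using nonempty unfolding mono_ideal_def by auto
  ultimately have "lookup (D 0 z a) 0 = 0" for a
    using Gr_0D[of "D 0 z" j] by (cases "a = 0") (auto simp: in_keys_iff)
  then show ?thesis using z 0 cst_part[of 0 j] by auto
next
  case (Suc k)
  have "cst i z \<in> tensor_cycles F i j \<longleftrightarrow> tensor_diff F k *\<^sub>v cst (Suc k) z = 0\<^sub>v (res_rank F k)"
    using cst_part[of i j] z unfolding Suc by auto
  also have "\<dots> \<longleftrightarrow> cst k (D i z) = cst k (\<lambda>_. 0)"
    unfolding tensor_diff_cst Suc by (simp add: cst_def zero_vec_def)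
  also have "\<dots> \<longleftrightarrow> (\<forall>a. lookup (D i z a) 0 = 0)"
    unfolding cst_eq_iff using GrD(3)[OF D_Gr[OF z]] Suc
    by (metis lookup_zero rk_simps(2))
  finally show ?thesis .
qed

lemma cst_boundaries:
  assumes z: "z \<in> Gr (Suc i) j"
  shows "cst i z \<in> tensor_boundaries F i j \<longleftrightarrow>
    (\<exists>w\<in>Gr (Suc (Suc i)) j. \<forall>b. lookup (z b - D (Suc i) w b) 0 = 0)"
proof -
  have "cst i z \<in> tensor_boundaries F i j \<longleftrightarrow> (\<exists>w\<in>Gr (Suc (Suc i)) j. cst i z = cst i (D (Suc i) w))"
    unfolding tensor_boundaries_def cst_part by (auto simp flip: tensor_diff_cst)
  also have "\<dots> \<longleftrightarrow> (\<exists>w\<in>Gr (Suc (Suc i)) j. \<forall>b. lookup (z b - D (Suc i) w b) 0 = 0)"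
  proof (rule bex_cong[OF refl])
    fix w assume w: "w \<in> Gr (Suc (Suc i)) j"
    show "cst i z = cst i (D (Suc i) w) \<longleftrightarrow> (\<forall>b. lookup (z b - D (Suc i) w b) 0 = 0)"
      unfolding cst_eq_iff lookup_minus using GrD(3)[OF D_Gr[OF w]] GrD(3)[OF z]
      by (metis eq_iff_diff_eq_0 lookup_zero rk_simps(2))
  qed
  finally show ?thesis .
qed

lemma cycles_subset_part: "tensor_cycles F i j \<subseteq> tensor_part F i j"
  by (cases i) auto

lemma boundaries_subset_cycles: "tensor_boundaries F i j \<subseteq> tensor_cycles F i j"
proof
  fix y assume "y \<in> tensor_boundaries F i j"
  then obtain w where w: "w \<in> Gr (Suc (Suc i)) j" "y = cst i (D (Suc i) w)"
    unfolding tensor_boundaries_def cst_part by (auto simp flip: tensor_diff_cst)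
  show "y \<in> tensor_cycles F i j"
    unfolding w(2) cst_cycles[OF D_Gr[OF w(1)]] D_D[OF w(1)] by simp
qed

text \<open>The right-hand side does not mention the resolution. The existential quantifier in
  \<open>Tor_nonzero\<close> therefore asks only that some resolution exists.\<close>

lemma tensor_homology_nz:
  "tensor_cycles F i j \<noteq> tensor_boundaries F i j \<longleftrightarrow>
    (\<exists>W p. W \<subseteq> V \<and> card W = p + Suc i \<and> int (card W) = j \<and> cohom_nz (csign \<epsilon> W) E W p)"
proof -
  have "tensor_cycles F i j \<noteq> tensor_boundaries F i j \<longleftrightarrow>
      (\<exists>y\<in>cst i ` Gr (Suc i) j. y \<in> tensor_cycles F i j \<and> y \<notin> tensor_boundaries F i j)"
    using boundaries_subset_cycles cycles_subset_part[of i j] unfolding cst_part by blast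
  also have "\<dots> \<longleftrightarrow> linked_nz i 0 j"
    unfolding linked_nz_0 by (simp add: cst_cycles cst_boundaries cong: bex_cong)
  also have "\<dots> \<longleftrightarrow> koszul_nz 0 (Suc i) j"
    using koszul_nz_linked[of 0 i j] by simp
  also have "\<dots> \<longleftrightarrow> (\<exists>W p. W \<subseteq> V \<and> card W = p + Suc i \<and> int (card W) = j \<and> cohom_nz (csign \<epsilon> W) E W p)"
    using nz_of_cohom[of _ _ "Suc i" j i] cohom_of_nz[of "Suc i" i j] by auto
  finally show ?thesis .
qed

end

section \<open>The Taylor resolution\<close>

lemma mono_ideal_sum:
  "(\<And>x. x \<in> I \<Longrightarrow> f x \<in> mono_ideal V E) \<Longrightarrow> sum f I \<in> mono_ideal V E"
proof (induction I rule: infinite_finite_induct)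
  case (insert x I)
  have "f x \<in> mono_ideal V E" "sum f I \<in> mono_ideal V E" using insert by auto
  then have "f x + sum f I \<in> mono_ideal V E"
    unfolding mono_ideal_def using keys_add[of "f x" "sum f I"] by (auto intro: poly_ring_add)
  then show ?case using insert by simp
qed (auto simp: mono_ideal_def)

lemma mono_ideal_mult:
  assumes "p \<in> poly_ring V" "e \<in> E" "e \<subseteq> V" "finite e"
  shows "p * single (ind e) c \<in> mono_ideal V E"
  unfolding mono_ideal_def
proof (intro CollectI conjI ballI)
  show "p * single (ind e) c \<in> poly_ring V"
    using assms by (intro poly_ring_mult poly_ring_single) auto
  fix m assume "m \<in> keys (p * single (ind e) c)"
  then obtain a b where "m = a + b" "b \<in> keys (single (ind e) c)"
    using keys_mult[of p "single (ind e) c"] by blast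
  then show "\<exists>e\<in>E. e \<subseteq> keys m"
    using assms by (intro bexI[of _ e]) (auto simp: keys_plus_nat split: if_splits)
qed

locale taylor = weighted_simplex E "\<lambda>e. e" \<epsilon>
  for E :: "'v set set" and \<epsilon> :: "'v set \<Rightarrow> 'v set set \<Rightarrow> 'k::field" +
  fixes V :: "'v set"
  assumes edge_subset: "e \<in> E \<Longrightarrow> e \<subseteq> V"
begin

lemma B_subset: "S \<subseteq> E \<Longrightarrow> B S \<subseteq> V"
  unfolding B_def using edge_subset by auto

lemma tdiff_exact_poly_ring:
  assumes \<Omega>: "\<And>S. \<Omega> S \<in> poly_ring V"
    and cyc: "\<And>S. S \<subseteq> E \<Longrightarrow> Suc (card S) = s \<Longrightarrow> tdiff \<Omega> S = 0"
    and cov: "\<And>m. s = 0 \<Longrightarrow> m \<in> keys (\<Omega> {}) \<Longrightarrow> \<exists>e\<in>E. e \<subseteq> keys m"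
  obtains \<eta> where "\<And>S. S \<subseteq> E \<Longrightarrow> card S = s \<Longrightarrow> \<Omega> S = tdiff \<eta> S" "\<And>S. S \<subseteq> E \<Longrightarrow> \<eta> S \<in> poly_ring V"
proof (rule tdiff_exact[OF cyc cov])
  fix \<eta>
  assume 1: "\<And>S. S \<subseteq> E \<Longrightarrow> card S = s \<Longrightarrow> \<Omega> S = tdiff \<eta> S"
    and 2: "\<And>S m. S \<subseteq> E \<Longrightarrow> m \<in> keys (\<eta> S) \<Longrightarrow>
      \<exists>S'\<subseteq>E. card S' = s \<and> (\<exists>m'\<in>keys (\<Omega> S'). m + ind (B S) = m' + ind (B S'))"
  have "\<eta> S \<in> poly_ring V" if S: "S \<subseteq> E" for S
    unfolding poly_ring_def
  proof (intro CollectI ballI)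
    fix m assume "m \<in> keys (\<eta> S)"
    from 2[OF S this] obtain S' m' where
      m': "S' \<subseteq> E" "m' \<in> keys (\<Omega> S')" "m + ind (B S) = m' + ind (B S')" by blast
    have "keys m \<subseteq> keys (m' + ind (B S'))"
      unfolding m'(3)[symmetric] by (simp add: keys_plus_nat)
    also have "\<dots> \<subseteq> V"
      using m'(2) \<Omega>[of S'] B_subset[OF m'(1)] finite_B[OF m'(1)]
      unfolding poly_ring_def by (auto simp: keys_plus_nat)
    finally show "keys m \<subseteq> V" .
  qed
  with 1 show thesis by (rule that)
qed

lemma mono_ideal_tdiff:
  assumes "p \<in> mono_ideal V E"
  obtains \<eta> where "p = tdiff \<eta> {}" "\<And>S. S \<subseteq> E \<Longrightarrow> \<eta> S \<in> poly_ring V"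
proof (rule tdiff_exact_poly_ring[of "\<lambda>_. p" 0])
  show "p \<in> poly_ring V" using assms unfolding mono_ideal_def by simp
next
  fix m assume "m \<in> keys p"
  then show "\<exists>e\<in>E. e \<subseteq> keys m" using assms unfolding mono_ideal_def by simp
next
  fix \<eta>
  assume \<eta>: "\<And>S. S \<subseteq> E \<Longrightarrow> card S = 0 \<Longrightarrow> p = tdiff \<eta> S" "\<And>S. S \<subseteq> E \<Longrightarrow> \<eta> S \<in> poly_ring V"
  show thesis by (rule that[OF \<eta>(1)[OF empty_subsetI card.empty] \<eta>(2)])
qed simp

lemma tdiff_poly_ring:
  assumes "\<And>S. S \<subseteq> E \<Longrightarrow> \<Omega> S \<in> poly_ring V" "S \<subseteq> E"
  shows "tdiff \<Omega> S \<in> poly_ring V"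
  unfolding tdiff_def
  by (intro poly_ring_sum poly_ring_mult poly_ring_single assms(1))
     (use assms(2) edge_subset finite_A in auto)

lemma tdiff_empty_mono_ideal:
  assumes "\<And>S. S \<subseteq> E \<Longrightarrow> \<Omega> S \<in> poly_ring V"
  shows "tdiff \<Omega> {} \<in> mono_ideal V E"
proof -
  have "tdiff \<Omega> {} = (\<Sum>e\<in>E. \<Omega> {e} * single (ind e) (\<epsilon> e {}))"
    unfolding tdiff_def B_def by (simp add: mult.commute)
  also have "\<dots> \<in> mono_ideal V E"
    by (intro mono_ideal_sum mono_ideal_mult assms) (use edge_subset finite_A in auto)
  finally show ?thesis .
qed

text \<open>Position k of a resolution of the ideal has the sets of k + 1 edges as its basis. The
  empty set belongs to the ring, the target of the augmentation.\<close>

definition faces :: "nat \<Rightarrow> 'v set set set" where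
  "faces k = {S. S \<subseteq> E \<and> card S = Suc k}"

definition enum :: "nat \<Rightarrow> nat \<Rightarrow> 'v set set" where
  "enum k = (SOME h. bij_betw h {0..<card (faces k)} (faces k))"

abbreviation Fr :: "nat \<Rightarrow> ('v, 'k) mpoly vec set" where
  "Fr k \<equiv> free_module V (card (faces k))"

lemma finite_faces: "finite (faces k)"
  unfolding faces_def using finite_U by auto

lemma enum_bij: "bij_betw (enum k) {..<card (faces k)} (faces k)"
  unfolding enum_def atLeast0LessThan[symmetric]
  using ex_bij_betw_nat_finite[OF finite_faces] by (rule someI_ex)

lemma enum_in: "b < card (faces k) \<Longrightarrow> enum k b \<in> faces k"
  using enum_bij[of k] unfolding bij_betw_def by auto

text \<open>At most one summand is nonzero, since T and S determine u. The form of a sum allows the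
  summations to be exchanged when comparing with \<open>tdiff\<close>.\<close>

definition ent :: "'v set set \<Rightarrow> 'v set set \<Rightarrow> ('v, 'k) mpoly" where
  "ent S T = (\<Sum>u\<in>E - S. if T = insert u S then single (ind (u - B S)) (\<epsilon> u S) else 0)"

lemma sum_ent:
  assumes "S \<subseteq> E" "card S = k"
  shows "(\<Sum>b<card (faces k). ent S (enum k b) * \<Omega> (enum k b)) = tdiff \<Omega> S"
proof -
  have fS: "finite S" using assms finite_U finite_subset by blast
  have "(\<Sum>b<card (faces k). ent S (enum k b) * \<Omega> (enum k b)) = (\<Sum>T\<in>faces k. ent S T * \<Omega> T)"
    by (rule sum.reindex_bij_betw[OF enum_bij])
  also have "\<dots> = (\<Sum>u\<in>E - S. \<Sum>T\<in>faces k. if T = insert u S then single (ind (u - B S)) (\<epsilon> u S) * \<Omega> T else 0)"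
    unfolding ent_def sum_distrib_right by (subst sum.swap) (intro sum.cong, auto)
  also have "\<dots> = tdiff \<Omega> S"
    unfolding tdiff_def
  proof (rule sum.cong)
    fix u assume "u \<in> E - S"
    then have "insert u S \<in> faces k" using assms fS unfolding faces_def by auto
    then show "(\<Sum>T\<in>faces k. if T = insert u S then single (ind (u - B S)) (\<epsilon> u S) * \<Omega> T else 0)
      = single (ind (u - B S)) (\<epsilon> u S) * \<Omega> (insert u S)"
      using finite_faces by (simp add: sum.delta)
  qed simp
  finally show ?thesis .
qed

definition taylor_res :: "('v, 'k) free_resolution" where
  "taylor_res = \<lparr>res_rank = \<lambda>k. card (faces k),
     res_shift = \<lambda>k b. int (card (B (enum k b))),
     res_diff = \<lambda>k. mat (card (faces k)) (card (faces (Suc k))) (\<lambda>(a, b). ent (enum k a) (enum (Suc k) b)),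
     res_aug = vec (card (faces 0)) (\<lambda>b. ent {} (enum 0 b))\<rparr>"

lemma taylor_res_simps [simp]:
  "res_rank taylor_res k = card (faces k)"
  "res_shift taylor_res k b = int (card (B (enum k b)))"
  "res_diff taylor_res k = mat (card (faces k)) (card (faces (Suc k))) (\<lambda>(a, b). ent (enum k a) (enum (Suc k) b))"
  "res_aug taylor_res = vec (card (faces 0)) (\<lambda>b. ent {} (enum 0 b))"
  unfolding taylor_res_def by auto

lemma ent_poly_ring: "S \<subseteq> E \<Longrightarrow> ent S T \<in> poly_ring V"
  unfolding ent_def
  by (intro poly_ring_sum) (use finite_A in \<open>auto intro!: poly_ring_single dest: edge_subset[THEN subsetD]\<close>)

lemma ent_homogeneous:
  assumes "S \<subseteq> E"
  shows "homogeneous (int (card (B T)) - int (card (B S))) (ent S T)"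
  unfolding ent_def
proof (rule homogeneous_sum)
  fix u assume u: "u \<in> E - S"
  have "card (B (insert u S)) = card (u - B S) + card (B S)"
    unfolding B_insert using u finite_A finite_B[OF assms]
    by (metis DiffD1 Diff_disjoint Int_commute Un_Diff_cancel2 card_Un_disjoint finite_Diff)
  then show "homogeneous (int (card (B T)) - int (card (B S)))
      (if T = insert u S then single (ind (u - B S)) (\<epsilon> u S) else 0)"
    using u finite_A by (auto intro!: homogeneous_single simp: mono_degree_ind)
qed

definition vr :: "nat \<Rightarrow> ('v set set \<Rightarrow> ('v, 'k) mpoly) \<Rightarrow> ('v, 'k) mpoly vec" where
  "vr k \<Omega> = vec (card (faces k)) (\<lambda>b. \<Omega> (enum k b))"

lemma vr_free: "(\<And>S. S \<subseteq> E \<Longrightarrow> \<Omega> S \<in> poly_ring V) \<Longrightarrow> vr k \<Omega> \<in> Fr k"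
  using enum_in unfolding vr_def free_module_def faces_def by auto

lemma free_vr:
  assumes "v \<in> Fr k"
  obtains \<Omega> where "v = vr k \<Omega>" "\<And>S. \<Omega> S \<in> poly_ring V"
proof -
  define \<Omega> where "\<Omega> S = (if S \<in> faces k then v $ the_inv_into {..<card (faces k)} (enum k) S else 0)" for S
  have 1: "v = vr k \<Omega>"
    using assms enum_in the_inv_into_f_f[OF bij_betw_imp_inj_on[OF enum_bij]]
    unfolding vr_def free_module_def \<Omega>_def by (intro eq_vecI) auto
  have 2: "\<Omega> S \<in> poly_ring V" for S
  proof (cases "S \<in> faces k")
    case True
    then have "the_inv_into {..<card (faces k)} (enum k) S < card (faces k)"
      using the_inv_into_into[OF bij_betw_imp_inj_on[OF enum_bij], of S k "{..<card (faces k)}"] enum_bij[of k]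
      unfolding bij_betw_def by auto
    then show ?thesis using assms True unfolding \<Omega>_def free_module_def by auto
  qed (simp add: \<Omega>_def)
  show thesis by (rule that[OF 1 2])
qed

lemma vr_eq_iff: "vr k \<Omega> = vr k \<Omega>' \<longleftrightarrow> (\<forall>S\<subseteq>E. card S = Suc k \<longrightarrow> \<Omega> S = \<Omega>' S)"
proof -
  have "vr k \<Omega> = vr k \<Omega>' \<longleftrightarrow> (\<forall>b<card (faces k). \<Omega> (enum k b) = \<Omega>' (enum k b))"
    unfolding vr_def by (auto dest: vec_fun_cong intro!: eq_vecI)
  also have "\<dots> \<longleftrightarrow> (\<forall>S\<in>enum k ` {..<card (faces k)}. \<Omega> S = \<Omega>' S)" by auto
  also have "enum k ` {..<card (faces k)} = faces k" using enum_bij unfolding bij_betw_def by blast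
  finally show ?thesis unfolding faces_def by auto
qed

lemma vr_zero: "vr k (\<lambda>_. 0) = 0\<^sub>v (card (faces k))"
  unfolding vr_def by auto

lemma diff_vr: "res_diff taylor_res k *\<^sub>v vr (Suc k) \<Omega> = vr k (tdiff \<Omega>)"
proof (rule eq_vecI)
  fix a assume "a < dim_vec (vr k (tdiff \<Omega>))"
  then have a: "a < card (faces k)" by (simp add: vr_def)
  have "(res_diff taylor_res k *\<^sub>v vr (Suc k) \<Omega>) $ a
     = (\<Sum>b<card (faces (Suc k)). ent (enum k a) (enum (Suc k) b) * \<Omega> (enum (Suc k) b))"
    using a unfolding vr_def by (simp add: scalar_prod_def atLeast0LessThan)
  also have "\<dots> = tdiff \<Omega> (enum k a)"
    by (rule sum_ent) (use enum_in[OF a] in \<open>auto simp: faces_def\<close>)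
  finally show "(res_diff taylor_res k *\<^sub>v vr (Suc k) \<Omega>) $ a = vr k (tdiff \<Omega>) $ a"
    using a unfolding vr_def by simp
qed (simp add: vr_def)

lemma aug_vr: "res_aug taylor_res \<bullet> vr 0 \<Omega> = tdiff \<Omega> {}"
  using sum_ent[of "{}" 0 \<Omega>] unfolding vr_def by (simp add: scalar_prod_def atLeast0LessThan)

lemma kernel_vr:
  assumes \<Omega>: "\<And>S. \<Omega> S \<in> poly_ring V" and cyc: "\<And>S. S \<subseteq> E \<Longrightarrow> card S = k \<Longrightarrow> tdiff \<Omega> S = 0"
  shows "\<exists>w\<in>Fr (Suc k). vr k \<Omega> = res_diff taylor_res k *\<^sub>v w"
proof (rule tdiff_exact_poly_ring[of \<Omega> "Suc k"])
  show "\<Omega> S \<in> poly_ring V" for S by (rule \<Omega>)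
  show "tdiff \<Omega> S = 0" if "S \<subseteq> E" "Suc (card S) = Suc k" for S using cyc that by simp
next
  fix \<eta>
  assume \<eta>: "\<And>S. S \<subseteq> E \<Longrightarrow> card S = Suc k \<Longrightarrow> \<Omega> S = tdiff \<eta> S" "\<And>S. S \<subseteq> E \<Longrightarrow> \<eta> S \<in> poly_ring V"
  have "vr k \<Omega> = res_diff taylor_res k *\<^sub>v vr (Suc k) \<eta>"
    unfolding diff_vr vr_eq_iff using \<eta>(1) by simp
  moreover have "vr (Suc k) \<eta> \<in> Fr (Suc k)" by (rule vr_free[OF \<eta>(2)])
  ultimately show ?thesis by blast
qed simp

lemma image_cycle:
  assumes "w \<in> Fr (Suc k)"
  obtains \<Omega> where "res_diff taylor_res k *\<^sub>v w = vr k \<Omega>" "\<And>S. S \<subseteq> E \<Longrightarrow> \<Omega> S \<in> poly_ring V"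
    "\<And>S. S \<subseteq> E \<Longrightarrow> tdiff \<Omega> S = 0"
proof -
  obtain \<Omega> where w: "w = vr (Suc k) \<Omega>" "\<And>S. \<Omega> S \<in> poly_ring V" using free_vr[OF assms] by blast
  show thesis
    by (rule that[of "tdiff \<Omega>"]) (auto simp only: w(1) diff_vr intro!: tdiff_tdiff tdiff_poly_ring w(2))
qed

abbreviation (input) "Rm k \<equiv> free_module V (res_rank taylor_res k)"

text \<open>Exactness is \<open>tdiff_exact\<close> in every position: s = 0 gives the image of the
  augmentation, s = k + 1 the kernel in position k. The opposite inclusions come from
  \<open>tdiff_tdiff\<close>.\<close>

lemma taylor_resolution: "graded_free_resolution V (mono_ideal V E) taylor_res"
  (is "graded_free_resolution V _ ?F")
  unfolding graded_free_resolution_def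
proof (intro conjI allI impI)
  show "res_aug ?F \<in> Rm 0"
    unfolding free_module_def by (auto intro: ent_poly_ring)
  show "homogeneous (res_shift ?F 0 b) (res_aug ?F $ b)" if "b < res_rank ?F 0" for b
    using that ent_homogeneous[of "{}" "enum 0 b"] by (simp add: B_def)
  show "res_diff ?F i \<in> carrier_mat (res_rank ?F i) (res_rank ?F (Suc i))" for i
    by simp
next
  fix i a b assume ab: "a < res_rank ?F i" "b < res_rank ?F (Suc i)"
  then have "enum i a \<in> faces i" by (simp add: enum_in)
  then have S: "enum i a \<subseteq> E" unfolding faces_def by simp
  show "res_diff ?F i $$ (a, b) \<in> poly_ring V"
    "homogeneous (res_shift ?F (Suc i) b - res_shift ?F i a) (res_diff ?F i $$ (a, b))"
    using ab ent_poly_ring[OF S] ent_homogeneous[OF S] by simp_all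
next
  show "{res_aug ?F \<bullet> v |v. v \<in> Rm 0} = mono_ideal V E"
  proof (intro equalityI subsetI)
    fix p assume "p \<in> {res_aug ?F \<bullet> v |v. v \<in> Rm 0}"
    then obtain v where v: "p = res_aug ?F \<bullet> v" "v \<in> Fr 0" by auto
    obtain \<Omega> where "v = vr 0 \<Omega>" "\<And>S. \<Omega> S \<in> poly_ring V" using free_vr[OF v(2)] by blast
    then show "p \<in> mono_ideal V E"
      unfolding v(1) by (simp only: aug_vr) (rule tdiff_empty_mono_ideal)
  next
    fix p :: "('v, 'k) mpoly" assume "p \<in> mono_ideal V E"
    then obtain \<eta> where "p = tdiff \<eta> {}" "\<And>S. S \<subseteq> E \<Longrightarrow> \<eta> S \<in> poly_ring V"
      by (rule mono_ideal_tdiff) blast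
    then have "p = res_aug ?F \<bullet> vr 0 \<eta>" "vr 0 \<eta> \<in> Fr 0"
      using vr_free by (auto simp only: aug_vr)
    then show "p \<in> {res_aug ?F \<bullet> v |v. v \<in> Rm 0}" by auto
  qed
next
  show "{v \<in> Rm 0. res_aug ?F \<bullet> v = 0} =
    {res_diff ?F 0 *\<^sub>v w |w. w \<in> Rm 1}"
  proof (intro equalityI subsetI)
    fix v assume v: "v \<in> {v \<in> Rm 0. res_aug ?F \<bullet> v = 0}"
    then have "v \<in> Fr 0" by simp
    then obtain \<Omega> where \<Omega>: "v = vr 0 \<Omega>" "\<And>S. \<Omega> S \<in> poly_ring V" using free_vr by blast
    have "tdiff \<Omega> S = 0" if "S \<subseteq> E" "card S = 0" for S
    proof -
      have "S = {}" using that finite_U finite_subset by (metis card_eq_0_iff)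
      then show ?thesis using v unfolding \<Omega>(1) by (simp only: mem_Collect_eq aug_vr)
    qed
    then obtain w where "w \<in> Fr (Suc 0)" "v = res_diff ?F 0 *\<^sub>v w"
      unfolding \<Omega>(1) using kernel_vr[of \<Omega> 0, OF \<Omega>(2)] by metis
    then show "v \<in> {res_diff ?F 0 *\<^sub>v w |w. w \<in> Rm 1}"
      unfolding taylor_res_simps(1) One_nat_def by blast
  next
    fix v assume "v \<in> {res_diff ?F 0 *\<^sub>v w |w. w \<in> Rm 1}"
    then obtain w where w: "v = res_diff ?F 0 *\<^sub>v w" "w \<in> Fr (Suc 0)"
      unfolding taylor_res_simps(1) One_nat_def by blast
    obtain \<Omega> where "v = vr 0 \<Omega>" "\<And>S. S \<subseteq> E \<Longrightarrow> \<Omega> S \<in> poly_ring V" "\<And>S. S \<subseteq> E \<Longrightarrow> tdiff \<Omega> S = 0"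
      using image_cycle[OF w(2)] w(1) by blast
    then show "v \<in> {v \<in> Rm 0. res_aug ?F \<bullet> v = 0}"
      using vr_free[of \<Omega> 0] by (simp only: aug_vr taylor_res_simps(1) mem_Collect_eq) auto
  qed
next
  fix i
  show "{v \<in> Rm (Suc i). res_diff ?F i *\<^sub>v v = 0\<^sub>v (res_rank ?F i)} =
    {res_diff ?F (Suc i) *\<^sub>v w |w. w \<in> Rm (Suc (Suc i))}"
  proof (intro equalityI subsetI)
    fix v assume v: "v \<in> {v \<in> Rm (Suc i). res_diff ?F i *\<^sub>v v = 0\<^sub>v (res_rank ?F i)}"
    then have "v \<in> Fr (Suc i)" by simp
    then obtain \<Omega> where \<Omega>: "v = vr (Suc i) \<Omega>" "\<And>S. \<Omega> S \<in> poly_ring V" using free_vr by blast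
    have "vr i (tdiff \<Omega>) = vr i (\<lambda>_. 0)"
      using v unfolding \<Omega>(1) vr_zero by (simp only: mem_Collect_eq diff_vr taylor_res_simps(1))
    then have "tdiff \<Omega> S = 0" if "S \<subseteq> E" "card S = Suc i" for S
      using that unfolding vr_eq_iff by blast
    then obtain w where "w \<in> Fr (Suc (Suc i))" "v = res_diff ?F (Suc i) *\<^sub>v w"
      unfolding \<Omega>(1) using kernel_vr[of \<Omega> "Suc i", OF \<Omega>(2)] by metis
    then show "v \<in> {res_diff ?F (Suc i) *\<^sub>v w |w. w \<in> Rm (Suc (Suc i))}"
      unfolding taylor_res_simps(1) by blast
  next
    fix v assume "v \<in> {res_diff ?F (Suc i) *\<^sub>v w |w. w \<in> Rm (Suc (Suc i))}"
    then obtain w where w: "v = res_diff ?F (Suc i) *\<^sub>v w" "w \<in> Fr (Suc (Suc i))"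
      unfolding taylor_res_simps(1) by blast
    obtain \<Omega> where \<Omega>: "v = vr (Suc i) \<Omega>" "\<And>S. S \<subseteq> E \<Longrightarrow> \<Omega> S \<in> poly_ring V" "\<And>S. S \<subseteq> E \<Longrightarrow> tdiff \<Omega> S = 0"
      using image_cycle[OF w(2)] w(1) by blast
    have "res_diff ?F i *\<^sub>v v = 0\<^sub>v (card (faces i))"
      unfolding \<Omega>(1) diff_vr vr_zero[symmetric] vr_eq_iff using \<Omega>(3) by blast
    then show "v \<in> {v \<in> Rm (Suc i). res_diff ?F i *\<^sub>v v = 0\<^sub>v (res_rank ?F i)}"
      using vr_free[of \<Omega> "Suc i"] \<Omega>(1,2) by (simp only: taylor_res_simps(1) mem_Collect_eq)
  qed
qed

end

section \<open>Edge ideals as monomial ideals, and their Tor\<close>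

lemma var_mult_var:
  assumes "u \<noteq> v"
  shows "var u * var v = (single (ind {u, v}) 1 :: ('v, 'k::field) mpoly)"
  unfolding var_def ind_def using assms by (simp add: mult_single)

text \<open>That a polynomial all of whose monomials are divisible by edges is a combination of the
  generators is the exactness of the Taylor complex at the ring.\<close>

lemma edge_ideal_eq:
  assumes G: "simple_graph G"
  shows "edge_ideal G = (mono_ideal (verts G) (edges G) :: ('v, 'k::field) mpoly set)"
proof -
  let ?V = "verts G" and ?E = "edges G"
  have fV: "finite ?V" and E: "\<And>e. e \<in> ?E \<Longrightarrow> e \<subseteq> ?V" "\<And>e. e \<in> ?E \<Longrightarrow> card e = 2"
    using G unfolding simple_graph_def by auto
  have fe: "finite e" if "e \<in> ?E" for e using E(1)[OF that] fV finite_subset by blast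
  have "?E \<subseteq> Pow ?V" using E(1) by blast
  then have fE: "finite ?E" using fV finite_subset by auto
  obtain \<epsilon> :: "'v set \<Rightarrow> 'v set set \<Rightarrow> 'k" where s: "sign_system ?E \<epsilon>"
    using sign_system_exists[OF fE] by blast
  interpret taylor ?E \<epsilon> ?V by unfold_locales (use fE fe s E in auto)
  define g where "g e = (single (ind e) 1 :: ('v, 'k) mpoly)" for e
  have gens: "{var u * var v |u v. {u, v} \<in> ?E} = g ` ?E"
  proof (intro equalityI subsetI)
    fix p assume "p \<in> {var u * var v :: ('v, 'k) mpoly |u v. {u, v} \<in> ?E}"
    then obtain u v where p: "p = var u * var v" "{u, v} \<in> ?E" by blast
    then have "u \<noteq> v" using E(2)[OF p(2)] by auto
    then show "p \<in> g ` ?E" using p var_mult_var[of u v] unfolding g_def by auto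
  next
    fix p assume "p \<in> g ` ?E"
    then obtain e where e: "e \<in> ?E" "p = g e" by blast
    obtain u v where uv: "e = {u, v}" "u \<noteq> v" using E(2)[OF e(1)] by (auto simp: card_2_iff)
    have "p = var u * var v" "{u, v} \<in> ?E"
      using e uv(1) unfolding g_def var_mult_var[OF uv(2)] by simp_all
    then show "p \<in> {var u * var v |u v. {u, v} \<in> ?E}" by blast
  qed
  have g_inj: "inj_on g ?E"
  proof (rule inj_onI)
    fix e e' assume "e \<in> ?E" "e' \<in> ?E" "g e = g e'"
    then have "keys (g e) = keys (g e')" by simp
    then have "ind e = ind e'" unfolding g_def by simp
    then have "keys (ind e) = keys (ind e')" by simp
    then show "e = e'" using fe \<open>e \<in> ?E\<close> \<open>e' \<in> ?E\<close> by simp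
  qed
  show ?thesis
    unfolding edge_ideal_def ideal_generated_def gens
  proof (intro equalityI subsetI)
    fix p assume "p \<in> {\<Sum>s\<in>T. c s * s |T c. finite T \<and> T \<subseteq> g ` ?E \<and> (\<forall>s\<in>T. c s \<in> poly_ring ?V)}"
    then obtain T c where p: "p = (\<Sum>s\<in>T. c s * s)" "T \<subseteq> g ` ?E" "\<And>s. s \<in> T \<Longrightarrow> c s \<in> poly_ring ?V" by blast
    show "p \<in> mono_ideal ?V ?E"
      unfolding p(1)
    proof (rule mono_ideal_sum)
      fix s assume "s \<in> T"
      then obtain e where "e \<in> ?E" "s = single (ind e) 1" using p(2) unfolding g_def by blast
      then show "c s * s \<in> mono_ideal ?V ?E" using mono_ideal_mult[OF p(3)[OF \<open>s \<in> T\<close>]] E fe by blast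
    qed
  next
    fix p :: "('v, 'k) mpoly" assume "p \<in> mono_ideal ?V ?E"
    then obtain \<eta> where p: "p = tdiff \<eta> {}" and \<eta>: "\<And>S. S \<subseteq> ?E \<Longrightarrow> \<eta> S \<in> poly_ring ?V"
      by (rule mono_ideal_tdiff) blast
    \<comment> \<open>The coefficient of an edge monomial is read off \<eta> at that single edge.
      \<open>ideal_generated\<close> indexes coefficients by generators, hence the inverse of
      \<open>g\<close>.\<close>
    define c where "c s = (let e = the_inv_into ?E g s in single 0 (\<epsilon> e {}) * \<eta> {e})" for s
    have "p = (\<Sum>e\<in>?E. c (g e) * g e)"
      unfolding p tdiff_def
    proof (rule sum.cong)
      fix e assume e: "e \<in> ?E"
      have "c (g e) = single 0 (\<epsilon> e {}) * \<eta> {e}"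
        unfolding c_def the_inv_into_f_f[OF g_inj e] by simp
      moreover have "single (ind e) (\<epsilon> e {}) = single 0 (\<epsilon> e {}) * g e"
        unfolding g_def by (simp add: mult_single)
      ultimately show "single (ind (e - B {})) (\<epsilon> e {}) * \<eta> {e} = c (g e) * g e"
        by (simp add: B_def mult_ac)
    qed simp
    also have "\<dots> = (\<Sum>s\<in>g ` ?E. c s * s)" by (simp add: sum.reindex[OF g_inj])
    finally have "p = (\<Sum>s\<in>g ` ?E. c s * s)" .
    moreover have "c s \<in> poly_ring ?V" if "s \<in> g ` ?E" for s
      using that the_inv_into_f_f[OF g_inj] \<eta> unfolding c_def
      by (auto intro!: poly_ring_mult poly_ring_single)
    ultimately show "p \<in> {\<Sum>s\<in>T. c s * s |T c. finite T \<and> T \<subseteq> g ` ?E \<and> (\<forall>s\<in>T. c s \<in> poly_ring ?V)}"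
      using fE by blast
  qed
qed

lemma edge_ideal_resolution_exists:
  assumes G: "simple_graph G"
  shows "\<exists>F :: ('v, 'k::field) free_resolution. graded_free_resolution (verts G) (edge_ideal G) F"
proof -
  let ?V = "verts G" and ?E = "edges G"
  have fV: "finite ?V" and E: "\<And>e. e \<in> ?E \<Longrightarrow> e \<subseteq> ?V"
    using G unfolding simple_graph_def by auto
  have fe: "finite e" if "e \<in> ?E" for e using E[OF that] fV finite_subset by blast
  have "?E \<subseteq> Pow ?V" using E by blast
  then have fE: "finite ?E" using fV finite_subset by auto
  obtain \<epsilon> :: "'v set \<Rightarrow> 'v set set \<Rightarrow> 'k" where s: "sign_system ?E \<epsilon>"
    using sign_system_exists[OF fE] by blast
  interpret taylor ?E \<epsilon> ?V by unfold_locales (use fE fe s E in auto)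
  show ?thesis using taylor_resolution unfolding edge_ideal_eq[OF G] by blast
qed

theorem Tor_nonzero_edge_ideal_iff:
  assumes G: "simple_graph G" and s: "sign_system (verts G) (\<epsilon> :: 'v \<Rightarrow> 'v set \<Rightarrow> 'k::field)"
  shows "Tor_nonzero (verts G) (edge_ideal G :: ('v, 'k) mpoly set) i j \<longleftrightarrow>
    (\<exists>W p. W \<subseteq> verts G \<and> card W = p + Suc i \<and> int (card W) = j \<and> cohom_nz (csign \<epsilon> W) (edges G) W p)"
proof -
  have fV: "finite (verts G)" and E: "{} \<notin> edges G"
    using G unfolding simple_graph_def by auto
  have "tensor_cycles F i j \<noteq> tensor_boundaries F i j \<longleftrightarrow>
    (\<exists>W p. W \<subseteq> verts G \<and> card W = p + Suc i \<and> int (card W) = j \<and> cohom_nz (csign \<epsilon> W) (edges G) W p)"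
    if "graded_free_resolution (verts G) (edge_ideal G) F" for F :: "('v, 'k) free_resolution"
    using tensor_homology_nz[OF fV s that[unfolded edge_ideal_eq[OF G]] E] .
  then show ?thesis
    unfolding Tor_nonzero_def using edge_ideal_resolution_exists[OF G] by blast
qed

section \<open>Cycles in finite graphs\<close>

lemma nbh_sym: "u \<in> nbh E v \<longleftrightarrow> v \<in> nbh E u"
  unfolding nbh_def by (simp add: insert_commute)

lemma nbh_irrefl: "\<forall>e\<in>E. card e = 2 \<Longrightarrow> v \<notin> nbh E v"
  unfolding nbh_def by fastforce

text \<open>Take a longest path in S. All neighbours in S of its first vertex lie on it, and one of
  them other than the second vertex closes a cycle.\<close>

lemma min_degree_cycle:
  fixes S :: "'v set"
  assumes fin: "finite S" and ne: "S \<noteq> {}" and E: "\<forall>e\<in>E. card e = 2"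
    and deg: "\<And>v. v \<in> S \<Longrightarrow> 2 \<le> card (nbh E v \<inter> S)"
  shows "\<exists>C. cycle_graph C \<and> verts C \<subseteq> S \<and> edges C \<subseteq> E"
proof -
  define P where "P xs \<longleftrightarrow> distinct xs \<and> set xs \<subseteq> S \<and> xs \<noteq> [] \<and>
    (\<forall>i. Suc i < length xs \<longrightarrow> {xs ! i, xs ! Suc i} \<in> E)" for xs
  obtain x where "x \<in> S" using ne by blast
  then have "P [x]" unfolding P_def by auto
  moreover have "\<forall>xs. P xs \<longrightarrow> length xs < Suc (card S)"
    unfolding P_def using card_mono[OF fin] distinct_card by (metis le_imp_less_Suc)
  ultimately obtain xs where xs: "P xs" "\<And>ys. P ys \<Longrightarrow> length ys \<le> length xs"
    using ex_has_greatest_nat[of P "[x]" length "Suc (card S)"] by blast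
  let ?x = "xs ! 0"
  have x0: "?x \<in> S" using xs(1) unfolding P_def by (metis length_greater_0_conv nth_mem subsetD)
  have sub: "nbh E ?x \<inter> S \<subseteq> set xs"
  proof
    fix y assume y: "y \<in> nbh E ?x \<inter> S"
    show "y \<in> set xs"
    proof (rule ccontr)
      assume "y \<notin> set xs"
      then have "P (y # xs)"
        using xs(1) y unfolding P_def nbh_def by (auto simp: nth_Cons split: nat.splits)
      then show False using xs(2)[of "y # xs"] by simp
    qed
  qed
  have "\<not> nbh E ?x \<inter> S \<subseteq> {xs ! 1}"
    using deg[OF x0] card_mono[of "{xs ! 1}" "nbh E ?x \<inter> S"] by auto
  then obtain y where y: "y \<in> nbh E ?x \<inter> S" "y \<noteq> xs ! 1" by blast
  then obtain i where i: "i < length xs" "y = xs ! i" using sub by (metis in_set_conv_nth subsetD)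
  have "i \<noteq> 0" using y i nbh_irrefl[OF E] by (metis IntD1)
  moreover have "i \<noteq> 1" using y i by auto
  ultimately have i2: "2 \<le> i" by simp
  define vs where "vs = take (Suc i) xs"
  have len: "length vs = Suc i" unfolding vs_def using i by simp
  have nth: "vs ! k = xs ! k" if "k \<le> i" for k unfolding vs_def using that by simp
  define C :: "'v sgraph" where
    "C = \<lparr>verts = set vs, edges = {{vs ! i, vs ! (Suc i mod length vs)} | i. i < length vs}\<rparr>"
  have "distinct vs" unfolding vs_def using xs(1) P_def by auto
  then have "cycle_graph C" unfolding cycle_graph_def C_def using len i2 by (intro exI[of _ vs]) auto
  moreover have "verts C \<subseteq> S"
    using xs(1) set_take_subset[of "Suc i" xs] unfolding C_def vs_def P_def by auto
  moreover have "edges C \<subseteq> E"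
  proof
    fix e assume "e \<in> edges C"
    then obtain k where k: "k < Suc i" "e = {vs ! k, vs ! (Suc k mod Suc i)}"
      unfolding C_def using len by auto
    show "e \<in> E"
    proof (cases "k = i")
      case True
      then show ?thesis using k nth[of i] nth[of 0] y i unfolding nbh_def by auto
    next
      case False
      then have "k < i" using k by simp
      then show ?thesis using k nth[of k] nth[of "Suc k"] xs(1) i(1) unfolding P_def by auto
    qed
  qed
  ultimately show ?thesis by blast
qed

lemma finite_edges_within: "finite S \<Longrightarrow> finite {e\<in>E. e \<subseteq> S}"
  by (rule finite_subset[of _ "Pow S"]) auto

text \<open>The edge count of a forest: by \<open>min_degree_cycle\<close> some vertex has degree at
  most one, and its removal loses at most one edge.\<close>

lemma acyclic_card_edges:
  assumes "finite S" "S \<noteq> {}" "\<forall>e\<in>E. card e = 2"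
    and "\<And>C. cycle_graph C \<Longrightarrow> verts C \<subseteq> S \<Longrightarrow> \<not> edges C \<subseteq> E"
  shows "card {e\<in>E. e \<subseteq> S} < card S"
  using assms
proof (induction "card S" arbitrary: S)
  case 0
  then show ?case by simp
next
  case (Suc k)
  have "\<exists>v\<in>S. card (nbh E v \<inter> S) < 2"
    using min_degree_cycle[OF Suc.prems(1,2,3)] Suc.prems(4) by (meson not_le)
  then obtain v where v: "v \<in> S" "card (nbh E v \<inter> S) \<le> 1" by force
  define T where "T = S - {v}"
  have sub: "{e\<in>E. e \<subseteq> S} \<subseteq> {e\<in>E. e \<subseteq> T} \<union> (\<lambda>u. {u, v}) ` (nbh E v \<inter> S)"
  proof
    fix e assume e: "e \<in> {e\<in>E. e \<subseteq> S}"
    show "e \<in> {e\<in>E. e \<subseteq> T} \<union> (\<lambda>u. {u, v}) ` (nbh E v \<inter> S)"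
    proof (cases "v \<in> e")
      case True
      obtain a b where "e = {a, b}" "a \<noteq> b" using e Suc.prems(3) by (auto simp: card_2_iff)
      then obtain u where "e = {u, v}" using True by auto
      then show ?thesis using e unfolding nbh_def by auto
    next
      case False
      then show ?thesis using e unfolding T_def by auto
    qed
  qed
  have cT: "card S = Suc (card T)" unfolding T_def using v Suc.prems(1) by (simp add: card_Suc_Diff1 del: card_Diff_insert)
  have fT: "finite T" unfolding T_def using Suc.prems(1) by simp
  show ?case
  proof (cases "T = {}")
    case True
    then have "S = {v}" using v T_def by auto
    then have "e \<notin> E" if "e \<subseteq> S" for e using that Suc.prems(3) by (metis card.empty card_1_singleton_iff numeral_eq_one_iff One_nat_def semiring_norm(85) subset_singletonD zero_neq_numeral)
    then have "{e\<in>E. e \<subseteq> S} = {}" by auto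
    then have "card {e\<in>E. e \<subseteq> S} = 0" by (simp only: card.empty)
    then show ?thesis using cT by linarith
  next
    case False
    have IH: "card {e\<in>E. e \<subseteq> T} < card T"
    proof (rule Suc.hyps(1))
      show "k = card T" using cT Suc.hyps(2) by simp
      show "\<not> edges C \<subseteq> E" if "cycle_graph C" "verts C \<subseteq> T" for C
        using Suc.prems(4)[OF that(1)] that(2) T_def by auto
    qed (use fT False Suc.prems in auto)
    have "card {e\<in>E. e \<subseteq> S} \<le> card ({e\<in>E. e \<subseteq> T} \<union> (\<lambda>u. {u, v}) ` (nbh E v \<inter> S))"
      by (rule card_mono[OF _ sub]) (use Suc.prems(1) finite_edges_within[OF fT] in auto)
    also have "\<dots> \<le> card {e\<in>E. e \<subseteq> T} + card ((\<lambda>u. {u, v}) ` (nbh E v \<inter> S))"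
      by (rule card_Un_le)
    also have "card ((\<lambda>u. {u, v}) ` (nbh E v \<inter> S)) \<le> 1"
      using card_image_le[of "nbh E v \<inter> S" "\<lambda>u. {u, v}"] Suc.prems(1) v(2) by simp
    finally show ?thesis using IH cT by simp
  qed
qed

lemma sum_degrees:
  assumes fin: "finite S" and E: "\<forall>e\<in>E. card e = 2"
  shows "(\<Sum>v\<in>S. card (nbh E v \<inter> S)) = 2 * card {e\<in>E. e \<subseteq> S}"
proof -
  let ?ES = "{e\<in>E. e \<subseteq> S}"
  have "(\<Sum>v\<in>S. card {e\<in>?ES. v \<in> e}) = (\<Sum>e\<in>?ES. 2)"
  proof (rule sum_multicount_gen[OF fin finite_edges_within[OF fin]], rule ballI)
    fix e assume e: "e \<in> ?ES"
    then have "{v\<in>S. v \<in> e} = e" by auto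
    then show "card {v\<in>S. v \<in> e} = 2" using e E by auto
  qed
  moreover have "card {e\<in>?ES. v \<in> e} = card (nbh E v \<inter> S)" if v: "v \<in> S" for v
  proof -
    have "{e\<in>?ES. v \<in> e} = (\<lambda>u. {u, v}) ` (nbh E v \<inter> S)"
    proof (intro equalityI subsetI)
      fix e assume e: "e \<in> {e\<in>?ES. v \<in> e}"
      obtain a b where "e = {a, b}" "a \<noteq> b" using e E by (auto simp: card_2_iff)
      then obtain u where "e = {u, v}" using e by auto
      then show "e \<in> (\<lambda>u. {u, v}) ` (nbh E v \<inter> S)" using e unfolding nbh_def by auto
    qed (use v in \<open>auto simp: nbh_def\<close>)
    moreover have "inj_on (\<lambda>u. {u, v}) (nbh E v \<inter> S)"
      by (rule inj_onI) (auto simp: doubleton_eq_iff)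
    ultimately show ?thesis by (simp add: card_image)
  qed
  ultimately show ?thesis by simp
qed

section \<open>Cohomology of paths and cycles\<close>

locale chordless_cycle =
  fixes E :: "'v set set" and f :: "nat \<Rightarrow> 'v" and n :: nat
  assumes edge_card: "\<forall>e\<in>E. card e = 2" and inj: "inj_on f {..<n}" and n3: "3 \<le> n"
    and adj: "\<And>i k. i < n \<Longrightarrow> k < n \<Longrightarrow> {f i, f k} \<in> E \<longleftrightarrow> k = Suc i mod n \<or> i = Suc k mod n"

lemma cycle_graph_enum:
  assumes "cycle_graph C"
  obtains f n where "inj_on f {..<n}" "3 \<le> n" "n = card (verts C)" "verts C = f ` {..<n}"
    "\<And>i k. i < n \<Longrightarrow> k < n \<Longrightarrow> {f i, f k} \<in> edges C \<longleftrightarrow> k = Suc i mod n \<or> i = Suc k mod n"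
proof -
  obtain vs where vs: "distinct vs" "3 \<le> length vs" "verts C = set vs"
     "edges C = {{vs ! i, vs ! (Suc i mod length vs)} | i. i < length vs}"
    using assms unfolding cycle_graph_def by blast
  let ?n = "length vs"
  show thesis
  proof (rule that[of "\<lambda>i. vs ! i" ?n])
    show "inj_on (\<lambda>i. vs ! i) {..<?n}" using vs(1) by (simp add: inj_on_nth)
    show "?n = card (verts C)" using vs by (simp add: distinct_card)
    show "verts C = (\<lambda>i. vs ! i) ` {..<?n}" using vs(3) by (auto simp: set_conv_nth)
    show "{vs ! i, vs ! k} \<in> edges C \<longleftrightarrow> k = Suc i mod ?n \<or> i = Suc k mod ?n" if ik: "i < ?n" "k < ?n" for i k
    proof
      assume "{vs ! i, vs ! k} \<in> edges C"
      then obtain m where m: "m < ?n" "{vs ! i, vs ! k} = {vs ! m, vs ! (Suc m mod ?n)}" unfolding vs(4) by blast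
      have "Suc m mod ?n < ?n" using m by (metis mod_less_divisor less_nat_zero_code neq0_conv)
      then show "k = Suc i mod ?n \<or> i = Suc k mod ?n"
        using m ik vs(1) by (auto simp: doubleton_eq_iff nth_eq_iff_index_eq)
    next
      assume "k = Suc i mod ?n \<or> i = Suc k mod ?n"
      then show "{vs ! i, vs ! k} \<in> edges C" unfolding vs(4) using ik by (auto simp: insert_commute)
    qed
  qed (use vs in auto)
qed

text \<open>The first vertex is pendant. Eliminating it with its neighbour and the vertex after that
  leaves a path on three vertices fewer and shifts p by one.\<close>

lemma cohom_nz_path:
  assumes E: "\<forall>e\<in>E. card e = 2" and inj: "inj_on f {a..<a + l}"
    and adj: "\<And>i k. i \<in> {a..<a + l} \<Longrightarrow> k \<in> {a..<a + l} \<Longrightarrow> {f i, f k} \<in> E \<longleftrightarrow> k = Suc i \<or> i = Suc k"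
    and s: "sign_system (f ` {a..<a + l}) \<epsilon>"
  shows "cohom_nz \<epsilon> E (f ` {a..<a + l}) p \<longleftrightarrow>
    (l mod 3 = 0 \<and> p = l div 3) \<or> (l mod 3 = 2 \<and> p = Suc (l div 3))"
  using inj adj s
proof (induction l arbitrary: a p rule: less_induct)
  case (less l)
  let ?W = "f ` {a..<a + l}"
  have E0: "{} \<notin> E" using E by fastforce
  have inj_eq: "f i = f k \<longleftrightarrow> i = k" if "i \<in> {a..<a + l}" "k \<in> {a..<a + l}" for i k
    using less.prems(1) that by (auto dest: inj_onD)
  consider "l = 0" | "l = 1" | "2 \<le> l" by linarith
  then show ?case
  proof cases
    case 1
    then show ?thesis using cohom_nz_empty[of \<epsilon> E p] E0 by simp
  next
    case 2
    have "\<not> cohom_nz \<epsilon> E ?W p"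
      by (rule cohom_nz_isolated[OF _ E less.prems(3), of "f a"]) (use 2 in auto)
    then show ?thesis using 2 by simp
  next
    case 3
    have nb: "nbh E (f i) \<inter> ?W = f ` ({a..<a + l} \<inter> {k. k = Suc i \<or> i = Suc k})" if i: "i \<in> {a..<a + l}" for i
      unfolding nbh_def using less.prems(2)[OF _ i] by auto
    have a: "a \<in> {a..<a + l}" "Suc a \<in> {a..<a + l}" using 3 by auto
    have "{a..<a + l} \<inter> {k. k = Suc a \<or> a = Suc k} = {Suc a}" using 3 by auto
    then have n1: "nbh E (f a) \<inter> ?W = {f (Suc a)}" using nb[OF a(1)] by simp
    \<comment> \<open>Truncated subtraction: l = 2 also leads to the empty path, although only two
      vertices are removed. This is the source of the extra one for residue 2.\<close>
    define l' where "l' = l - 3"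
    have sub: "{a + 3..<a + 3 + l'} \<subseteq> {a..<a + l}" unfolding l'_def by auto
    have "?W - insert (f (Suc a)) (nbh E (f (Suc a))) = ?W - insert (f (Suc a)) (nbh E (f (Suc a)) \<inter> ?W)" by auto
    also have "\<dots> = f ` ({a..<a + l} - insert (Suc a) {k. k = Suc (Suc a) \<or> Suc a = Suc k})"
      unfolding nb[OF a(2)] using a inj_eq by auto
    also have "{a..<a + l} - insert (Suc a) {k. k = Suc (Suc a) \<or> Suc a = Suc k} = {a + 3..<a + 3 + l'}"
      unfolding l'_def by auto
    finally have W': "?W - insert (f (Suc a)) (nbh E (f (Suc a))) = f ` {a + 3..<a + 3 + l'}" .
    have "cohom_nz \<epsilon> E ?W p \<longleftrightarrow> (\<exists>q. p = Suc q \<and> cohom_nz \<epsilon> E (f ` {a + 3..<a + 3 + l'}) q)"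
      using cohom_nz_pendant[OF _ E less.prems(3) _ _ _ n1, of p] a inj_eq unfolding W' by auto
    also have "\<dots> \<longleftrightarrow> (\<exists>q. p = Suc q \<and> ((l' mod 3 = 0 \<and> q = l' div 3) \<or> (l' mod 3 = 2 \<and> q = Suc (l' div 3))))"
    proof -
      have "cohom_nz \<epsilon> E (f ` {a + 3..<a + 3 + l'}) q \<longleftrightarrow>
          (l' mod 3 = 0 \<and> q = l' div 3) \<or> (l' mod 3 = 2 \<and> q = Suc (l' div 3))" for q
      proof (rule less.IH)
        show "l' < l" unfolding l'_def using 3 by simp
        show "inj_on f {a + 3..<a + 3 + l'}" using less.prems(1) sub inj_on_subset by blast
        show "{f i, f k} \<in> E \<longleftrightarrow> k = Suc i \<or> i = Suc k"
          if "i \<in> {a + 3..<a + 3 + l'}" "k \<in> {a + 3..<a + 3 + l'}" for i k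
          using less.prems(2) that sub by blast
        show "sign_system (f ` {a + 3..<a + 3 + l'}) \<epsilon>"
          by (rule sign_system_subset[OF less.prems(3)]) (use sub in auto)
      qed
      then show ?thesis by simp
    qed
    also have "\<dots> \<longleftrightarrow> (l mod 3 = 0 \<and> p = l div 3) \<or> (l mod 3 = 2 \<and> p = Suc (l div 3))"
    proof (cases "l = 2")
      case True
      then show ?thesis unfolding l'_def by auto
    next
      case False
      then have "l = l' + 3" using 3 unfolding l'_def by simp
      then show ?thesis by auto
    qed
    finally show ?thesis .
  qed
qed

context chordless_cycle
begin

lemma adj_path:
  assumes "1 \<le> a" "a + l \<le> n" "i \<in> {a..<a + l}" "k \<in> {a..<a + l}"
  shows "{f i, f k} \<in> E \<longleftrightarrow> k = Suc i \<or> i = Suc k"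
proof -
  have "Suc i mod n = (if Suc i = n then 0 else Suc i)" "Suc k mod n = (if Suc k = n then 0 else Suc k)"
    using assms by auto
  then show ?thesis using adj[of i k] assms by auto
qed

lemma cohom_nz_arc:
  assumes "1 \<le> a" "a + l \<le> n" "sign_system (f ` {..<n}) \<epsilon>"
  shows "cohom_nz \<epsilon> E (f ` {a..<a + l}) p \<longleftrightarrow>
    (l mod 3 = 0 \<and> p = l div 3) \<or> (l mod 3 = 2 \<and> p = Suc (l div 3))"
proof (rule cohom_nz_path[OF edge_card _ adj_path[OF assms(1,2)]])
  have sub: "{a..<a + l} \<subseteq> {..<n}" using assms by auto
  show "inj_on f {a..<a + l}" using inj_on_subset[OF inj sub] .
  show "sign_system (f ` {a..<a + l}) \<epsilon>" by (rule sign_system_subset[OF assms(3)]) (use sub in auto)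
qed

lemma inj_eq: "i < n \<Longrightarrow> k < n \<Longrightarrow> f i = f k \<longleftrightarrow> i = k"
  using inj by (auto dest: inj_onD)

lemma delete_0: "f ` {..<n} - {f 0} = f ` {1..<1 + (n - 1)}"
proof -
  have "f ` {..<n} - {f 0} = f ` ({..<n} - {0})" using n3 inj_eq by auto
  also have "{..<n} - {0} = {1..<1 + (n - 1)}" using n3 by auto
  finally show ?thesis .
qed

lemma link_0: "f ` {..<n} - insert (f 0) (nbh E (f 0)) = f ` {2..<2 + (n - 3)}"
proof -
  have "i \<in> {..<n} \<Longrightarrow> f i \<in> nbh E (f 0) \<longleftrightarrow> i = 1 \<or> i = n - 1" for i
    using adj[of i 0] n3 unfolding nbh_def by (cases "Suc i = n") auto
  then have "f ` {..<n} - insert (f 0) (nbh E (f 0)) = f ` ({..<n} - {0, 1, n - 1})"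
    using n3 inj_eq by auto
  also have "{..<n} - {0, 1, n - 1} = {2..<2 + (n - 3)}" using n3 by auto
  finally show ?thesis .
qed

text \<open>Deleting a vertex leaves a path on n - 1 vertices, and its link is a path on n - 3
  vertices. For residue 2 the deletion is acyclic and the link has cohomology at n div 3; for
  residue 1 the link is acyclic; for residue 0 both can contribute only at n div 3.\<close>

lemma cohom_nz_cycle:
  assumes s: "sign_system (f ` {..<n}) \<epsilon>"
  shows "cohom_nz \<epsilon> E (f ` {..<n}) p \<Longrightarrow> p = (if n mod 3 = 2 then Suc (n div 3) else n div 3)"
    and "n mod 3 = 2 \<Longrightarrow> cohom_nz \<epsilon> E (f ` {..<n}) (Suc (n div 3))"
proof -
  interpret vertex_deletion \<epsilon> E "f ` {..<n}" "f 0"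
    by unfold_locales (use s edge_card n3 in auto)
  have del: "cohom_nz \<epsilon> E (f ` {..<n} - {f 0}) p \<longleftrightarrow>
      ((n - 1) mod 3 = 0 \<and> p = (n - 1) div 3) \<or> ((n - 1) mod 3 = 2 \<and> p = Suc ((n - 1) div 3))" for p
    unfolding delete_0 by (rule cohom_nz_arc[OF _ _ s]) (use n3 in auto)
  have lnk: "cohom_nz \<epsilon> E (f ` {..<n} - insert (f 0) (nbh E (f 0))) p \<longleftrightarrow>
      ((n - 3) mod 3 = 0 \<and> p = (n - 3) div 3) \<or> ((n - 3) mod 3 = 2 \<and> p = Suc ((n - 3) div 3))" for p
    unfolding link_0 by (rule cohom_nz_arc[OF _ _ s]) (use n3 in auto)
  obtain m where m: "n = m + 3" using n3 by (metis le_add_diff_inverse2)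
  have m_cases: "m mod 3 = 0 \<or> m mod 3 = 1 \<or> m mod 3 = 2" by linarith
  have n1: "(n - 1) mod 3 = (m + 2) mod 3" "(n - 1) div 3 = (m + 2) div 3" unfolding m by simp_all
  {
    assume "cohom_nz \<epsilon> E (f ` {..<n}) p"
    then have "cohom_nz \<epsilon> E (f ` {..<n} - {f 0}) p \<or>
       (\<exists>q. p = Suc q \<and> cohom_nz \<epsilon> E (f ` {..<n} - insert (f 0) (nbh E (f 0))) q)"
      by (rule nz_cases)
    then show "p = (if n mod 3 = 2 then Suc (n div 3) else n div 3)"
      unfolding del lnk n1 unfolding m using m_cases by auto presburger+
  next
    assume n2: "n mod 3 = 2"
    show "cohom_nz \<epsilon> E (f ` {..<n}) (Suc (n div 3))"
    proof (rule nz_link)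
      show "cohom_nz \<epsilon> E (f ` {..<n} - insert (f 0) (nbh E (f 0))) (n div 3)"
        unfolding lnk using n2 unfolding m by auto
      show "\<not> cohom_nz \<epsilon> E (f ` {..<n} - {f 0}) (n div 3)"
        unfolding del n1 using n2 unfolding m by presburger
    qed
  }
qed

end

section \<open>Matchings in unicyclic graphs\<close>

lemma card_1_eq: "card A = 1 \<Longrightarrow> w \<in> A \<Longrightarrow> A = {w}"
  by (metis card_1_singletonE singletonD)

lemma degree_in_cycle:
  assumes C: "cycle_graph C" and u: "u \<in> verts C" and E: "\<forall>e\<in>edges C. card e = 2"
  shows "2 \<le> card (nbh (edges C) u \<inter> verts C)"
proof -
  obtain f n where f: "inj_on f {..<n}" "3 \<le> n" "n = card (verts C)" "verts C = f ` {..<n}"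
    "\<And>i k. i < n \<Longrightarrow> k < n \<Longrightarrow> {f i, f k} \<in> edges C \<longleftrightarrow> k = Suc i mod n \<or> i = Suc k mod n"
    by (rule cycle_graph_enum[OF C], rule that; assumption)
  obtain i where i: "i < n" "u = f i" using u f(4) by auto
  define a where "a = Suc i mod n"
  define b where "b = (if i = 0 then n - 1 else i - 1)"
  have ab: "a < n" "b < n" "Suc b mod n = i" using i f(2) unfolding a_def b_def by auto
  have "a \<noteq> b"
    using i f(2) unfolding a_def b_def by (cases "Suc i = n") auto
  then have "f a \<noteq> f b" using f(1) ab by (auto dest: inj_onD)
  moreover have "{f a, f b} \<subseteq> nbh (edges C) u \<inter> verts C"
    using f(5)[OF ab(1) i(1)] f(5)[OF ab(2) i(1)] ab i(1) f(4) unfolding nbh_def i(2) a_def by auto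
  moreover have "finite (verts C)" unfolding f(4) by simp
  ultimately show ?thesis using card_mono[of "nbh (edges C) u \<inter> verts C" "{f a, f b}"] by auto
qed

locale unicyclic_graph =
  fixes G :: "'v sgraph" and C :: "'v sgraph"
  assumes simple: "simple_graph G" and unic: "cycles G = {C}"
begin

abbreviation "V \<equiv> verts G"
abbreviation "E \<equiv> edges G"

lemma finite_V: "finite V" and E_sub: "e \<in> E \<Longrightarrow> e \<subseteq> V" and E_card: "\<forall>e\<in>E. card e = 2"
  using simple unfolding simple_graph_def by auto

lemma finite_E: "finite E"
proof -
  have "E \<subseteq> Pow V" using E_sub by blast
  then show ?thesis using finite_V finite_subset by auto
qed

lemma C_props: "cycle_graph C" "verts C \<subseteq> V" "edges C \<subseteq> E"
proof -
  have "C \<in> cycles G" using unic by simp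
  then show "cycle_graph C" "verts C \<subseteq> V" "edges C \<subseteq> E" unfolding cycles_def subgraph_def by auto
qed

lemma C_unique: "cycle_graph D \<Longrightarrow> verts D \<subseteq> V \<Longrightarrow> edges D \<subseteq> E \<Longrightarrow> D = C"
  using unic unfolding cycles_def subgraph_def by blast

lemma edgeE:
  assumes "e \<in> E" "v \<in> e"
  obtains u where "e = {u, v}" "u \<noteq> v" "u \<in> nbh E v"
proof -
  obtain a b where "e = {a, b}" "a \<noteq> b" using assms E_card by (auto simp: card_2_iff)
  then obtain u where "e = {u, v}" "u \<noteq> v" using assms(2) by auto
  then show thesis using that assms(1) unfolding nbh_def by auto
qed

text \<open>Without one edge of C the set S carries a forest, so S spans at most as many edges as
  vertices and all degrees are exactly 2. Vertices of C then have all their neighbours in S on C, so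
  the rest of S would again have minimum degree 2 and, if nonempty, contain C, which is
  absurd.\<close>

lemma min_degree_two_is_cycle:
  assumes S: "S \<subseteq> V" "S \<noteq> {}" and deg: "\<And>v. v \<in> S \<Longrightarrow> 2 \<le> card (nbh E v \<inter> S)"
  shows "S = verts C \<and> (\<forall>u\<in>S. \<forall>v\<in>S. {u, v} \<in> E \<longrightarrow> {u, v} \<in> edges C)"
proof -
  have fS: "finite S" using S(1) finite_V by (meson finite_subset order_trans)
  have C_in: "verts C \<subseteq> T" if T: "T \<subseteq> S" "T \<noteq> {}" "\<And>v. v \<in> T \<Longrightarrow> 2 \<le> card (nbh E v \<inter> T)" for T
  proof -
    have "finite T" using T(1) fS by (meson finite_subset order_trans)
    then obtain D where D: "cycle_graph D" "verts D \<subseteq> T" "edges D \<subseteq> E"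
      using min_degree_cycle[OF _ T(2) E_card T(3)] by blast
    then have "D = C" using C_unique T(1) S(1) by blast
    then show ?thesis using D by simp
  qed
  have CS: "verts C \<subseteq> S" using C_in[of S] S deg by blast
  have EC: "\<forall>e\<in>edges C. card e = 2" using E_card C_props(3) by blast
  obtain f n where f: "inj_on f {..<n}" "3 \<le> n" "n = card (verts C)" "verts C = f ` {..<n}"
    "\<And>i k. i < n \<Longrightarrow> k < n \<Longrightarrow> {f i, f k} \<in> edges C \<longleftrightarrow> k = Suc i mod n \<or> i = Suc k mod n"
    by (rule cycle_graph_enum[OF C_props(1)], rule that; assumption)
  define e0 where "e0 = {f 0, f 1}"
  have e0: "e0 \<in> edges C" unfolding e0_def using f(5)[of 0 1] f(2) by simp
  have e0E: "e0 \<in> E" "e0 \<subseteq> S"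
    using e0 C_props(3) CS f(2,4) unfolding e0_def by auto
  have "card {e\<in>E - {e0}. e \<subseteq> S} < card S"
  proof (rule acyclic_card_edges[OF fS S(2)])
    show "\<forall>e\<in>E - {e0}. card e = 2" using E_card by auto
    fix D assume "cycle_graph D" "verts D \<subseteq> S"
    then show "\<not> edges D \<subseteq> E - {e0}" using C_unique[of D] S(1) e0 by blast
  qed
  moreover have "{e\<in>E. e \<subseteq> S} = insert e0 {e\<in>E - {e0}. e \<subseteq> S}" using e0E by auto
  moreover have "finite {e\<in>E - {e0}. e \<subseteq> S}" using finite_E by auto
  ultimately have "card {e\<in>E. e \<subseteq> S} \<le> card S" by simp
  then have le: "(\<Sum>v\<in>S. card (nbh E v \<inter> S)) \<le> (\<Sum>v\<in>S. 2)"
    using sum_degrees[OF fS E_card] by simp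
  have deg2: "card (nbh E v \<inter> S) = 2" if "v \<in> S" for v
  proof (rule ccontr)
    assume "card (nbh E v \<inter> S) \<noteq> 2"
    then have "(\<Sum>v\<in>S. 2) < (\<Sum>v\<in>S. card (nbh E v \<inter> S))"
      using deg that by (intro sum_strict_mono_ex1[OF fS]) (auto intro!: bexI[of _ v] simp: le_neq_implies_less)
    then show False using le by simp
  qed
  have nb: "nbh E u \<inter> S = nbh (edges C) u \<inter> verts C" if u: "u \<in> verts C" for u
  proof (rule sym, rule card_seteq)
    show "nbh (edges C) u \<inter> verts C \<subseteq> nbh E u \<inter> S" using C_props(3) CS unfolding nbh_def by auto
    show "card (nbh E u \<inter> S) \<le> card (nbh (edges C) u \<inter> verts C)"
      using deg2[of u] degree_in_cycle[OF C_props(1) u EC] u CS by auto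
  qed (use fS in simp)
  have "S - verts C = {}"
  proof (rule ccontr)
    assume ne: "S - verts C \<noteq> {}"
    have "nbh E v \<inter> S = nbh E v \<inter> (S - verts C)" if v: "v \<in> S - verts C" for v
      using nb v nbh_sym[of _ E v] by blast
    then have "2 \<le> card (nbh E v \<inter> (S - verts C))" if "v \<in> S - verts C" for v
      using deg[of v] that by auto
    then have "verts C \<subseteq> S - verts C" using C_in[of "S - verts C"] ne by blast
    moreover have "verts C \<noteq> {}" using f(2,4) by (auto simp: lessThan_empty_iff)
    ultimately show False by blast
  qed
  then have "S = verts C" using CS by blast
  moreover have "{u, v} \<in> edges C" if "u \<in> S" "v \<in> S" "{u, v} \<in> E" for u v
    using nb[of v] that calculation unfolding nbh_def by blast
  ultimately show ?thesis by blast
qed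

text \<open>The previous lemma applied to the vertices of C themselves: a chord would raise a degree
  above 2.\<close>

lemma C_induced:
  assumes "u \<in> verts C" "v \<in> verts C" "{u, v} \<in> E"
  shows "{u, v} \<in> edges C"
proof -
  have EC: "\<forall>e\<in>edges C. card e = 2" using E_card C_props(3) by blast
  have fC: "finite (verts C)" using C_props(2) finite_V by (meson finite_subset order_trans)
  have "2 \<le> card (nbh E w \<inter> verts C)" if w: "w \<in> verts C" for w
  proof -
    have "nbh (edges C) w \<inter> verts C \<subseteq> nbh E w \<inter> verts C" using C_props(3) unfolding nbh_def by auto
    then have "card (nbh (edges C) w \<inter> verts C) \<le> card (nbh E w \<inter> verts C)"
      using fC by (intro card_mono) auto
    then show ?thesis using degree_in_cycle[OF C_props(1) w EC] by simp
  qed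
  then show ?thesis
    using min_degree_two_is_cycle[OF C_props(2)] assms by blast
qed

lemma C_enum:
  obtains f n where "chordless_cycle E f n" "n = card (verts C)" "verts C = f ` {..<n}"
proof -
  obtain f n where f: "inj_on f {..<n}" "3 \<le> n" "n = card (verts C)" "verts C = f ` {..<n}"
    "\<And>i k. i < n \<Longrightarrow> k < n \<Longrightarrow> {f i, f k} \<in> edges C \<longleftrightarrow> k = Suc i mod n \<or> i = Suc k mod n"
    by (rule cycle_graph_enum[OF C_props(1)], rule that; assumption)
  have "chordless_cycle E f n"
  proof
    show "\<forall>e\<in>E. card e = 2" "inj_on f {..<n}" "3 \<le> n" by (fact E_card f)+
    show "{f i, f k} \<in> E \<longleftrightarrow> k = Suc i mod n \<or> i = Suc k mod n" if "i < n" "k < n" for i k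
      using f(5)[OF that] C_induced[of "f i" "f k"] C_props(3) that f(4) by blast
  qed
  then show thesis using that f(3,4) by blast
qed

text \<open>Each edge of M is a component of the induced graph, so either end is pendant;
  eliminating it removes precisely this edge and lowers p by one.\<close>

lemma cohom_nz_matching:
  assumes "finite M" "M \<subseteq> E" "pairwise disjnt M" "finite X" "\<Union>M \<inter> X = {}"
    and "\<And>e u. e \<in> M \<Longrightarrow> u \<in> e \<Longrightarrow> nbh E u \<inter> (\<Union>M \<union> X) \<subseteq> e"
    and "sign_system (\<Union>M \<union> X) \<epsilon>"
  shows "cohom_nz \<epsilon> E (\<Union>M \<union> X) p \<longleftrightarrow> (\<exists>q. p = card M + q \<and> cohom_nz \<epsilon> E X q)"
  using assms
proof (induction M arbitrary: p rule: finite_induct)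
  case empty
  then show ?case by simp
next
  case (insert e M)
  let ?W = "\<Union>(insert e M) \<union> X" and ?W' = "\<Union>M \<union> X"
  have eE: "e \<in> E" using insert.prems by simp
  obtain u w where e: "e = {u, w}" "u \<noteq> w" using eE E_card by (auto simp: card_2_iff)
  have dis: "e \<inter> d = {}" if "d \<in> M" for d
    using insert.prems(2) insert.hyps(2) that unfolding pairwise_def disjnt_def by (metis insertI1 insertI2)
  have eW': "e \<inter> ?W' = {}" using dis insert.prems(4) by auto
  have nu: "w \<in> nbh E u" "u \<in> nbh E w" using eE unfolding e nbh_def by (auto simp: insert_commute)
  have u1: "nbh E u \<inter> ?W = {w}"
    using insert.prems(5)[of e u] nu(1) nbh_irrefl[OF E_card, of u] e by auto
  have w1: "nbh E w \<inter> ?W \<subseteq> {u}"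
    using insert.prems(5)[of e w] nbh_irrefl[OF E_card, of w] e by auto
  have W': "?W - insert w (nbh E w) = ?W'"
    using w1 nu(2) eW' unfolding e by auto
  have "\<Union>(insert e M) \<subseteq> V" using insert.prems(1) E_sub by blast
  then have "finite (\<Union>(insert e M))" using finite_V by (rule finite_subset)
  then have finW: "finite ?W" using insert.prems(3) by simp
  have "cohom_nz \<epsilon> E ?W p \<longleftrightarrow> (\<exists>q. p = Suc q \<and> cohom_nz \<epsilon> E ?W' q)"
    using cohom_nz_pendant[OF finW E_card insert.prems(6) _ _ e(2) u1, of p] e unfolding W' by auto
  also have "\<dots> \<longleftrightarrow> (\<exists>q. p = Suc q \<and> (\<exists>r. q = card M + r \<and> cohom_nz \<epsilon> E X r))"
  proof -
    have "cohom_nz \<epsilon> E ?W' q \<longleftrightarrow> (\<exists>r. q = card M + r \<and> cohom_nz \<epsilon> E X r)" for q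
    proof (rule insert.IH)
      show "pairwise disjnt M" using insert.prems(2) unfolding pairwise_def by blast
      show "sign_system ?W' \<epsilon>" by (rule sign_system_subset[OF insert.prems(6)]) auto
      show "nbh E v \<inter> ?W' \<subseteq> d" if "d \<in> M" "v \<in> d" for d v
        using insert.prems(5)[of d v] that by auto
    qed (use insert.prems in auto)
    then show ?thesis by simp
  qed
  also have "\<dots> \<longleftrightarrow> (\<exists>q. p = card (insert e M) + q \<and> cohom_nz \<epsilon> E X q)"
    using insert.hyps by auto
  finally show ?case .
qed

text \<open>An inclusion-minimal vertex set with nonvanishing cohomology admits no fold and has no
  isolated vertex, so it is the disjoint union of an induced matching and possibly the cycle.\<close>

lemma cohom_nz_reduce:
  assumes W: "W \<subseteq> V" and s: "sign_system W \<epsilon>" and nz: "cohom_nz \<epsilon> E W p"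
  obtains M X q where "M \<subseteq> E" "pairwise disjnt M" "\<Union>M \<union> X \<subseteq> W" "\<Union>M \<inter> X = {}"
    "\<And>e u. e \<in> M \<Longrightarrow> u \<in> e \<Longrightarrow> nbh E u \<inter> (\<Union>M \<union> X) \<subseteq> e"
    "X = {} \<or> X = verts C" "p = card M + q" "cohom_nz \<epsilon> E X q"
proof -
  \<comment> \<open>Minimality is among the vertex sets with cohomology at this same p, so both a
    fold and an isolated vertex contradict it or the nonvanishing.\<close>
  define P where "P k \<longleftrightarrow> (\<exists>U\<subseteq>W. card U = k \<and> cohom_nz \<epsilon> E U p)" for k
  have "P (card W)" unfolding P_def using nz by blast
  then have "P (LEAST k. P k)" by (rule LeastI)
  then obtain U where U: "U \<subseteq> W" "cohom_nz \<epsilon> E U p" "card U = (LEAST k. P k)"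
    using P_def[of "LEAST k. P k"] by auto
  have min: "\<not> cohom_nz \<epsilon> E T p" if "T \<subset> U" for T
  proof
    assume "cohom_nz \<epsilon> E T p"
    then have "P (card T)" unfolding P_def using that U(1) by blast
    moreover have "U \<subseteq> V" using U(1) W by simp
    then have "card T < card U"
      by (intro psubset_card_mono[OF _ that] finite_subset[OF _ finite_V])
    ultimately show False unfolding U(3) using not_less_Least[of "card T" P] by simp
  qed
  have fU: "finite U" using U(1) W finite_V by (meson finite_subset order_trans)
  have sU: "sign_system U \<epsilon>" using sign_system_subset[OF s U(1)] .
  note irr = nbh_irrefl[OF E_card]
  have noniso: "nbh E v \<inter> U \<noteq> {}" if "v \<in> U" for v
    using cohom_nz_isolated[OF fU E_card sU that] U(2) by blast
  have nofold: "\<not> nbh E u \<inter> U \<subseteq> nbh E v" if "u \<in> U" "v \<in> U" "u \<noteq> v" for u v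
    using cohom_nz_fold[OF fU E_card sU that] U(2) min[of "U - {v}"] that by blast
  define L where "L = {v\<in>U. card (nbh E v \<inter> U) = 1}"
  define X where "X = U - L"
  \<comment> \<open>A second neighbour v of w would satisfy nbh u = {w} inside nbh v within U, so v
    could be folded away. Hence the neighbour of a leaf is a leaf.\<close>
  have leaf: "nbh E w \<inter> U = {u}" if "u \<in> L" "w \<in> nbh E u \<inter> U" for u w
  proof -
    have u: "u \<in> U" "nbh E u \<inter> U = {w}"
      using that(1) card_1_eq[OF _ that(2)] unfolding L_def by auto
    have "v = u" if "v \<in> nbh E w \<inter> U" for v
    proof (rule ccontr)
      assume "v \<noteq> u"
      then have "\<not> nbh E u \<inter> U \<subseteq> nbh E v" using nofold[OF u(1), of v] that by auto
      moreover have "w \<in> nbh E v" using that nbh_sym[of v E w] by simp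
      ultimately show False using u(2) by simp
    qed
    moreover have "u \<in> nbh E w" using that(2) nbh_sym[of u E w] by blast
    ultimately show ?thesis using u(1) by blast
  qed
  define M where "M = {e\<in>E. e \<subseteq> L}"
  have UM: "\<Union>M = L"
  proof (intro equalityI subsetI)
    fix u assume u: "u \<in> L"
    then have uU: "u \<in> U" unfolding L_def by simp
    obtain w where w: "w \<in> nbh E u \<inter> U" using noniso[OF uU] by blast
    have "w \<in> L" using leaf[OF u w] w unfolding L_def by simp
    then have "{w, u} \<in> M" using u w unfolding M_def nbh_def by auto
    then show "u \<in> \<Union>M" by blast
  qed (auto simp: M_def)
  have LU: "\<Union>M \<union> X = U" unfolding UM X_def L_def by auto
  have cl: "nbh E u \<inter> U \<subseteq> e" if e: "e \<in> M" "u \<in> e" for e u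
  proof -
    have eE: "e \<in> E" using e unfolding M_def by auto
    obtain w where w: "e = {w, u}" "w \<noteq> u" "w \<in> nbh E u" by (rule edgeE[OF eE e(2)])
    have "card (nbh E u \<inter> U) = 1" "w \<in> U" using e w unfolding M_def L_def by auto
    then have "nbh E u \<inter> U = {w}" using w(3) by (intro card_1_eq) auto
    then show ?thesis using w by auto
  qed
  have disM: "pairwise disjnt M"
  proof (rule pairwiseI)
    fix e d assume ed: "e \<in> M" "d \<in> M" "e \<noteq> d"
    show "disjnt e d"
    proof (rule ccontr)
      assume "\<not> disjnt e d"
      then obtain u where u: "u \<in> e" "u \<in> d" unfolding disjnt_def by blast
      have eE: "e \<in> E" "d \<in> E" using ed unfolding M_def by auto
      obtain a where a: "e = {a, u}" "a \<noteq> u" "a \<in> nbh E u" by (rule edgeE[OF eE(1) u(1)])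
      obtain b where b: "d = {b, u}" "b \<noteq> u" "b \<in> nbh E u" by (rule edgeE[OF eE(2) u(2)])
      have "b \<in> U" using ed b unfolding M_def L_def by auto
      then have "b = a" using cl[OF ed(1) u(1)] a b by blast
      then show False using a b ed by simp
    qed
  qed
  \<comment> \<open>A vertex of X has a neighbour in U but is not a leaf, so it has at least two.
    None of them is in L, because a leaf can only be adjacent to a leaf.\<close>
  have Xdeg: "2 \<le> card (nbh E v \<inter> X)" if v: "v \<in> X" for v
  proof -
    have vU: "v \<in> U" "v \<notin> L" using v unfolding X_def by auto
    have "w \<notin> L" if "w \<in> nbh E v \<inter> U" for w
    proof
      assume "w \<in> L"
      then have "nbh E v \<inter> U = {w}" using leaf[of w v] that vU nbh_sym[of v E w] by blast
      then show False using vU unfolding L_def by simp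
    qed
    then have "nbh E v \<inter> U = nbh E v \<inter> X" unfolding X_def by blast
    moreover have "card (nbh E v \<inter> U) \<noteq> 0" using noniso[OF vU(1)] fU by auto
    moreover have "card (nbh E v \<inter> U) \<noteq> 1" using vU unfolding L_def by simp
    ultimately show ?thesis by simp
  qed
  have XV: "X \<subseteq> V" using U(1) W unfolding X_def by blast
  have X: "X = {} \<or> X = verts C"
    using min_degree_two_is_cycle[OF XV _ Xdeg] by blast
  have ME: "M \<subseteq> E" unfolding M_def by blast
  have fM: "finite M" using ME finite_E by (meson finite_subset)
  have fX: "finite X" unfolding X_def using fU by simp
  have MX: "\<Union>M \<inter> X = {}" unfolding UM X_def by blast
  have "cohom_nz \<epsilon> E (\<Union>M \<union> X) p \<longleftrightarrow> (\<exists>q. p = card M + q \<and> cohom_nz \<epsilon> E X q)"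
    by (rule cohom_nz_matching[OF fM ME disM fX MX]) (use cl sU in \<open>auto simp: LU\<close>)
  then obtain q where q: "p = card M + q" "cohom_nz \<epsilon> E X q" using U(2) LU by auto
  show thesis
    by (rule that[OF ME disM _ MX _ X q]) (use LU U(1) cl in auto)
qed

lemma induced_matching_iff:
  "induced_matching G M \<longleftrightarrow> M \<subseteq> E \<and> pairwise disjnt M \<and> (\<forall>e\<in>E. e \<subseteq> \<Union>M \<longrightarrow> e \<in> M)"
  unfolding induced_matching_def induced_subgraph_def by auto

lemma induced_matching_sub_iff:
  "induced_matching (induced_subgraph G S) M \<longleftrightarrow> induced_matching G M \<and> \<Union>M \<subseteq> S"
proof -
  have "M \<subseteq> {e\<in>E. e \<subseteq> S} \<longleftrightarrow> M \<subseteq> E \<and> \<Union>M \<subseteq> S" by blast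
  moreover have "{e\<in>{e\<in>E. e \<subseteq> S}. e \<subseteq> \<Union>M} = {e\<in>E. e \<subseteq> \<Union>M}" if "\<Union>M \<subseteq> S"
    using that by blast
  ultimately show ?thesis
    unfolding induced_matching_def induced_subgraph_def by (cases "\<Union>M \<subseteq> S") simp_all
qed

lemma finite_matchings: "finite {card M | M. induced_matching G M \<and> \<Union>M \<subseteq> S}"
proof (rule finite_subset)
  show "{card M | M. induced_matching G M \<and> \<Union>M \<subseteq> S} \<subseteq> card ` Pow E"
    unfolding induced_matching_def by auto
qed (use finite_E in auto)

lemma number_sub_eq:
  "induced_matching_number (induced_subgraph G S) = Max {card M | M. induced_matching G M \<and> \<Union>M \<subseteq> S}"
  unfolding induced_matching_number_def induced_matching_sub_iff ..

lemma number_sub_ge: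
  "induced_matching G M \<Longrightarrow> \<Union>M \<subseteq> S \<Longrightarrow> card M \<le> induced_matching_number (induced_subgraph G S)"
  unfolding number_sub_eq by (rule Max_ge[OF finite_matchings]) blast

lemma number_sub_attained:
  obtains M where "induced_matching G M" "\<Union>M \<subseteq> S" "card M = induced_matching_number (induced_subgraph G S)"
proof -
  have "induced_matching G {}" unfolding induced_matching_iff using E_card by auto
  then have "{card M | M. induced_matching G M \<and> \<Union>M \<subseteq> S} \<noteq> {}" by blast
  then have "Max {card M | M. induced_matching G M \<and> \<Union>M \<subseteq> S} \<in> {card M | M. induced_matching G M \<and> \<Union>M \<subseteq> S}"
    by (rule Max_in[OF finite_matchings])
  then obtain M where "induced_matching G M" "\<Union>M \<subseteq> S"
    "Max {card M | M. induced_matching G M \<and> \<Union>M \<subseteq> S} = card M" by blast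
  then show thesis using that[of M] unfolding number_sub_eq by simp
qed

lemma induced_subgraph_V: "induced_matching_number (induced_subgraph G V) = induced_matching_number G"
proof -
  have "induced_matching G M \<and> \<Union>M \<subseteq> V \<longleftrightarrow> induced_matching G M" for M
    using E_sub unfolding induced_matching_iff by blast
  then show ?thesis using number_sub_eq[of V] unfolding induced_matching_number_def[of G] by simp
qed

lemma number_ge: "induced_matching G M \<Longrightarrow> card M \<le> induced_matching_number G"
  using number_sub_ge[of M V] E_sub unfolding induced_subgraph_V induced_matching_iff by blast

lemma number_sub_le: "induced_matching_number (induced_subgraph G S) \<le> induced_matching_number G"
  using number_sub_attained[of S] number_ge by metis

text \<open>By \<open>cl\<close> an edge inside the union that meets \<open>\<Union>M\<close> is one
  of the edges of M; every other edge lies inside \<open>\<Union>N\<close>.\<close>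

lemma induced_matching_union:
  assumes M: "M \<subseteq> E" "pairwise disjnt M" "\<Union>M \<inter> X = {}"
    and cl: "\<And>e u. e \<in> M \<Longrightarrow> u \<in> e \<Longrightarrow> nbh E u \<inter> (\<Union>M \<union> X) \<subseteq> e"
    and N: "induced_matching G N" "\<Union>N \<subseteq> X"
  shows "induced_matching G (M \<union> N) \<and> card (M \<union> N) = card M + card N"
proof -
  have NE: "N \<subseteq> E" "pairwise disjnt N" using N(1) unfolding induced_matching_iff by auto
  have ne: "e \<noteq> {}" if "e \<in> E" for e using that E_card by fastforce
  have dis: "disjnt e d" if "e \<in> M" "d \<in> N" for e d
    using that M(3) N(2) unfolding disjnt_def by blast
  have "M \<inter> N = {}"
  proof (rule ccontr)
    assume "M \<inter> N \<noteq> {}"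
    then obtain e where "e \<in> M" "e \<in> N" by blast
    then show False using dis[of e e] ne[of e] M(1) unfolding disjnt_def by blast
  qed
  then have c: "card (M \<union> N) = card M + card N"
    using M(1) NE(1) finite_E finite_subset by (metis card_Un_disjoint)
  have "pairwise disjnt (M \<union> N)"
  proof (rule pairwiseI)
    fix x y assume "x \<in> M \<union> N" "y \<in> M \<union> N" and xy: "x \<noteq> y"
    then consider "x \<in> M" "y \<in> M" | "x \<in> M" "y \<in> N" | "x \<in> N" "y \<in> M" | "x \<in> N" "y \<in> N" by blast
    then show "disjnt x y"
    proof cases
      case 1
      then show ?thesis using M(2) xy by (simp add: pairwise_def)
    next
      case 2
      then show ?thesis by (rule dis)
    next
      case 3
      then show ?thesis by (intro disjnt_sym[OF dis])
    next
      case 4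
      then show ?thesis using NE(2) xy by (simp add: pairwise_def)
    qed
  qed
  moreover have "e \<in> M \<union> N" if e: "e \<in> E" "e \<subseteq> \<Union>(M \<union> N)" for e
  proof (cases "e \<inter> \<Union>M = {}")
    case True
    then have "e \<subseteq> \<Union>N" using e(2) by auto
    then show ?thesis using N(1) e(1) unfolding induced_matching_iff by blast
  next
    case False
    then obtain u d where u: "u \<in> e" "d \<in> M" "u \<in> d" by blast
    obtain w where w: "e = {w, u}" "w \<noteq> u" "w \<in> nbh E u" using edgeE[OF e(1) u(1)] .
    have "w \<in> \<Union>M \<union> X" using e(2) w N(2) by auto
    then have "w \<in> d" using cl[OF u(2,3)] w(3) by blast
    moreover have "d \<in> E" using u(2) M(1) by blast
    then obtain w' where "d = {w', u}" using u(3) by (rule edgeE)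
    ultimately have "d = e" using w by auto
    then show ?thesis using u by simp
  qed
  ultimately show ?thesis using c M(1) NE(1) unfolding induced_matching_iff by blast
qed

end

section \<open>Largest induced matchings of a cycle\<close>

context chordless_cycle
begin

text \<open>A largest induced matching of the cycle: edges start at positions 0, 3, 6 and so on,
  each followed by a free vertex, the last one included, so nothing clashes where the cycle
  closes.\<close>

definition third_edges :: "'v set set" where
  "third_edges = (\<lambda>t. {f (3 * t), f (Suc (3 * t))}) ` {..<n div 3}"

lemma third_index: "t < n div 3 \<Longrightarrow> Suc (Suc (3 * t)) < n"
  by presburger

lemma third_edge_eq:
  assumes "t < n div 3" "s < n div 3" "{f (3 * t), f (Suc (3 * t))} \<inter> {f (3 * s), f (Suc (3 * s))} \<noteq> {}"
  shows "t = s"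
proof -
  have "3 * t = 3 * s \<or> 3 * t = Suc (3 * s) \<or> Suc (3 * t) = 3 * s \<or> Suc (3 * t) = Suc (3 * s)"
    using assms(3) inj_eq third_index[OF assms(1)] third_index[OF assms(2)] by auto
  then show ?thesis by presburger
qed

lemma card_third_edges: "card third_edges = n div 3"
  unfolding third_edges_def
proof (subst card_image)
  show "inj_on (\<lambda>t. {f (3 * t), f (Suc (3 * t))}) {..<n div 3}"
    by (rule inj_onI, rule third_edge_eq) auto
qed simp

lemma third_edges_sub: "third_edges \<subseteq> E" "\<Union>third_edges \<subseteq> f ` {..<n}"
  unfolding third_edges_def using adj third_index by (auto dest!: third_index)

lemma third_edges_disjoint: "pairwise disjnt third_edges"
  unfolding third_edges_def using third_edge_eq
  by (auto simp: pairwise_def disjnt_def)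

lemma third_edges_induced:
  assumes e: "e \<in> E" "e \<subseteq> \<Union>third_edges"
  shows "e \<in> third_edges"
proof -
  \<comment> \<open>\<open>Suc i < n\<close> keeps the last position of the cycle free, so an edge
    between two covered vertices cannot be the closing one.\<close>
  have third: "\<exists>i. x = f i \<and> Suc i < n \<and> i mod 3 \<noteq> 2" if x: "x \<in> \<Union>third_edges" for x
  proof -
    obtain t where t: "t < n div 3" "x = f (3 * t) \<or> x = f (Suc (3 * t))"
      using x unfolding third_edges_def by auto
    have "3 * t mod 3 \<noteq> 2" "Suc (3 * t) mod 3 \<noteq> 2" by presburger+
    then show ?thesis using t(2) third_index[OF t(1)] by (metis Suc_lessD)
  qed
  have step: "{f i, f (Suc i)} \<in> third_edges"
    if "Suc i < n" "i mod 3 \<noteq> 2" "Suc i mod 3 \<noteq> 2" "Suc (Suc i) < n" for i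
  proof -
    have "i mod 3 = 0" using that(2,3) by presburger
    then obtain t where t: "i = 3 * t" by (metis mod_0_imp_dvd dvdE)
    then have "t < n div 3" using that(4) by linarith
    then show ?thesis unfolding third_edges_def t by blast
  qed
  obtain a b where ab: "e = {a, b}" using e(1) edge_card by (auto simp: card_2_iff)
  obtain i where i: "a = f i" "Suc i < n" "i mod 3 \<noteq> 2" using third[of a] e(2) ab by auto
  obtain k where k: "b = f k" "Suc k < n" "k mod 3 \<noteq> 2" using third[of b] e(2) ab by auto
  have "k = Suc i \<or> i = Suc k" using adj[of i k] e(1) ab i k by auto
  then show ?thesis
  proof
    assume "k = Suc i"
    then show ?thesis using step[of i] i k ab by auto
  next
    assume "i = Suc k"
    then show ?thesis using step[of k] i k ab by (auto simp: insert_commute)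
  qed
qed

text \<open>If \<open>s\<close> is the rotation and \<open>A\<close> the set of initial vertices of the matching edges, then
  \<open>A\<close> and its images under \<open>s\<close> and \<open>s \<circ> s\<close> are disjoint.\<close>

lemma card_matching_le:
  assumes N: "N \<subseteq> E" "pairwise disjnt N" "\<And>e. e \<in> E \<Longrightarrow> e \<subseteq> \<Union>N \<Longrightarrow> e \<in> N" "\<Union>N \<subseteq> f ` {..<n}"
  shows "card N \<le> n div 3"
proof -
  define s where "s i = Suc i mod n" for i
  define g where "g i = {f i, f (s i)}" for i
  have s: "s i < n" "s i \<noteq> i" "s (s i) \<noteq> i" if "i < n" for i
    using that n3 unfolding s_def by (auto simp: mod_Suc)
  have s_inj: "inj_on s {..<n}"
    unfolding s_def by (rule inj_onI) (auto simp: mod_Suc split: if_splits)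
  define A where "A = {i\<in>{..<n}. g i \<in> N}"
  have "N \<subseteq> g ` A"
  proof
    fix e assume e: "e \<in> N"
    have eE: "e \<in> E" using e N(1) by blast
    then obtain a b where ab: "e = {a, b}" using edge_card by (auto simp: card_2_iff)
    have "a \<in> f ` {..<n}" "b \<in> f ` {..<n}" using e ab N(4) by auto
    then obtain i k where ik: "a = f i" "i < n" "b = f k" "k < n" by auto
    have "k = s i \<or> i = s k" using adj[of i k] e N(1) ab ik unfolding s_def by auto
    then have "e = g i \<or> e = g k" unfolding g_def ab ik by auto
    then show "e \<in> g ` A" using e ik unfolding A_def by auto
  qed
  moreover have fA: "finite A" unfolding A_def by simp
  ultimately have "card N \<le> card A" by (intro surj_card_le)
  \<comment> \<open>Edges starting at consecutive positions share a vertex but are distinct, as n is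
    at least 3.\<close>
  have clash: False if "i < n" "g i \<in> N" "g (s i) \<in> N" for i
  proof -
    have "g i \<noteq> g (s i)"
    proof
      assume "g i = g (s i)"
      then have "f i = f (s i) \<or> f i = f (s (s i))" unfolding g_def by auto
      then show False using inj_eq s that(1) by metis
    qed
    then have "disjnt (g i) (g (s i))" using N(2) that by (auto simp: pairwise_def)
    then show False unfolding disjnt_def g_def by auto
  qed
  have A1: "A \<inter> s ` A = {}" using clash unfolding A_def by auto
  have "s ` A \<subseteq> {..<n}" "A \<subseteq> {..<n}" using s unfolding A_def by auto
  then have A2: "s ` A \<inter> s ` s ` A = {}"
    using A1 s_inj by (metis image_empty inj_on_image_Int)
  \<comment> \<open>Edges starting two positions apart cover both ends of the edge between them,
    which an induced matching would have to contain; this reduces to the previous clash.\<close>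
  have A3: "A \<inter> s ` s ` A = {}"
  proof (rule ccontr)
    assume "A \<inter> s ` s ` A \<noteq> {}"
    then obtain i where i: "i < n" "g i \<in> N" "g (s (s i)) \<in> N" unfolding A_def by auto
    have "g (s i) \<in> E" unfolding g_def using adj[of "s i" "s (s i)"] s i(1) unfolding s_def by auto
    moreover have "g (s i) \<subseteq> \<Union>N" using i(2,3) unfolding g_def by auto
    ultimately have "g (s i) \<in> N" by (rule N(3))
    then show False using clash[OF i(1,2)] by blast
  qed
  have c1: "card (s ` A) = card A"
    by (rule card_image, rule inj_on_subset[OF s_inj]) (auto simp: A_def)
  have c2: "card (s ` s ` A) = card A"
  proof -
    have "inj_on s (s ` A)" by (rule inj_on_subset[OF s_inj]) (use \<open>s ` A \<subseteq> {..<n}\<close> in auto)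
    then show ?thesis using c1 by (simp add: card_image)
  qed
  have "card (A \<union> (s ` A \<union> s ` s ` A)) = 3 * card A"
    using fA A1 A2 A3 c1 c2 by (subst card_Un_disjoint, simp, simp, blast, subst card_Un_disjoint) auto
  moreover have "A \<union> (s ` A \<union> s ` s ` A) \<subseteq> {..<n}" using s unfolding A_def by auto
  then have "card (A \<union> (s ` A \<union> s ` s ` A)) \<le> n"
    using card_mono[of "{..<n}" "A \<union> (s ` A \<union> s ` s ` A)"] by simp
  ultimately have "3 * card A \<le> n" by simp
  then show ?thesis using \<open>card N \<le> card A\<close> by linarith
qed

end

section \<open>Extremal face sizes with cohomology, and the set Gamma\<close>

context unicyclic_graph
begin

abbreviation "nu \<equiv> induced_matching_number G"
abbreviation "nu' \<equiv> induced_matching_number (induced_subgraph G (V - Gamma_set G C))"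

text \<open>Completing M by every third edge of C gives an induced matching N of G, and p exceeds
  its size by at most one, namely when C is present with residue 2. Equality forces N to be a
  largest induced matching, and N avoids Gamma.\<close>

lemma cohom_nz_bound:
  assumes W: "W \<subseteq> V" and s: "sign_system W \<epsilon>" and nz: "cohom_nz \<epsilon> E W p"
  shows "p \<le> Suc nu" and "p = Suc nu \<Longrightarrow> card (verts C) mod 3 = 2 \<and> nu' = nu"
proof -
  obtain M X q where M: "M \<subseteq> E" "pairwise disjnt M" "\<Union>M \<union> X \<subseteq> W" "\<Union>M \<inter> X = {}"
    "\<And>e u. e \<in> M \<Longrightarrow> u \<in> e \<Longrightarrow> nbh E u \<inter> (\<Union>M \<union> X) \<subseteq> e"
    "X = {} \<or> X = verts C" "p = card M + q" "cohom_nz \<epsilon> E X q"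
    by (rule cohom_nz_reduce[OF W s nz], rule that; assumption)
  have empty: "induced_matching G {}" unfolding induced_matching_iff using E_card by auto
  show "p \<le> Suc nu" "p = Suc nu \<Longrightarrow> card (verts C) mod 3 = 2 \<and> nu' = nu"
  proof (atomize (full), cases "X = {}")
    case True
    then have "q = 0" using M(8) cohom_nz_empty by metis
    moreover have "card M \<le> nu"
      using induced_matching_union[OF M(1,2,4,5) empty] number_ge[of "M \<union> {}"] by simp
    ultimately show "p \<le> Suc nu \<and> (p = Suc nu \<longrightarrow> card (verts C) mod 3 = 2 \<and> nu' = nu)" using M(7) by simp
  next
    case False
    then have X: "X = verts C" using M(6) by blast
    obtain f n where f: "chordless_cycle E f n" "n = card (verts C)" "verts C = f ` {..<n}"
      by (rule C_enum)
    interpret chordless_cycle E f n by (rule f(1))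
    have "sign_system (f ` {..<n}) \<epsilon>" by (rule sign_system_subset[OF s]) (use M(3) X f(3) in auto)
    then have q: "q = (if n mod 3 = 2 then Suc (n div 3) else n div 3)"
      by (rule cohom_nz_cycle(1)) (use M(8) X f(3) in simp)
    have third: "induced_matching G third_edges"
      unfolding induced_matching_iff using third_edges_sub(1) third_edges_disjoint third_edges_induced by blast
    have tX: "\<Union>third_edges \<subseteq> X" using third_edges_sub(2) X f(3) by simp
    define N where "N = M \<union> third_edges"
    have N: "induced_matching G N" "card N = card M + n div 3"
      using induced_matching_union[OF M(1,2,4,5) third tX] card_third_edges unfolding N_def by auto
    have le: "card N \<le> nu" by (rule number_ge[OF N(1)])
    have "nu' = nu" if "card N = nu"
    proof -
      \<comment> \<open>A vertex of Gamma covered by N lies off C, hence on an edge of M; its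
        neighbour on C would be forced into that edge.\<close>
      have "v \<notin> Gamma_set G C" if v: "v \<in> \<Union>N" for v
      proof
        assume G: "v \<in> Gamma_set G C"
        then obtain u where u: "u \<in> verts C" "{u, v} \<in> E" "v \<notin> verts C" unfolding Gamma_set_def by blast
        then obtain e where e: "e \<in> M" "v \<in> e" using v tX X unfolding N_def by auto
        have "u \<in> nbh E v" using u(2) unfolding nbh_def by simp
        then have "u \<in> e" using M(5)[OF e] u(1) X by blast
        then show False using e(1) M(4) u(1) X by blast
      qed
      moreover have "\<Union>N \<subseteq> V" using N(1) E_sub unfolding induced_matching_iff by blast
      ultimately have "\<Union>N \<subseteq> V - Gamma_set G C" by blast
      then have "nu \<le> nu'" using number_sub_ge[OF N(1)] that by simp
      then show ?thesis using number_sub_le by (simp add: le_antisym)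
    qed
    then show "p \<le> Suc nu \<and> (p = Suc nu \<longrightarrow> card (verts C) mod 3 = 2 \<and> nu' = nu)"
      using q le N(2) M(7) f(2) by auto
  qed
qed

text \<open>In a largest induced matching avoiding Gamma, trade the edges inside C for the whole
  cycle. At most n div 3 edges are lost while the cycle contributes n div 3 + 1, so p reaches nu +
  1, and by the upper bound not more.\<close>

lemma cohom_nz_attained:
  assumes n: "card (verts C) mod 3 = 2" and eq: "nu' = nu"
  obtains W where "W \<subseteq> V" "Suc (Suc nu) \<le> card W"
    "\<And>\<epsilon> :: 'v \<Rightarrow> 'v set \<Rightarrow> 'a::comm_ring_1. sign_system W \<epsilon> \<Longrightarrow> cohom_nz \<epsilon> E W (Suc nu)"
proof -
  let ?\<Gamma> = "Gamma_set G C"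
  obtain M where M: "induced_matching G M" "\<Union>M \<subseteq> V - ?\<Gamma>" "card M = nu"
    using number_sub_attained[of "V - ?\<Gamma>"] unfolding eq by blast
  obtain f n where f: "chordless_cycle E f n" "n = card (verts C)" "verts C = f ` {..<n}"
    by (rule C_enum)
  interpret chordless_cycle E f n by (rule f(1))
  have ME: "M \<subseteq> E" "pairwise disjnt M" and ind: "\<And>e. e \<in> E \<Longrightarrow> e \<subseteq> \<Union>M \<Longrightarrow> e \<in> M"
    using M(1) unfolding induced_matching_iff by auto
  have fM: "finite M" using ME(1) finite_E by (rule finite_subset)
  define N where "N = {e\<in>M. e \<subseteq> verts C}"
  define M' where "M' = M - N"
  \<comment> \<open>A neighbour off C of a vertex of C lies in Gamma, which M avoids. So no edge of
    the graph joins C to a vertex off C covered by M.\<close>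
  have out: "u \<notin> verts C" if "w \<in> nbh E u" "u \<in> verts C \<Longrightarrow> w \<in> \<Union>M" "w \<notin> verts C" for u w
  proof
    assume "u \<in> verts C"
    moreover have "{u, w} \<in> E" using that(1) unfolding nbh_def by (simp add: insert_commute)
    moreover have "w \<in> V" using E_sub[OF calculation(2)] by simp
    ultimately have "w \<in> ?\<Gamma>" using that(3) unfolding Gamma_set_def by blast
    then show False using that(2) \<open>u \<in> verts C\<close> M(2) by blast
  qed
  have M'C: "e \<inter> verts C = {}" if e: "e \<in> M'" for e
  proof (rule ccontr)
    assume "e \<inter> verts C \<noteq> {}"
    then obtain u where u: "u \<in> e" "u \<in> verts C" by blast
    have eE: "e \<in> E" using e ME(1) unfolding M'_def by blast
    obtain w where w: "e = {w, u}" "w \<noteq> u" "w \<in> nbh E u" by (rule edgeE[OF eE u(1)])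
    have "w \<notin> verts C" using e w u unfolding M'_def N_def by auto
    moreover have "w \<in> \<Union>M" using e w unfolding M'_def by auto
    ultimately show False using out[OF w(3)] u(2) by blast
  qed
  have cN: "card N \<le> n div 3"
  proof (rule card_matching_le)
    show "N \<subseteq> E" "\<Union>N \<subseteq> f ` {..<n}" using ME unfolding N_def f(3) by auto
    show "pairwise disjnt N" using ME(2) unfolding N_def pairwise_def by auto
    fix e assume e: "e \<in> E" "e \<subseteq> \<Union>N"
    then show "e \<in> N" using ind[OF e(1)] unfolding N_def by blast
  qed
  have cM: "card M' + card N = nu"
    using card_Diff_subset[of N M] fM M(3) card_mono[of M N] unfolding M'_def N_def by (auto intro: finite_subset)
  define X where "X = verts C"
  have MX: "\<Union>M' \<inter> X = {}" using M'C unfolding X_def by auto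
  have cl: "nbh E u \<inter> (\<Union>M' \<union> X) \<subseteq> e" if e: "e \<in> M'" "u \<in> e" for e u
  proof
    fix w assume w: "w \<in> nbh E u \<inter> (\<Union>M' \<union> X)"
    have uM: "u \<in> \<Union>M" "u \<notin> verts C" using e M'C unfolding M'_def by auto
    have "w \<notin> verts C" using out[of u w] w uM nbh_sym[of u E w] by blast
    then have "w \<in> \<Union>M" using w unfolding X_def M'_def by auto
    moreover have wE: "{w, u} \<in> E" using w unfolding nbh_def by simp
    ultimately have wuM: "{w, u} \<in> M" using ind[OF wE] uM by simp
    have eM: "e \<in> M" using e(1) unfolding M'_def by simp
    have "{w, u} = e \<or> disjnt {w, u} e" using pairwiseD[OF ME(2) wuM eM] by blast
    then show "w \<in> e" using e(2) unfolding disjnt_def by auto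
  qed
  have M'V: "\<Union>M' \<subseteq> V"
  proof (rule Union_least)
    fix e assume "e \<in> M'"
    then show "e \<subseteq> V" using ME(1) unfolding M'_def by (intro E_sub) auto
  qed
  have fin: "finite (\<Union>M')" "finite X"
    using finite_subset[OF M'V finite_V] unfolding X_def f(3) by simp_all
  have M'E: "M' \<subseteq> E" "pairwise disjnt M'" "finite M'"
    using ME fM unfolding M'_def pairwise_def by auto
  define W where "W = \<Union>M' \<union> X"
  have WV: "W \<subseteq> V" using M'V C_props(2) unfolding W_def X_def by simp
  have nz: "cohom_nz \<epsilon> E W (card M' + Suc (n div 3))" if s: "sign_system W \<epsilon>"
    for \<epsilon> :: "'v \<Rightarrow> 'v set \<Rightarrow> 'a"
  proof -
    have "sign_system (f ` {..<n}) \<epsilon>"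
      by (rule sign_system_subset[OF s]) (use f(3) in \<open>auto simp: W_def X_def\<close>)
    moreover have "n mod 3 = 2" using n unfolding f(2)[symmetric] .
    ultimately have "cohom_nz \<epsilon> E X (Suc (n div 3))"
      unfolding X_def f(3) by (rule cohom_nz_cycle(2))
    moreover have "cohom_nz \<epsilon> E (\<Union>M' \<union> X) (card M' + Suc (n div 3)) \<longleftrightarrow>
        (\<exists>q. card M' + Suc (n div 3) = card M' + q \<and> cohom_nz \<epsilon> E X q)"
      by (rule cohom_nz_matching[OF M'E(3,1,2) fin(2) MX cl s[unfolded W_def]])
    ultimately show ?thesis unfolding W_def by blast
  qed
  \<comment> \<open>One concrete sign system suffices: the equality obtained from the bound concerns
    only cardinalities.\<close>
  obtain \<epsilon> :: "'v \<Rightarrow> 'v set \<Rightarrow> 'a" where "sign_system W \<epsilon>"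
    using sign_system_exists[OF finite_subset[OF WV finite_V]] by blast
  then have "card M' + Suc (n div 3) \<le> Suc nu" using cohom_nz_bound(1)[OF WV _ nz] by blast
  then have p: "card M' + Suc (n div 3) = Suc nu" using cM cN by linarith
  \<comment> \<open>Needed for a homological index i = card W - p - 1 that is not negative, where p
    = Suc nu.\<close>
  have "Suc (Suc nu) \<le> card W"
  proof -
    have "card (\<Union>M') = 2 * card M'"
      using M'E E_card by (subst card_Union_disjoint) (auto simp: subset_iff intro: card_ge_0_finite)
    moreover have "card W = card (\<Union>M') + n"
      unfolding W_def using card_Un_disjoint[OF fin MX] f(2)[symmetric] unfolding X_def by simp
    moreover have "n div 3 + 2 \<le> n" using n3 by linarith
    ultimately show ?thesis using p by linarith
  qed
  then show thesis using that[OF WV] nz unfolding p by blast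
qed

text \<open>The independence complex of an edge is two points. It accounts for the generators of
  degree 2 and keeps the set of values defining the regularity nonempty.\<close>

lemma cohom_nz_edge:
  assumes e: "e \<in> E" and s: "sign_system e \<epsilon>"
  shows "cohom_nz \<epsilon> E e 1"
proof -
  have "cohom_nz \<epsilon> E (\<Union>{e} \<union> {}) 1 \<longleftrightarrow> (\<exists>q. 1 = card {e} + q \<and> cohom_nz \<epsilon> E {} q)"
    by (rule cohom_nz_matching) (use e s in auto)
  then show ?thesis using E_card by (auto simp: cohom_nz_empty)
qed

end

theorem theorem1p2:
  fixes G C :: "'v sgraph"
  assumes "simple_graph G"
    and "connected_graph G"
    and "unicyclic G"
    and "\<not> cycle_graph G"
    and "C \<in> cycles G"
    and "n = card (verts C)"
  shows "regularity (verts G) (edge_ideal G :: ('v, 'k::field) mpoly set)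
           = int (induced_matching_number G) + 2
         \<longleftrightarrow> n mod 3 = 2 \<and>
           induced_matching_number (induced_subgraph G (verts G - Gamma_set G C))
             = induced_matching_number G"
proof -
  have "cycles G = {C}" using assms(3,5) unfolding unicyclic_def by blast
  then interpret unicyclic_graph G C using assms(1) by unfold_locales
  obtain \<epsilon> :: "'v \<Rightarrow> 'v set \<Rightarrow> 'k" where \<epsilon>: "sign_system V \<epsilon>"
    using sign_system_exists[OF finite_V] by blast
  have s: "sign_system W (csign \<epsilon> W)" if "W \<subseteq> V" for W
    by (rule sign_system_csign[OF sign_system_subset[OF \<epsilon> that]])
  define R where "R = {j - int i | i j. Tor_nonzero V (edge_ideal G :: ('v, 'k) mpoly set) i j}"
  have reg: "regularity V (edge_ideal G :: ('v, 'k) mpoly set) = Max R"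
    unfolding regularity_def R_def ..
  \<comment> \<open>Here j = card W = p + Suc i, so j - i = p + 1, and \<open>p < card W\<close>
    says that such an i exists.\<close>
  have R: "x \<in> R \<longleftrightarrow> (\<exists>W p. W \<subseteq> V \<and> p < card W \<and> x = int p + 1 \<and> cohom_nz (csign \<epsilon> W) E W p)" for x
  proof
    assume "x \<in> R"
    then obtain i j where x: "x = j - int i" and nz: "Tor_nonzero V (edge_ideal G :: ('v, 'k) mpoly set) i j"
      unfolding R_def by blast
    obtain W p where W: "W \<subseteq> V" "card W = p + Suc i" "int (card W) = j" "cohom_nz (csign \<epsilon> W) E W p"
      using nz unfolding Tor_nonzero_edge_ideal_iff[OF assms(1) \<epsilon>] by blast
    have "p < card W" "x = int p + 1" using W(2,3) x by linarith+
    then show "\<exists>W p. W \<subseteq> V \<and> p < card W \<and> x = int p + 1 \<and> cohom_nz (csign \<epsilon> W) E W p"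
      using W(1,4) by blast
  next
    assume "\<exists>W p. W \<subseteq> V \<and> p < card W \<and> x = int p + 1 \<and> cohom_nz (csign \<epsilon> W) E W p"
    then obtain W p where W: "W \<subseteq> V" "p < card W" "x = int p + 1" "cohom_nz (csign \<epsilon> W) E W p" by blast
    define i where "i = card W - Suc p"
    have i: "card W = p + Suc i" "x = int (card W) - int i" using W(2,3) unfolding i_def by linarith+
    have "Tor_nonzero V (edge_ideal G :: ('v, 'k) mpoly set) i (int (card W))"
      unfolding Tor_nonzero_edge_ideal_iff[OF assms(1) \<epsilon>] using W(1,4) i(1) by blast
    then show "x \<in> R" unfolding R_def using i(2) by blast
  qed
  \<comment> \<open>\<open>Max\<close> is meaningful only for a finite nonempty set. Finiteness
    holds because p is smaller than the number of vertices of W.\<close>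
  have "R \<subseteq> (\<lambda>p. int p + 1) ` {..card V}"
  proof
    fix x assume "x \<in> R"
    from R[THEN iffD1, OF this] obtain W p where W: "W \<subseteq> V" "p < card W" "x = int p + 1" by blast
    have "p \<le> card V" using W(2) card_mono[OF finite_V W(1)] by linarith
    then show "x \<in> (\<lambda>p. int p + 1) ` {..card V}" using W(3) by blast
  qed
  then have fin: "finite R" by (rule finite_subset) simp
  have upper: "x \<le> int nu + 2" if x: "x \<in> R" for x
  proof -
    obtain W p where W: "W \<subseteq> V" "x = int p + 1" "cohom_nz (csign \<epsilon> W) E W p"
      using R[THEN iffD1, OF x] by blast
    show ?thesis using cohom_nz_bound(1)[OF W(1) s[OF W(1)] W(3)] W(2) by linarith
  qed
  \<comment> \<open>An edge of C, taken as W with p = 1, gives the element 2.\<close>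
  have ne: "R \<noteq> {}"
  proof -
    obtain f m where f: "chordless_cycle E f m" "m = card (verts C)" "verts C = f ` {..<m}" by (rule C_enum)
    interpret chordless_cycle E f m by (rule f(1))
    define e where "e = {f 0, f 1}"
    have e: "e \<in> E" unfolding e_def using adj[of 0 1] n3 by simp
    have eV: "e \<subseteq> V" by (rule E_sub[OF e])
    have "1 < card e" using e E_card by auto
    then have "int 1 + 1 \<in> R"
      by (intro R[THEN iffD2] exI[of _ e] exI[of _ 1] conjI eV refl cohom_nz_edge[OF e s[OF eV]])
    then show ?thesis by blast
  qed
  show ?thesis
    unfolding reg assms(6)
  proof
    assume eq: "Max R = int nu + 2"
    then have "int nu + 2 \<in> R" using Max_in[OF fin ne] by simp
    from R[THEN iffD1, OF this] obtain W p where
      W: "W \<subseteq> V" "int nu + 2 = int p + 1" "cohom_nz (csign \<epsilon> W) E W p" by blast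
    have "p = Suc nu" using W(2) by linarith
    then show "card (verts C) mod 3 = 2 \<and> nu' = nu"
      by (rule cohom_nz_bound(2)[OF W(1) s[OF W(1)] W(3)])
  next
    assume h: "card (verts C) mod 3 = 2 \<and> nu' = nu"
    obtain W where W: "W \<subseteq> V" "Suc (Suc nu) \<le> card W"
      "\<And>\<epsilon> :: 'v \<Rightarrow> 'v set \<Rightarrow> 'k. sign_system W \<epsilon> \<Longrightarrow> cohom_nz \<epsilon> E W (Suc nu)"
      by (rule cohom_nz_attained[OF conjunct1[OF h] conjunct2[OF h]], rule that; assumption)
    have "cohom_nz (csign \<epsilon> W) E W (Suc nu)" by (rule W(3)[OF s[OF W(1)]])
    moreover have "Suc nu < card W" "int nu + 2 = int (Suc nu) + 1" using W(2) by linarith+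
    ultimately have "int nu + 2 \<in> R"
      by (intro R[THEN iffD2] exI[of _ W] exI[of _ "Suc nu"] conjI W(1))
    then show "Max R = int nu + 2" using upper by (intro Max_eqI[OF fin])
  qed
qed

end
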